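(* For every real number $d\neq 0$, every compact set $K\subset D$ with connected complement and every $\varepsilon>0$, it holds that \[ \liminf_{T\to\infty}\frac{1}{T}\,\mu\Bigl\{\tau\in[0,T] : \sup_{s\in K}\bigl|\log\zeta(s+i\tau)-\log\zeta(s+id\tau)\bigr|<\varepsilon\Bigr\}>0 . \]
   Context: $\zeta(s)$ is the Riemann zeta function. $D:=\{s\in\mathbb{C}: 1/2<\Re(s)<1\}$. $\mu\{A\}$ denotes the Lebesgue measure of a measurable set $A\subset\mathbb{R}$. $\log\zeta(s)$ denotes the logarithm of the zeta function, given for $\Re s>1$ by $\sum_p\sum_{k\ge1}k^{-1}p^{-ks}$ and extended by analytic continuation along horizontal line segments from the right (defined at points not lying on a horizontal segment extending to the left from a zero or the pole of $\zeta$); the inequality in the set is understood to require that both logarithms be defined on $K$. *)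

theory Defs
  imports "HOL-Complex_Analysis.Complex_Analysis" "HOL-Computational_Algebra.Primes"
begin

text \<open>
  The Riemann zeta function, as the unique analytic continuation of its Dirichlet series to the
  plane without the pole; the value at the pole is set to \<open>0\<close> so that the description is unique.
\<close>
definition zeta :: "complex \<Rightarrow> complex" where
  "zeta = (THE f. f holomorphic_on (- {1}) \<and> f 1 = 0 \<and>
             (\<forall>s. Re s > 1 \<longrightarrow> f s = (\<Sum>n. 1 / of_nat (Suc n) powr s)))"

definition log_zeta_series :: "complex \<Rightarrow> complex" where
  "log_zeta_series s =
     (\<Sum>\<^sub>\<infinity>p\<in>{p::nat. prime p}. \<Sum>\<^sub>\<infinity>k\<in>{1::nat..}. of_nat p powr (- (of_nat k * s)) / of_nat k)"

definition right_ray :: "complex \<Rightarrow> complex set" where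
  "right_ray s = {z. Im z = Im s \<and> Re s \<le> Re z}"

text \<open>
  The complement of all horizontal rays running to the left from a zero or the pole of \<open>zeta\<close>.
\<close>
definition log_zeta_dom :: "complex set" where
  "log_zeta_dom = {s. \<forall>\<rho>. \<rho> = 1 \<or> zeta \<rho> = 0 \<longrightarrow> \<rho> \<notin> right_ray s}"

text \<open>
  The value at \<open>s\<close> of the analytic continuation of the series along the horizontal line from the
  right: \<open>g\<close> continues the series to a connected open neighbourhood of the ray from \<open>s\<close> to the right.
  By the identity theorem the value \<open>g s\<close> does not depend on the choice of \<open>U\<close> and \<open>g\<close>; such a
  continuation exists when \<open>s \<in> log_zeta_dom\<close>, and the value is meaningful only there.
\<close>
definition log_zeta :: "complex \<Rightarrow> complex" where
  "log_zeta s = (THE w. \<exists>U g. open U \<and> connected U \<and> right_ray s \<subseteq> U \<and> g holomorphic_on U \<and>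
                   (\<forall>z\<in>U. Re z > 1 \<longrightarrow> g z = log_zeta_series z) \<and> g s = w)"

end

theory Submission imports Defs begin

text \<open>
  Let \<open>S\<close> be the set of primes up to \<open>N\<close> and split \<open>log \<zeta>\<close> into the Euler factors at \<open>S\<close> and the logarithm of
  \<open>\<zeta>\<^sub>S = \<zeta> \<cdot> (\<Prod>p\<in>S. 1 - p\<^sup>-\<^sup>s)\<close>. The first part nearly agrees at \<open>s + i\<tau>\<close> and \<open>s + id\<tau>\<close> as soon as all
  \<open>p\<close> to the power \<open>i(1-d)\<tau>\<close>, \<open>p \<in> S\<close>, are close to 1, which is detected by the trigonometric polynomial
  \<open>W(\<tau>) = (\<Prod>p\<in>S. ((1 + cos ((1-d) \<tau> ln p)) / 2)^m)\<close>: away from such \<open>\<tau>\<close> it is at most \<open>\<kappa>^m\<close> with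
  \<open>\<kappa> < 1\<close>, while its mean decays only polynomially in \<open>m\<close>.

  For the second part one shows that \<open>\<zeta>\<^sub>S - 1\<close> is small in mean square with respect to the weight \<open>W\<close>. Without
  weight, \<open>\<zeta>\<close> is approximated in mean square on \<open>Re s > 1/2\<close> by finite Dirichlet polynomials. On a fixed
  Dirichlet polynomial with frequencies \<open>ln n\<close>, \<open>n\<close> free of primes in \<open>S\<close>, the weight acts as its mean, provided
  no difference of two such frequencies, multiplied by 1 or \<open>d\<close>, is a frequency of \<open>W\<close>. For rational \<open>d\<close> this
  is unique factorisation. For irrational \<open>d\<close> it holds for all large \<open>N\<close>: otherwise there are three
  multiplicatively independent rationals with rational powers to the same irrational exponent, which
  contradicts the six exponentials theorem.

  Smallness in mean square gives smallness uniformly on compact sets by Cauchy's formula; in particular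
  \<open>\<zeta>\<close> then has no zeros to the right of \<open>K + i\<tau>\<close> and \<open>K + id\<tau>\<close>.
\<close>

section \<open>Analytic continuation of the zeta function\<close>

text \<open>Unweighted mean squares do not suffice. The tail left by the primes beyond N has mean
  square about N^(1 - 2 \<sigma>), whereas the \<tau> at which all phases up to N nearly return have
  a density that shrinks far faster in N, so the tail might be large exactly there. Measured against
  W, the tail costs only a small multiple of the mean of W. The other error, from replacing
  \<open>zeta\<close> by a Dirichlet polynomial, is not proportional to W and must be small against
  that mean; it can be, since the length of the polynomial is chosen after N and m. The shifts
  \<tau> and d \<tau> produce frequencies ln n and d ln n, the weight produces (1 - d) ln (P / P')
  with P, P' composed of primes up to N. Hence resonance means ln (n / n') = \<beta> ln (P / P')
  with \<beta> = 1 - d or (1 - d) / d. For irrational \<beta> unique factorisation says nothing, and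
  the six exponentials theorem excludes only three independent relations at a time. This is why N
  must be large: it has to pass the primes of at most two exceptional relations.\<close>

definition dirichlet_zeta :: "complex \<Rightarrow> complex" where
  "dirichlet_zeta s = (\<Sum>n. 1 / of_nat (Suc n) powr s)"

text \<open>Remainder after order \<open>M\<close> of the Taylor expansion of u^(1 - s) at u = n,
  taken at u = n + 1. It is of size n^(-Re s - M), so its sum over n converges for Re s > 1 - M;
  this gain is the source of the continuation.\<close>

definition taylor_rem :: "nat \<Rightarrow> nat \<Rightarrow> complex \<Rightarrow> complex" where
  "taylor_rem M n s = of_nat (Suc n) powr (1 - s) -
     (\<Sum>k\<le>M. (\<Prod>j<k. 1 - s - of_nat j) * of_nat n powr (1 - s - of_nat k) / fact k)"

lemma norm_nat_powr [simp]: "cmod (of_nat n powr s) = real n powr Re s"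
  by (simp add: norm_powr_real_powr)

lemma powr_le_two_powr_abs:
  fixes a u :: real
  assumes "n \<ge> 1" "real n \<le> u" "u \<le> real n + 1"
  shows "u powr a \<le> 2 powr \<bar>a\<bar> * real n powr a"
proof -
  define v where "v = u / real n"
  have v: "1 \<le> v" "v \<le> 2" using assms by (auto simp: v_def field_simps)
  have "v powr a \<le> v powr \<bar>a\<bar>" using v by (intro powr_mono) auto
  also have "\<dots> \<le> 2 powr \<bar>a\<bar>" using v by (intro powr_mono2) auto
  finally have "v powr a \<le> 2 powr \<bar>a\<bar>" .
  moreover have "u = v * real n" using assms by (simp add: v_def)
  ultimately show ?thesis using v by (simp add: powr_mult mult_right_mono)
qed

text \<open>Taylor's theorem on the segment from n to n + 1: derivative number M + 1 of u^(1 - s) is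
  bounded there by its size at n, up to a power of 2. The factor 1 / M! is estimated by 1.\<close>

lemma taylor_rem_bound:
  assumes "n \<ge> 1"
  shows "cmod (taylor_rem M n s) \<le>
    (\<Prod>j<Suc M. cmod (1 - s - of_nat j)) * 2 powr \<bar>Re s + real M\<bar> * real n powr (- Re s - real M)"
proof -
  define S where "S = closed_segment (of_nat n :: complex) (of_nat (Suc n))"
  define f where "f = (\<lambda>k u. (\<Prod>j<k. 1 - s - of_nat j) * u powr (1 - s - of_nat k))"
  define B where "B = (\<Prod>j<Suc M. cmod (1 - s - of_nat j)) * (2 powr \<bar>Re s + real M\<bar> * real n powr (- Re s - real M))"
  have Sx: "\<exists>u. x = of_real u \<and> real n \<le> u \<and> u \<le> real n + 1" if "x \<in> S" for x
  proof -
    have "S = of_real ` closed_segment (real n) (real (Suc n))"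
      unfolding S_def by (simp flip: closed_segment_of_real)
    with that show ?thesis by (auto simp: closed_segment_eq_real_ivl)
  qed
  have "cmod (f 0 (of_nat (Suc n)) - (\<Sum>k\<le>M. f k (of_nat n) * (of_nat (Suc n) - of_nat n) ^ k / fact k))
     \<le> B * cmod (of_nat (Suc n) - of_nat n) ^ Suc M / fact M"
  proof (rule complex_Taylor)
    show "convex S" by (simp add: S_def)
    show "of_nat n \<in> S" "of_nat (Suc n) \<in> S" by (auto simp: S_def)
  next
    fix i x assume "x \<in> S" "i \<le> M"
    then obtain u where u: "x = of_real u" "real n \<le> u" using Sx by blast
    hence "x \<notin> \<real>\<^sub>\<le>\<^sub>0" using assms by auto
    thus "(f i has_field_derivative f (Suc i) x) (at x within S)"
      unfolding f_def by (auto intro!: derivative_eq_intros simp: algebra_simps)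
  next
    fix x assume "x \<in> S"
    then obtain u where u: "x = of_real u" "real n \<le> u" "u \<le> real n + 1" using Sx by blast
    have "cmod (x powr (1 - s - of_nat (Suc M))) = u powr (- Re s - real M)"
      using u assms by (simp add: norm_powr_real_powr)
    also have "\<dots> \<le> 2 powr \<bar>- Re s - real M\<bar> * real n powr (- Re s - real M)"
      using powr_le_two_powr_abs assms u by blast
    also have "\<bar>- Re s - real M\<bar> = \<bar>Re s + real M\<bar>" by linarith
    finally show "cmod (f (Suc M) x) \<le> B"
      unfolding f_def B_def norm_mult prod_norm[symmetric] by (intro mult_left_mono prod_nonneg) auto
  qed
  also have "\<dots> \<le> B"
  proof -
    have "B \<ge> 0" unfolding B_def by (intro mult_nonneg_nonneg prod_nonneg) auto
    hence "B * 1 \<le> B * fact M" by (intro mult_left_mono fact_ge_1)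
    thus ?thesis by (simp add: divide_le_eq)
  qed
  finally show ?thesis by (simp add: f_def taylor_rem_def B_def mult.assoc)
qed

lemma holomorphic_suminf:
  fixes f :: "nat \<Rightarrow> complex \<Rightarrow> complex"
  assumes "open A" "\<And>n. f n holomorphic_on A"
    and "\<And>x. x \<in> A \<Longrightarrow> \<exists>d h. d > 0 \<and> cball x d \<subseteq> A \<and> summable h \<and> (\<forall>n. \<forall>y\<in>cball x d. norm (f n y) \<le> h n)"
  shows "(\<lambda>s. \<Sum>n. f n s) holomorphic_on A"
proof (rule holomorphic_uniform_sequence[OF assms(1), where f = "\<lambda>n s. \<Sum>k<n. f k s"])
  show "(\<lambda>s. \<Sum>k<n. f k s) holomorphic_on A" for n by (intro holomorphic_on_sum assms(2))
next
  fix x assume "x \<in> A"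
  from assms(3)[OF this]
  obtain d h where d: "d > 0" "cball x d \<subseteq> A" "summable h" "\<forall>n. \<forall>y\<in>cball x d. norm (f n y) \<le> h n"
    by (elim exE conjE)
  have "uniform_limit (cball x d) (\<lambda>n s. \<Sum>k<n. f k s) (\<lambda>s. \<Sum>n. f n s) sequentially"
    by (rule Weierstrass_m_test[OF _ d(3)]) (use d(4) in blast)
  with d show "\<exists>d. 0 < d \<and> cball x d \<subseteq> A \<and>
    uniform_limit (cball x d) (\<lambda>n s. \<Sum>k<n. f k s) (\<lambda>s. \<Sum>n. f n s) sequentially"
    by blast
qed

lemma holomorphic_taylor_rem: "n \<ge> 1 \<Longrightarrow> taylor_rem M n holomorphic_on A"
  unfolding taylor_rem_def by (intro holomorphic_intros) auto

lemma summable_shifted_powr: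
  "a < -1 \<Longrightarrow> summable (\<lambda>n. real (n + X) powr a)"
  by (subst summable_iff_shift) (simp add: summable_real_powr_iff)

lemma taylor_rem_local_bound:
  assumes "X \<ge> 1" "Re x > 1 - real M"
  shows "\<exists>d h. d > 0 \<and> cball x d \<subseteq> {s. Re s > 1 - real M} \<and> summable h \<and>
     (\<forall>n. \<forall>y\<in>cball x d. cmod (taylor_rem M (n + X) y) \<le> h n)"
proof -
  \<comment> \<open>Half the distance to the line Re s = 1 - M: with this radius the exponent -(Re x
    - d) - M still lies below -1, and \<open>h\<close> is summable.\<close>
  define d where "d = (Re x - 1 + real M) / 2"
  have d: "d > 0" using assms by (simp add: d_def)
  define C where "C = (\<Prod>j<Suc M. 1 + (cmod x + d) + real j) * 2 powr (cmod x + d + real M)"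
  define h where "h = (\<lambda>n. C * real (n + X) powr (- (Re x - d) - real M))"
  have re: "\<bar>Re y - Re x\<bar> \<le> d \<and> cmod y \<le> cmod x + d" if "y \<in> cball x d" for y
  proof -
    have "cmod (y - x) \<le> d" using that by (simp add: dist_norm norm_minus_commute)
    moreover have "\<bar>Re (y - x)\<bar> \<le> cmod (y - x)" by (rule abs_Re_le_cmod)
    moreover have "cmod y \<le> cmod x + cmod (y - x)" by (rule norm_triangle_sub)
    ultimately show ?thesis by simp
  qed
  have "cball x d \<subseteq> {s. Re s > 1 - real M}"
  proof
    fix y assume "y \<in> cball x d"
    hence "Re x - d \<le> Re y" using re by fastforce
    thus "y \<in> {s. Re s > 1 - real M}" using assms by (simp add: d_def field_simps)
  qed
  moreover have "summable h"
    unfolding h_def using assms by (intro summable_mult summable_shifted_powr) (simp add: d_def field_simps)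
  moreover have "cmod (taylor_rem M (n + X) y) \<le> h n" if y: "y \<in> cball x d" for n y
  proof -
    have n1: "n + X \<ge> 1" using assms by simp
    have "cmod (taylor_rem M (n + X) y) \<le> ((\<Prod>j<Suc M. cmod (1 - y - of_nat j)) * 2 powr \<bar>Re y + real M\<bar>) * real (n + X) powr (- Re y - real M)"
      using taylor_rem_bound[OF n1] by blast
    also have "\<dots> \<le> C * real (n + X) powr (- (Re x - d) - real M)"
      unfolding C_def
    proof (intro mult_mono prod_mono conjI powr_mono prod_nonneg mult_nonneg_nonneg)
      show "\<bar>Re y + real M\<bar> \<le> cmod x + d + real M"
        using re[OF y] abs_Re_le_cmod[of y] by linarith
      show "- Re y - real M \<le> - (Re x - d) - real M" using re[OF y] by linarith
      fix j
      have "cmod (1 - y - of_nat j) \<le> cmod (1::complex) + cmod y + cmod (of_nat j :: complex)"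
        using norm_triangle_ineq4[of "1 - y" "of_nat j"] norm_triangle_ineq4[of 1 y] by linarith
      thus "cmod (1 - y - of_nat j) \<le> 1 + (cmod x + d) + real j" using re[OF y] by simp
    qed (use d n1 in auto)
    finally show ?thesis by (simp add: h_def)
  qed
  ultimately show ?thesis using d by blast
qed

lemma taylor_rem_summable:
  assumes "X \<ge> 1" "Re s > 1 - real M"
  shows "summable (\<lambda>n. taylor_rem M (n + X) s)"
proof -
  from taylor_rem_local_bound[OF assms] obtain d h where d: "d > 0" "summable h"
    "\<forall>n. \<forall>y\<in>cball s d. cmod (taylor_rem M (n + X) y) \<le> h n" by (elim exE conjE)
  have "s \<in> cball s d" using d(1) by simp
  hence "cmod (taylor_rem M (n + X) s) \<le> h n" for n by (rule d(3)[THEN spec, THEN bspec])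
  thus ?thesis by (intro summable_comparison_test[OF _ d(2)] exI[of _ 0] allI impI)
qed

lemma holomorphic_taylor_rem_series:
  assumes "X \<ge> 1"
  shows "(\<lambda>s. \<Sum>n. taylor_rem M (n + X) s) holomorphic_on {s. Re s > 1 - real M}"
proof (rule holomorphic_suminf)
  show "taylor_rem M (n + X) holomorphic_on {s. Re s > 1 - real M}" for n
    using assms by (intro holomorphic_taylor_rem) auto
  show "open {s. Re s > 1 - real M}" by (rule open_halfspace_Re_gt)
  show "\<exists>d h. d > 0 \<and> cball x d \<subseteq> {s. Re s > 1 - real M} \<and> summable h \<and>
     (\<forall>n. \<forall>y\<in>cball x d. cmod (taylor_rem M (n + X) y) \<le> h n)" if "x \<in> {s. Re s > 1 - real M}" for x
    using that by (intro taylor_rem_local_bound[OF assms]) simp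
qed

lemma dirichlet_zeta_sums:
  assumes "Re s > 1"
  shows "(\<lambda>n. of_nat (Suc n) powr (-s)) sums dirichlet_zeta s"
proof -
  have "summable (\<lambda>n. of_nat (Suc n) powr (-s) :: complex)"
  proof (rule summable_norm_cancel)
    show "summable (\<lambda>n. norm (of_nat (Suc n) powr (-s) :: complex))"
      using assms summable_shifted_powr[of "- Re s" 1] by (simp del: of_nat_Suc)
  qed
  thus ?thesis by (simp add: dirichlet_zeta_def powr_minus_divide summable_sums del: of_nat_Suc)
qed

lemma telescope_nat_powr:
  assumes "Re s > 1" "X \<ge> 1"
  shows "(\<lambda>n. of_nat (Suc (n + X)) powr (1 - s) - of_nat (n + X) powr (1 - s) :: complex) sums (- (of_nat X powr (1 - s)))"
proof -
  have "(\<lambda>n. real (n + X) powr (1 - Re s)) \<longlonglongrightarrow> 0"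
  proof -
    have "filterlim (\<lambda>n. real (n + X)) at_top sequentially"
      by (intro filterlim_compose[OF filterlim_real_sequentially] filterlim_add_const_nat_at_top)
    thus ?thesis using assms by (intro tendsto_neg_powr) auto
  qed
  hence "(\<lambda>n. norm (of_nat (n + X) powr (1 - s) :: complex)) \<longlonglongrightarrow> 0"
    unfolding norm_nat_powr by simp
  hence "(\<lambda>n. of_nat (n + X) powr (1 - s) :: complex) \<longlonglongrightarrow> 0"
    by (rule tendsto_norm_zero_cancel)
  from telescope_sums[OF this] show ?thesis by simp
qed

text \<open>
  Summing the Taylor expansion of \<open>(n + 1)\<^sup>1\<^sup>-\<^sup>s\<close> at \<open>n\<close> over all \<open>n\<close> telescopes on the left; solving for the term
  \<open>k = 1\<close> expresses \<open>(s - 1) \<zeta>(s)\<close> by values of \<open>\<zeta>\<close> further to the right.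
\<close>
lemma dirichlet_zeta_recursion:
  assumes "Re s > 1" "M \<ge> 1"
  shows "(s - 1) * dirichlet_zeta s = 1 + (\<Sum>k\<in>{2..M}. (\<Prod>j<k. 1 - s - of_nat j) / fact k * dirichlet_zeta (s + of_nat k - 1))
           + (\<Sum>n. taylor_rem M (n + 1) s)"
proof -
  let ?c = "\<lambda>k. (\<Prod>j<k. 1 - s - of_nat j) / fact k :: complex"
  have z: "(\<lambda>n. of_nat (n + 1) powr (1 - s - of_nat k)) sums dirichlet_zeta (s + of_nat k - 1)" if "k \<in> {1..M}" for k
  proof -
    have "Re (s + of_nat k - 1) > 1" using that assms by simp
    from dirichlet_zeta_sums[OF this] show ?thesis by (simp add: diff_diff_eq2 minus_diff_eq diff_diff_eq add.commute del: of_nat_Suc)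
  qed
  have "(\<lambda>n. (of_nat (Suc (n + 1)) powr (1 - s) - of_nat (n + 1) powr (1 - s))
         - (\<Sum>k\<in>{1..M}. ?c k * of_nat (n + 1) powr (1 - s - of_nat k))) sums
        (- (of_nat 1 powr (1 - s)) - (\<Sum>k\<in>{1..M}. ?c k * dirichlet_zeta (s + of_nat k - 1)))"
    by (intro sums_diff telescope_nat_powr sums_sum sums_mult z) (use assms in auto)
  moreover have "(of_nat (Suc (n + 1)) powr (1 - s) - of_nat (n + 1) powr (1 - s))
         - (\<Sum>k\<in>{1..M}. ?c k * of_nat (n + 1) powr (1 - s - of_nat k)) = taylor_rem M (n + 1) s" for n
  proof -
    have "{..M} = insert 0 {1..M}" by auto
    thus ?thesis by (simp add: taylor_rem_def algebra_simps)
  qed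
  ultimately have "(\<lambda>n. taylor_rem M (n + 1) s) sums
        (- (of_nat 1 powr (1 - s)) - (\<Sum>k\<in>{1..M}. ?c k * dirichlet_zeta (s + of_nat k - 1)))" by (simp only:)
  hence "(\<Sum>n. taylor_rem M (n + 1) s) = -1 - (\<Sum>k\<in>{1..M}. ?c k * dirichlet_zeta (s + of_nat k - 1))"
    by (simp add: sums_iff)
  moreover have "{1..M} = insert 1 {2..M}" using assms by auto
  ultimately show ?thesis by (simp add: algebra_simps)
qed

text \<open>The function (s - 1) \<zeta>(s) is continued instead of \<zeta>, to have no pole. Each
  induction step gains a strip of width 1, since the recursion refers only to points at least 1
  further to the right.\<close>

lemma zeta_continuation_halfplane:
  "\<exists>E. E holomorphic_on {s. Re s > 1 - real m} \<and> (\<forall>s. Re s > 1 \<longrightarrow> E s = (s - 1) * dirichlet_zeta s)"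
proof (induction m)
  case 0
  have "(\<lambda>s. (s - 1) * dirichlet_zeta s) holomorphic_on {s. Re s > 1 - real 0}"
  proof (rule holomorphic_transform)
    have "(\<lambda>s. \<Sum>n. taylor_rem 1 (n + 1) s) holomorphic_on {s. Re s > 1 - real 0}"
      by (rule holomorphic_on_subset[OF holomorphic_taylor_rem_series]) auto
    thus "(\<lambda>s. 1 + (\<Sum>n. taylor_rem 1 (n + 1) s)) holomorphic_on {s. Re s > 1 - real 0}"
      by (intro holomorphic_on_add holomorphic_on_const)
    fix s :: complex assume "s \<in> {s. Re s > 1 - real 0}"
    thus "1 + (\<Sum>n. taylor_rem 1 (n + 1) s) = (s - 1) * dirichlet_zeta s"
      using dirichlet_zeta_recursion[of s 1] by simp
  qed
  thus ?case by blast
next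
  case (Suc m)
  then obtain E where E: "E holomorphic_on {s. Re s > 1 - real m}"
    "\<And>s. Re s > 1 \<Longrightarrow> E s = (s - 1) * dirichlet_zeta s" by blast
  define M where "M = m + 2"
  let ?A = "{s. Re s > 1 - real (Suc m)}"
  \<comment> \<open>In the recursion the last factor 1 - s - (k - 1) of the product is split off: up
    to sign it is what turns \<zeta>(s + k - 1) into \<open>E (s + of_nat k - 1)\<close>, which is
    holomorphic by induction.\<close>
  define F where "F = (\<lambda>s. 1 + (\<Sum>k\<in>{2..M}. - (\<Prod>j<k-1. 1 - s - of_nat j) / fact k * E (s + of_nat k - 1))
           + (\<Sum>n. taylor_rem M (n + 1) s))"
  have "(\<lambda>s. \<Sum>n. taylor_rem M (n + 1) s) holomorphic_on ?A"
    by (rule holomorphic_on_subset[OF holomorphic_taylor_rem_series]) (auto simp: M_def)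
  moreover have "(\<lambda>s. E (s + of_nat k - 1)) holomorphic_on ?A" if "k \<in> {2..M}" for k
    using holomorphic_on_compose_gen[of "\<lambda>s. s + of_nat k - 1" ?A E, OF _ E(1)] that
    by (force simp: o_def intro!: holomorphic_intros)
  ultimately have "F holomorphic_on ?A" unfolding F_def by (intro holomorphic_intros) auto
  moreover have "F s = (s - 1) * dirichlet_zeta s" if s: "Re s > 1" for s
  proof -
    have "- (\<Prod>j<k-1. 1 - s - of_nat j) / fact k * E (s + of_nat k - 1)
       = (\<Prod>j<k. 1 - s - of_nat j) / fact k * dirichlet_zeta (s + of_nat k - 1)" if "k \<in> {2..M}" for k
    proof -
      from that have "k > 0" by simp
      then obtain k' where k': "k = Suc k'" by (cases k) auto
      have "Re (s + of_nat k - 1) > 1" using that s by auto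
      hence "E (s + of_nat k - 1) = (s + of_nat k' - 1) * dirichlet_zeta (s + of_nat k - 1)"
        using E(2)[of "s + of_nat k - 1"] by (simp add: k' algebra_simps)
      moreover have "(\<Prod>j<k. 1 - s - of_nat j) = - (\<Prod>j<k-1. 1 - s - of_nat j) * (s + of_nat k' - 1)"
        by (simp add: k' algebra_simps)
      ultimately show ?thesis by simp
    qed
    hence "(\<Sum>k\<in>{2..M}. - (\<Prod>j<k-1. 1 - s - of_nat j) / fact k * E (s + of_nat k - 1))
       = (\<Sum>k\<in>{2..M}. (\<Prod>j<k. 1 - s - of_nat j) / fact k * dirichlet_zeta (s + of_nat k - 1))"
      by (intro sum.cong refl)
    moreover have "M \<ge> 1" by (simp add: M_def)
    ultimately show ?thesis using dirichlet_zeta_recursion[OF s, of M] unfolding F_def by simp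
  qed
  ultimately show ?case by blast
qed

lemma holomorphic_eq_from_halfplane:
  assumes "f holomorphic_on A" "g holomorphic_on A" "open A" "connected A" "s \<in> A" "w \<in> A" "Re w > 1"
    and "\<And>s. s \<in> A \<Longrightarrow> Re s > 1 \<Longrightarrow> f s = g s"
  shows "f s = g s"
proof (rule analytic_continuation_open[where s = "A \<inter> {s. Re s > 1}" and s' = A and f = f and g = g])
  show "open (A \<inter> {s. Re s > 1})" using assms by (intro open_Int open_halfspace_Re_gt)
qed (use assms in auto)

lemma zeta_entire:
  "\<exists>E. E holomorphic_on UNIV \<and> (\<forall>s. Re s > 1 \<longrightarrow> E s = (s - 1) * dirichlet_zeta s)"
proof -
  obtain E where "\<forall>m. E m holomorphic_on {s. Re s > 1 - real m} \<and> (\<forall>s. Re s > 1 \<longrightarrow> E m s = (s - 1) * dirichlet_zeta s)"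
    using choice[of "\<lambda>m E. E holomorphic_on {s. Re s > 1 - real m} \<and> (\<forall>s. Re s > 1 \<longrightarrow> E s = (s - 1) * dirichlet_zeta s)"]
      zeta_continuation_halfplane by blast
  hence E: "\<And>m. E m holomorphic_on {s. Re s > 1 - real m}"
    "\<And>m s. Re s > 1 \<Longrightarrow> E m s = (s - 1) * dirichlet_zeta s" by auto
  have le: "E m s = E n s" if "m \<le> n" "Re s > 1 - real m" for m n s
  proof (rule holomorphic_eq_from_halfplane[where A = "{s. Re s > 1 - real m}" and w = 2 and f = "E m" and g = "E n"])
    show "E n holomorphic_on {s. Re s > 1 - real m}"
      by (rule holomorphic_on_subset[OF E(1)]) (use that in auto)
  qed (use that E in \<open>auto simp: open_halfspace_Re_gt connected_halfspace_Re_gt\<close>)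
  \<comment> \<open>The continuations to different half-planes agree where both exist, so any index
    that is large enough for s may be taken.\<close>
  define F where "F = (\<lambda>s. E (nat \<lceil>2 - Re s\<rceil>) s)"
  have F: "F s = E m s" if "Re s > 1 - real m" for m s
  proof -
    have "real (nat \<lceil>2 - Re s\<rceil>) \<ge> 2 - Re s" by linarith
    hence "Re s > 1 - real (nat \<lceil>2 - Re s\<rceil>)" by linarith
    thus ?thesis unfolding F_def using le[of m _ s] le[of _ m s] that by (metis nat_le_linear)
  qed
  have "F holomorphic_on (\<Union>m::nat. {s. Re s > 1 - real m})"
  proof (rule holomorphic_on_UN_open)
    show "F holomorphic_on {s. Re s > 1 - real m}" for m
      using holomorphic_transform[OF E(1)[of m], of F] F by simp
  qed (simp add: open_halfspace_Re_gt)
  moreover have "s \<in> (\<Union>m::nat. {s. Re s > 1 - real m})" for s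
    using reals_Archimedean2[of "1 - Re s"] by (auto simp: algebra_simps)
  hence "(\<Union>m::nat. {s. Re s > 1 - real m}) = UNIV" by blast
  ultimately show ?thesis using F E(2) by (metis less_add_same_cancel1 of_nat_0 diff_zero)
qed

lemma zeta_properties:
  "zeta holomorphic_on (- {1}) \<and> zeta 1 = 0 \<and> (\<forall>s. Re s > 1 \<longrightarrow> zeta s = dirichlet_zeta s)"
proof -
  obtain E where E: "E holomorphic_on UNIV" "\<And>s. Re s > 1 \<Longrightarrow> E s = (s - 1) * dirichlet_zeta s"
    using zeta_entire by blast
  \<comment> \<open>Division by zero yields 0, so \<open>f 1 = 0\<close> holds as the description of
    \<open>zeta\<close> requires.\<close>
  define f where "f = (\<lambda>s. E s / (s - 1))"
  have f: "f holomorphic_on (- {1}) \<and> f 1 = 0 \<and> (\<forall>s. Re s > 1 \<longrightarrow> f s = dirichlet_zeta s)"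
    unfolding f_def using E(2) by (auto intro!: holomorphic_intros holomorphic_on_subset[OF E(1)])
  have "\<exists>!f. f holomorphic_on (- {1}) \<and> f 1 = 0 \<and> (\<forall>s. Re s > 1 \<longrightarrow> f s = dirichlet_zeta s)"
  proof (rule ex1I[of _ f])
    fix g assume g: "g holomorphic_on (- {1}) \<and> g 1 = 0 \<and> (\<forall>s. Re s > 1 \<longrightarrow> g s = dirichlet_zeta s)"
    show "g = f"
    proof
      fix s show "g s = f s"
      proof (cases "s = 1")
        case False
        show ?thesis
          by (rule holomorphic_eq_from_halfplane[where A = "-{1}" and w = 2 and f = g and g = f])
             (use f g False in \<open>auto intro: connected_punctured_universe\<close>)
      qed (use f g in auto)
    qed
  qed (use f in auto)
  from theI'[OF this] show ?thesis unfolding zeta_def dirichlet_zeta_def by blast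
qed

lemmas holomorphic_zeta = zeta_properties[THEN conjunct1]

lemma zeta_eq_dirichlet_zeta: "Re s > 1 \<Longrightarrow> zeta s = dirichlet_zeta s"
  using zeta_properties by blast

text \<open>Euler summation of first order. The case X = 1 is the recursion with M = 1, continued to
  Re s > 0 by the identity theorem; passing to a general X splits off finitely many remainders,
  whose sum telescopes.\<close>

lemma zeta_formula:
  assumes "Re s > 0" "s \<noteq> 1" "X \<ge> 1"
  shows "(s - 1) * zeta s = (s - 1) * (\<Sum>n=1..<X. of_nat n powr (-s)) + of_nat X powr (1 - s)
           + (\<Sum>n. taylor_rem 1 (n + X) s)"
proof -
  obtain E where E: "E holomorphic_on UNIV" "\<And>s. Re s > 1 \<Longrightarrow> E s = (s - 1) * dirichlet_zeta s"
    using zeta_entire by blast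
  have "zeta s = E s / (s - 1)"
  proof (rule holomorphic_eq_from_halfplane[where A = "-{1}" and w = 2 and f = zeta and g = "\<lambda>s. E s / (s - 1)"])
    show "(\<lambda>s. E s / (s - 1)) holomorphic_on - {1}"
      by (auto intro!: holomorphic_intros holomorphic_on_subset[OF E(1)])
  qed (use E zeta_properties assms in \<open>auto intro: connected_punctured_universe\<close>)
  hence "(s - 1) * zeta s = E s" using assms by simp
  also have "E s = 1 + (\<Sum>n. taylor_rem 1 (n + 1) s)"
  proof (rule holomorphic_eq_from_halfplane[where A = "{s. Re s > 1 - real 1}" and w = 2
      and f = E and g = "\<lambda>s. 1 + (\<Sum>n. taylor_rem 1 (n + 1) s)"])
    show "(\<lambda>s. 1 + (\<Sum>n. taylor_rem 1 (n + 1) s)) holomorphic_on {s. Re s > 1 - real 1}"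
      by (intro holomorphic_intros holomorphic_taylor_rem_series) auto
    show "E s = 1 + (\<Sum>n. taylor_rem 1 (n + 1) s)" if "Re s > 1" for s
      using E(2)[OF that] dirichlet_zeta_recursion[OF that, of 1] by simp
  qed (use E assms in \<open>auto intro: holomorphic_on_subset simp: open_halfspace_Re_gt connected_halfspace_Re_gt\<close>)
  also have "(\<Sum>n. taylor_rem 1 (n + 1) s) = (\<Sum>n. taylor_rem 1 (n + (X - 1) + 1) s) + (\<Sum>n<X-1. taylor_rem 1 (n + 1) s)"
    using taylor_rem_summable[of 1 1 s] assms by (intro suminf_split_initial_segment) auto
  also have "(\<Sum>n<X-1. taylor_rem 1 (n + 1) s) = of_nat X powr (1 - s) - 1 + (s - 1) * (\<Sum>n=1..<X. of_nat n powr (-s))"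
    using assms(3)
  proof (induction X rule: dec_induct)
    case (step X)
    then obtain Y where Y: "X = Suc Y" by (cases X) auto
    show ?case using step.IH by (simp add: Y taylor_rem_def algebra_simps)
  qed auto
  finally show ?thesis using assms by (simp add: algebra_simps)
qed

section \<open>Mean squares\<close>

abbreviation lborel_on :: "real \<Rightarrow> real \<Rightarrow> real measure" where
  "lborel_on a b \<equiv> restrict_space lborel {a..b}"

lemma finite_measure_lborel_on: "finite_measure (lborel_on a b)"
  by (intro finite_measureI) (auto simp: space_restrict_space emeasure_restrict_space emeasure_lborel_Icc_eq)

text \<open>Bridge between two integrals: Fubini and domination are applied to Lebesgue integrals,
  antiderivatives and comparison of ranges to gauge integrals.\<close>

lemma lborel_on_integral:
  fixes f :: "real \<Rightarrow> 'b::euclidean_space"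
  assumes "integrable (lborel_on a b) f"
  shows "f integrable_on {a..b}" "integral\<^sup>L (lborel_on a b) f = integral {a..b} f"
proof -
  have "set_integrable lborel {a..b} f"
    using assms by (simp add: integrable_restrict_space set_integrable_def)
  note * = set_borel_integral_eq_integral[OF this]
  show "f integrable_on {a..b}" by (rule *(1))
  show "integral\<^sup>L (lborel_on a b) f = integral {a..b} f"
    using *(2) by (simp add: integral_restrict_space set_lebesgue_integral_def)
qed

lemma integrable_lborel_on_continuous:
  fixes f :: "real \<Rightarrow> 'b::euclidean_space"
  assumes "continuous_on {a..b} f"
  shows "integrable (lborel_on a b) f"
  using borel_integrable_atLeastAtMost'[OF assms]
  by (simp add: integrable_restrict_space set_integrable_def)

text \<open>The weight T^2 - t^2 vanishes at both ends, so two integrations by parts leave a decay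
  \<omega>^(-2) instead of the \<omega>^(-1) of a sharp cutoff, and the kernel is absolutely
  summable over spaced frequencies. The constant 10 is 2 + 8, from the bounds 2 T^3 and 8 T /
  \<omega>^2.\<close>

lemma fejer_type_kernel_bound:
  fixes T \<omega> :: real
  assumes "T > 0"
  shows "cmod (integral {-T..T} (\<lambda>t. of_real (T\<^sup>2 - t\<^sup>2) * cis (\<omega> * t))) \<le> 10 * T ^ 3 / (1 + T\<^sup>2 * \<omega>\<^sup>2)"
proof -
  define I where "I = integral {-T..T} (\<lambda>t. of_real (T\<^sup>2 - t\<^sup>2) * cis (\<omega> * t))"
  have 1: "cmod I \<le> 2 * T ^ 3"
  proof -
    have "cmod I \<le> T\<^sup>2 * (T - (-T))" unfolding I_def
    proof (rule integral_bound)
      show "continuous_on {-T..T} (\<lambda>t. of_real (T\<^sup>2 - t\<^sup>2) * cis (\<omega> * t))"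
        by (intro continuous_intros)
      fix t assume "t \<in> {-T..T}"
      hence "t\<^sup>2 \<le> T\<^sup>2" using assms by (intro abs_le_square_iff[THEN iffD1]) auto
      thus "cmod (of_real (T\<^sup>2 - t\<^sup>2) * cis (\<omega> * t)) \<le> T\<^sup>2"
        unfolding norm_mult norm_of_real by simp
    qed (use assms in auto)
    thus ?thesis by (simp add: power2_eq_square power3_eq_cube)
  qed
  have 2: "cmod I * \<omega>\<^sup>2 \<le> 8 * T"
  proof (cases "\<omega> = 0")
    case False
    define c where "c = \<i> * complex_of_real \<omega>"
    have c: "c \<noteq> 0" using False by (simp add: c_def)
    define \<Phi> where "\<Phi> = (\<lambda>z. exp (c * z) * (((of_real T)\<^sup>2 - z\<^sup>2) / c + 2 * z / c\<^sup>2 - 2 / c ^ 3))"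
    have der: "(\<Phi> has_field_derivative (exp (c * z) * ((of_real T)\<^sup>2 - z\<^sup>2))) (at z)" for z
      unfolding \<Phi>_def using c
      by (auto intro!: derivative_eq_intros simp: field_simps power2_eq_square power3_eq_cube)
    have "((\<lambda>t. exp (c * of_real t) * ((of_real T)\<^sup>2 - (of_real t)\<^sup>2)) has_integral (\<Phi> (of_real T) - \<Phi> (of_real (-T)))) {-T..T}"
      using assms by (intro fundamental_theorem_of_calculus has_vector_derivative_real_field der) auto
    moreover have "exp (c * of_real t) * ((of_real T)\<^sup>2 - (of_real t)\<^sup>2) = of_real (T\<^sup>2 - t\<^sup>2) * cis (\<omega> * t)" for t
      by (simp add: c_def cis_conv_exp mult_ac)
    ultimately have "I = \<Phi> (of_real T) - \<Phi> (of_real (-T))"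
      unfolding I_def by (intro integral_unique) simp
    also have "\<dots> = (exp (c * of_real T) + exp (c * of_real (-T))) * (2 * of_real T / c\<^sup>2) - (exp (c * of_real T) - exp (c * of_real (-T))) * (2 / c ^ 3)"
      by (simp add: \<Phi>_def algebra_simps add_divide_distrib)
    finally have I: "I = (exp (c * of_real T) + exp (c * of_real (-T))) * (2 * of_real T / c\<^sup>2) - (exp (c * of_real T) - exp (c * of_real (-T))) * (2 / c ^ 3)" .
    have e1: "cmod (exp (c * of_real u)) = 1" for u by (simp add: c_def)
    have "exp (c * of_real T) - exp (c * of_real (-T)) = 2 * \<i> * of_real (sin (\<omega> * T))"
      by (simp add: c_def complex_eq_iff exp_eq_polar Re_exp Im_exp)
    hence "cmod (exp (c * of_real T) - exp (c * of_real (-T))) = 2 * \<bar>sin (\<omega> * T)\<bar>" by (simp add: norm_mult)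
    \<comment> \<open>The bound |sin u| \<le> |u| trades one power of 1 / \<omega> for T, so that
      the term with \<open>c ^ 3\<close> is of order T / \<omega>^2 as well.\<close>
    also have "\<dots> \<le> 2 * (\<bar>\<omega>\<bar> * T)" using abs_sin_x_le_abs_x[of "\<omega> * T"] assms by (simp add: abs_mult)
    finally have e2: "cmod (exp (c * of_real T) - exp (c * of_real (-T))) \<le> 2 * (\<bar>\<omega>\<bar> * T)" .
    have e3: "cmod (exp (c * of_real T) + exp (c * of_real (-T))) \<le> 2"
      using norm_triangle_ineq[of "exp (c * of_real T)" "exp (c * of_real (-T))"] unfolding e1 by simp
    have nc: "cmod c = \<bar>\<omega>\<bar>" by (simp add: c_def norm_mult)
    have "cmod I \<le> cmod (exp (c * of_real T) + exp (c * of_real (-T))) * cmod (2 * of_real T / c\<^sup>2)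
        + cmod (exp (c * of_real T) - exp (c * of_real (-T))) * cmod (2 / c ^ 3)"
      unfolding I norm_mult[symmetric] by (rule norm_triangle_ineq4)
    also have "\<dots> \<le> 2 * cmod (2 * of_real T / c\<^sup>2) + 2 * (\<bar>\<omega>\<bar> * T) * cmod (2 / c ^ 3)"
      using e2 e3 by (intro add_mono mult_right_mono) auto
    also have "\<dots> = 2 * (2 * T / \<bar>\<omega>\<bar>\<^sup>2) + 2 * (\<bar>\<omega>\<bar> * T) * (2 / \<bar>\<omega>\<bar> ^ 3)"
      using assms by (simp add: norm_divide norm_mult norm_power nc)
    also have "\<dots> = 8 * T / \<omega>\<^sup>2" using False by (simp add: field_simps power2_eq_square power3_eq_cube)
    finally show ?thesis using False by (simp add: field_simps)
  qed (use assms in simp)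
  have "cmod I * (1 + T\<^sup>2 * \<omega>\<^sup>2) = cmod I + T\<^sup>2 * (cmod I * \<omega>\<^sup>2)" by (simp add: algebra_simps)
  also have "\<dots> \<le> 2 * T ^ 3 + T\<^sup>2 * (8 * T)" using 1 2 by (intro add_mono mult_left_mono) auto
  also have "\<dots> = 10 * T ^ 3" by (simp add: power2_eq_square power3_eq_cube)
  finally have "cmod I * (1 + T\<^sup>2 * \<omega>\<^sup>2) \<le> 10 * T ^ 3" .
  moreover have "1 + T\<^sup>2 * \<omega>\<^sup>2 > 0" by (simp add: add_pos_nonneg)
  ultimately show ?thesis unfolding I_def by (simp add: pos_le_divide_eq)
qed

text \<open>By Fubini the integral over t is carried out first and only produces the kernel
  estimated above, at the frequency \<theta>(z).\<close>

lemma weighted_fourier_bound: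
  fixes P :: "'a measure" and G :: "'a \<Rightarrow> complex" and \<theta> :: "'a \<Rightarrow> real"
  assumes P: "finite_measure P" and [measurable]: "G \<in> borel_measurable P" "\<theta> \<in> borel_measurable P"
    and B: "\<And>z. z \<in> space P \<Longrightarrow> cmod (G z) \<le> B" and T: "T > 0"
  shows "cmod (\<integral>t. of_real (T\<^sup>2 - t\<^sup>2) * (\<integral>z. G z * cis (\<theta> z * t) \<partial>P) \<partial>lborel_on (-T) T)
    \<le> (\<integral>z. cmod (G z) * (10 * T ^ 3 / (1 + T\<^sup>2 * (\<theta> z)\<^sup>2)) \<partial>P)"
proof -
  interpret P: finite_measure P by fact
  interpret R: finite_measure "lborel_on (-T) T" by (rule finite_measure_lborel_on)
  interpret PR: pair_sigma_finite P "lborel_on (-T) T" by unfold_locales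
  interpret PRf: finite_measure "P \<Otimes>\<^sub>M lborel_on (-T) T"
    by (rule finite_measure_pair_measure[OF R.finite_measure_axioms P])
  have [measurable]: "(\<lambda>t. t) \<in> borel_measurable (lborel_on (-T) T)"
    by (rule measurable_restrict_space1) simp
  have B0: "cmod (G z) \<le> max B 0" if "z \<in> space P" for z using B[OF that] by linarith
  have "integrable (P \<Otimes>\<^sub>M lborel_on (-T) T) (\<lambda>(z, t). of_real (T\<^sup>2 - t\<^sup>2) * (G z * cis (\<theta> z * t)))"
  proof (rule PRf.integrable_const_bound[where B = "T\<^sup>2 * max B 0"])
    show "AE x in P \<Otimes>\<^sub>M lborel_on (-T) T. norm (case x of (z, t) \<Rightarrow> of_real (T\<^sup>2 - t\<^sup>2) * (G z * cis (\<theta> z * t))) \<le> T\<^sup>2 * max B 0"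
    proof (rule AE_I2)
      fix x assume "x \<in> space (P \<Otimes>\<^sub>M lborel_on (-T) T)"
      then obtain z t where x: "x = (z, t)" "z \<in> space P" "t \<in> {-T..T}"
        by (auto simp: space_pair_measure space_restrict_space)
      have "t\<^sup>2 \<le> T\<^sup>2" using x T by (intro abs_le_square_iff[THEN iffD1]) auto
      hence "\<bar>T\<^sup>2 - t\<^sup>2\<bar> \<le> T\<^sup>2" by simp
      thus "norm (case x of (z, t) \<Rightarrow> of_real (T\<^sup>2 - t\<^sup>2) * (G z * cis (\<theta> z * t))) \<le> T\<^sup>2 * max B 0"
        using B0[OF x(2)] unfolding x by (simp add: norm_mult mult_mono del: of_real_diff)
    qed
  qed (unfold cis_conv_exp, measurable)
  hence "(\<integral>t. (\<integral>z. of_real (T\<^sup>2 - t\<^sup>2) * (G z * cis (\<theta> z * t)) \<partial>P) \<partial>lborel_on (-T) T)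
     = (\<integral>z. (\<integral>t. of_real (T\<^sup>2 - t\<^sup>2) * (G z * cis (\<theta> z * t)) \<partial>lborel_on (-T) T) \<partial>P)"
    by (rule PR.Fubini_integral)
  also have "(\<lambda>z. \<integral>t. of_real (T\<^sup>2 - t\<^sup>2) * (G z * cis (\<theta> z * t)) \<partial>lborel_on (-T) T)
     = (\<lambda>z. G z * integral {-T..T} (\<lambda>t. of_real (T\<^sup>2 - t\<^sup>2) * cis (\<theta> z * t)))"
  proof
    fix z
    have "(\<integral>t. of_real (T\<^sup>2 - t\<^sup>2) * (G z * cis (\<theta> z * t)) \<partial>lborel_on (-T) T)
      = G z * (\<integral>t. of_real (T\<^sup>2 - t\<^sup>2) * cis (\<theta> z * t) \<partial>lborel_on (-T) T)"
      by (subst integral_mult_right_zero[symmetric]) (simp add: mult_ac)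
    also have "(\<integral>t. of_real (T\<^sup>2 - t\<^sup>2) * cis (\<theta> z * t) \<partial>lborel_on (-T) T) = integral {-T..T} (\<lambda>t. of_real (T\<^sup>2 - t\<^sup>2) * cis (\<theta> z * t))"
      by (intro lborel_on_integral(2) integrable_lborel_on_continuous continuous_intros)
    finally show "(\<integral>t. of_real (T\<^sup>2 - t\<^sup>2) * (G z * cis (\<theta> z * t)) \<partial>lborel_on (-T) T)
      = G z * integral {-T..T} (\<lambda>t. of_real (T\<^sup>2 - t\<^sup>2) * cis (\<theta> z * t))" .
  qed
  finally have eq: "(\<integral>t. of_real (T\<^sup>2 - t\<^sup>2) * (\<integral>z. G z * cis (\<theta> z * t) \<partial>P) \<partial>lborel_on (-T) T) =
     (\<integral>z. G z * integral {-T..T} (\<lambda>t. of_real (T\<^sup>2 - t\<^sup>2) * cis (\<theta> z * t)) \<partial>P)" by simp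
  have kb: "10 * T ^ 3 / (1 + T\<^sup>2 * u\<^sup>2) \<le> 10 * T ^ 3" for u
    using T by (simp add: divide_le_eq mult_le_cancel_left1 add_pos_nonneg)
  have int: "integrable P (\<lambda>z. cmod (G z) * (10 * T ^ 3 / (1 + T\<^sup>2 * (\<theta> z)\<^sup>2)))"
  proof (rule P.integrable_const_bound[where B = "max B 0 * (10 * T ^ 3)"])
    show "AE z in P. norm (cmod (G z) * (10 * T ^ 3 / (1 + T\<^sup>2 * (\<theta> z)\<^sup>2))) \<le> max B 0 * (10 * T ^ 3)"
    proof (rule AE_I2)
      fix z assume z: "z \<in> space P"
      have "0 \<le> 10 * T ^ 3 / (1 + T\<^sup>2 * (\<theta> z)\<^sup>2)" using T by (intro divide_nonneg_nonneg) auto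
      thus "norm (cmod (G z) * (10 * T ^ 3 / (1 + T\<^sup>2 * (\<theta> z)\<^sup>2))) \<le> max B 0 * (10 * T ^ 3)"
        using B0[OF z] kb[of "\<theta> z"] unfolding real_norm_def abs_mult by (intro mult_mono) auto
    qed
  qed measurable
  have "cmod (\<integral>z. G z * integral {-T..T} (\<lambda>t. of_real (T\<^sup>2 - t\<^sup>2) * cis (\<theta> z * t)) \<partial>P)
     \<le> (\<integral>z. cmod (G z * integral {-T..T} (\<lambda>t. of_real (T\<^sup>2 - t\<^sup>2) * cis (\<theta> z * t))) \<partial>P)"
    by (rule integral_norm_bound)
  also have "\<dots> \<le> (\<integral>z. cmod (G z) * (10 * T ^ 3 / (1 + T\<^sup>2 * (\<theta> z)\<^sup>2)) \<partial>P)"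
    unfolding norm_mult
  proof (rule integral_mono'[OF int])
    show "cmod (G z) * cmod (integral {-T..T} (\<lambda>t. of_real (T\<^sup>2 - t\<^sup>2) * cis (\<theta> z * t)))
        \<le> cmod (G z) * (10 * T ^ 3 / (1 + T\<^sup>2 * (\<theta> z)\<^sup>2))" for z
      by (intro mult_left_mono fejer_type_kernel_bound T norm_ge_zero)
    show "0 \<le> cmod (G z) * (10 * T ^ 3 / (1 + T\<^sup>2 * (\<theta> z)\<^sup>2))" for z
      using T by (intro mult_nonneg_nonneg divide_nonneg_nonneg) auto
  qed
  finally show ?thesis unfolding eq .
qed

text \<open>
  One statement for finite sums (counting measure) and for Fourier integrals (Lebesgue measure). The weight
  \<open>4 T\<^sup>2 - t\<^sup>2\<close> dominates \<open>3 T\<^sup>2\<close> on \<open>[-T, T]\<close> and its Fourier transform decays quadratically.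
\<close>
lemma mean_square_bound:
  fixes M :: "'a measure" and a :: "'a \<Rightarrow> complex" and l :: "'a \<Rightarrow> real"
  assumes M: "finite_measure M" and [measurable]: "a \<in> borel_measurable M" "l \<in> borel_measurable M"
    and B: "\<And>x. x \<in> space M \<Longrightarrow> cmod (a x) \<le> B" and T: "T > 0"
    and \<kappa>: "\<And>x. x \<in> space M \<Longrightarrow> (\<integral>y. 1 / (1 + T\<^sup>2 * (l x - l y)\<^sup>2) \<partial>M) \<le> \<kappa>"
  defines "f \<equiv> (\<lambda>t. \<integral>x. a x * cis (- (t * l x)) \<partial>M)"
  shows "(\<lambda>t. (cmod (f t))\<^sup>2) integrable_on {-T..T}"
    and "integral {-T..T} (\<lambda>t. (cmod (f t))\<^sup>2) \<le> 27 * T * \<kappa> * (\<integral>x. (cmod (a x))\<^sup>2 \<partial>M)"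
proof -
  interpret M: finite_measure M by fact
  interpret MM: pair_sigma_finite M M by unfold_locales
  define P where "P = M \<Otimes>\<^sub>M M"
  have P: "finite_measure P" unfolding P_def by (rule finite_measure_pair_measure[OF M M])
  interpret P: finite_measure P by fact
  define B' where "B' = max B 0"
  have B': "cmod (a x) \<le> B'" "B' \<ge> 0" if "x \<in> space M" for x using B[OF that] by (auto simp: B'_def)
  have Bge: "B' \<ge> 0" by (simp add: B'_def)
  have [measurable]: "(\<lambda>t. t) \<in> borel_measurable (lborel_on u v)" for u v
    by (rule measurable_restrict_space1) simp
  have fm [measurable]: "f \<in> borel_measurable (lborel_on u v)" for u v
  proof -
    interpret R: finite_measure "lborel_on u v" by (rule finite_measure_lborel_on)
    show ?thesis unfolding f_def cis_conv_exp by measurable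
  qed
  have inta: "integrable M (\<lambda>x. a x * cis (- (t * l x)))" for t
    by (rule M.integrable_const_bound[where B = B']) (auto intro!: AE_I2 B' simp: norm_mult cis_conv_exp)
  have fB: "cmod (f t) \<le> B' * measure M (space M)" for t
  proof -
    have "cmod (f t) \<le> (\<integral>x. B' \<partial>M)" unfolding f_def
      by (intro order_trans[OF integral_norm_bound] integral_mono_AE integrable_norm inta)
         (auto simp: norm_mult intro!: AE_I2 B')
    thus ?thesis by (simp add: mult.commute)
  qed
  have intf: "integrable (lborel_on u v) (\<lambda>t. g t * (cmod (f t))\<^sup>2)"
    if "continuous_on {u..v} g" for g :: "real \<Rightarrow> real" and u v
  proof -
    have "integrable (lborel_on u v) g" using that by (rule integrable_lborel_on_continuous)
    thus ?thesis
    proof (rule Bochner_Integration.integrable_bound[OF integrable_mult_left[where c = "(B' * measure M (space M))\<^sup>2"]])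
      show "(\<lambda>t. g t * (cmod (f t))\<^sup>2) \<in> borel_measurable (lborel_on u v)"
        using borel_measurable_integrable[OF \<open>integrable (lborel_on u v) g\<close>] by measurable
      show "AE t in lborel_on u v. norm (g t * (cmod (f t))\<^sup>2) \<le> norm (g t * (B' * measure M (space M))\<^sup>2)"
        using fB by (intro AE_I2) (auto simp: abs_mult intro!: mult_left_mono power_mono)
    qed
  qed
  show 1: "(\<lambda>t. (cmod (f t))\<^sup>2) integrable_on {-T..T}"
    using lborel_on_integral(1)[OF intf[of "-T" T "\<lambda>_. 1"]] by simp
  \<comment> \<open>Squaring out: |f(t)|^2 is itself a Fourier integral, over pairs (x, y), with
    frequency l y - l x.\<close>
  define G where "G = (\<lambda>(x, y). a x * cnj (a y))"
  define \<theta> where "\<theta> = (\<lambda>(x, y). l y - l x)"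
  have [measurable]: "(\<lambda>x. cnj (a x)) \<in> borel_measurable M"
    using bounded_linear_cnj by (intro measurable_compose[OF assms(2)] borel_measurable_continuous_onI continuous_intros)
  have Gm [measurable]: "G \<in> borel_measurable P" and \<theta>m [measurable]: "\<theta> \<in> borel_measurable P"
    unfolding G_def \<theta>_def P_def by measurable
  have sp: "z \<in> space P \<longleftrightarrow> fst z \<in> space M \<and> snd z \<in> space M" for z
    by (cases z) (simp add: P_def space_pair_measure)
  have GB: "cmod (G z) \<le> B' * B'" if "z \<in> space P" for z
    using that B' Bge unfolding sp by (auto simp: G_def norm_mult case_prod_beta intro!: mult_mono)
  have sq: "of_real ((cmod (f t))\<^sup>2) = (\<integral>z. G z * cis (\<theta> z * t) \<partial>P)" for t
  proof -
    have "of_real ((cmod (f t))\<^sup>2) = f t * cnj (f t)" by (rule complex_norm_square)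
    also have "cnj (f t) = (\<integral>y. cnj (a y) * cis (t * l y) \<partial>M)"
      unfolding f_def using Bochner_Integration.integral_cnj[of M "\<lambda>x. a x * cis (- (t * l x))", symmetric]
      by (simp only: complex_cnj_mult cis_cnj minus_minus)
    also have "f t * \<dots> = (\<integral>x. (\<integral>y. (a x * cis (- (t * l x))) * (cnj (a y) * cis (t * l y)) \<partial>M) \<partial>M)"
      unfolding f_def by (simp only: integral_mult_right_zero integral_mult_left_zero)
    also have "\<dots> = (\<integral>x. (\<integral>y. G (x, y) * cis (\<theta> (x, y) * t) \<partial>M) \<partial>M)"
      by (simp add: G_def \<theta>_def mult_ac cis_mult ring_distribs)
    also have "\<dots> = (\<integral>z. G z * cis (\<theta> z * t) \<partial>P)" unfolding P_def
    proof (rule MM.integral_fst')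
      show "integrable (M \<Otimes>\<^sub>M M) (\<lambda>z. G z * cis (\<theta> z * t))" unfolding P_def[symmetric]
        by (rule P.integrable_const_bound[where B = "B' * B'"])
           (use GB in \<open>auto intro!: AE_I2 simp: norm_mult cis_conv_exp\<close>)
    qed
    finally show ?thesis .
  qed
  define k where "k = (\<lambda>x y. 1 / (1 + T\<^sup>2 * (l x - l y)\<^sup>2))"
  have k01: "0 \<le> k x y" "k x y \<le> 1" for x y unfolding k_def by (auto simp: divide_le_eq add_pos_nonneg)
  have ksym: "k x y = k y x" for x y by (simp add: k_def power2_commute)
  have km [measurable]: "case_prod k \<in> borel_measurable (M \<Otimes>\<^sub>M M)" unfolding k_def by measurable
  have ib: "integrable P (\<lambda>z. u z * case_prod k z)"
    if [measurable]: "u \<in> borel_measurable P" and u: "\<And>z. z \<in> space P \<Longrightarrow> 0 \<le> u z \<and> u z \<le> C" for u C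
  proof (rule P.integrable_const_bound[where B = C])
    show "AE z in P. norm (u z * case_prod k z) \<le> C"
    proof (rule AE_I2)
      fix z assume z: "z \<in> space P"
      have "u z * k (fst z) (snd z) \<le> C * 1" using u[OF z] k01 by (intro mult_mono) auto
      thus "norm (u z * case_prod k z) \<le> C" using u[OF z] k01 by (simp add: case_prod_beta abs_mult)
    qed
    show "(\<lambda>z. u z * case_prod k z) \<in> borel_measurable P" using km unfolding P_def[symmetric] by measurable
  qed
  have aP [measurable]: "(\<lambda>z. a (fst z)) \<in> borel_measurable P" "(\<lambda>z. a (snd z)) \<in> borel_measurable P"
    unfolding P_def by measurable
  have i0: "integrable P (\<lambda>z. (cmod (a (fst z)))\<^sup>2 * case_prod k z)" "integrable P (\<lambda>z. (cmod (a (snd z)))\<^sup>2 * case_prod k z)"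
    by (rule ib[where C = "B'\<^sup>2"]; use B' in \<open>auto simp: sp intro!: power_mono\<close>)+
  have "3 * T\<^sup>2 * integral {-T..T} (\<lambda>t. (cmod (f t))\<^sup>2) = integral {-T..T} (\<lambda>t. 3 * T\<^sup>2 * (cmod (f t))\<^sup>2)" by simp
  also have "\<dots> \<le> integral {-T..T} (\<lambda>t. ((2 * T)\<^sup>2 - t\<^sup>2) * (cmod (f t))\<^sup>2)"
  proof (intro integral_le lborel_on_integral(1)[OF intf])
    fix t assume "t \<in> {-T..T}"
    hence "t\<^sup>2 \<le> T\<^sup>2" using T by (intro abs_le_square_iff[THEN iffD1]) auto
    thus "3 * T\<^sup>2 * (cmod (f t))\<^sup>2 \<le> ((2 * T)\<^sup>2 - t\<^sup>2) * (cmod (f t))\<^sup>2" by (intro mult_right_mono) auto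
  qed (auto intro!: continuous_intros)
  also have "\<dots> \<le> integral {-(2 * T)..2 * T} (\<lambda>t. ((2 * T)\<^sup>2 - t\<^sup>2) * (cmod (f t))\<^sup>2)"
  proof (intro integral_subset_le lborel_on_integral(1)[OF intf] ballI)
    fix t assume "t \<in> {-(2 * T)..2 * T}"
    hence "t\<^sup>2 \<le> (2 * T)\<^sup>2" using T by (intro abs_le_square_iff[THEN iffD1]) auto
    thus "0 \<le> ((2 * T)\<^sup>2 - t\<^sup>2) * (cmod (f t))\<^sup>2" by (intro mult_nonneg_nonneg) auto
  qed (use T in \<open>auto intro!: continuous_intros\<close>)
  also have "\<dots> = (\<integral>t. ((2 * T)\<^sup>2 - t\<^sup>2) * (cmod (f t))\<^sup>2 \<partial>lborel_on (-(2 * T)) (2 * T))"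
    by (rule lborel_on_integral(2)[symmetric]) (intro intf continuous_intros)
  also have "\<dots> \<le> cmod (of_real (\<integral>t. ((2 * T)\<^sup>2 - t\<^sup>2) * (cmod (f t))\<^sup>2 \<partial>lborel_on (-(2 * T)) (2 * T)))"
    by (simp only: norm_of_real abs_ge_self)
  also have "of_real (\<integral>t. ((2 * T)\<^sup>2 - t\<^sup>2) * (cmod (f t))\<^sup>2 \<partial>lborel_on (-(2 * T)) (2 * T))
      = (\<integral>t. of_real ((2 * T)\<^sup>2 - t\<^sup>2) * (\<integral>z. G z * cis (\<theta> z * t) \<partial>P) \<partial>lborel_on (-(2 * T)) (2 * T))"
    by (simp only: integral_complex_of_real[symmetric] of_real_mult sq[symmetric])
  also have "cmod \<dots> \<le> (\<integral>z. cmod (G z) * (10 * (2 * T) ^ 3 / (1 + (2 * T)\<^sup>2 * (\<theta> z)\<^sup>2)) \<partial>P)"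
    using GB T by (intro weighted_fourier_bound[OF P]) auto
  also have "\<dots> \<le> (\<integral>z. 80 * T ^ 3 * (cmod (G z) * case_prod k z) \<partial>P)"
  proof (intro integral_mono')
    show "integrable P (\<lambda>z. 80 * T ^ 3 * (cmod (G z) * case_prod k z))"
      using GB by (intro integrable_mult_right ib[where C = "B' * B'"]) auto
    fix z :: "'a \<times> 'a"
    obtain x y where z: "z = (x, y)" by fastforce
    have "10 * (2 * T) ^ 3 / (1 + (2 * T)\<^sup>2 * (\<theta> z)\<^sup>2) \<le> 80 * T ^ 3 / (1 + T\<^sup>2 * (\<theta> z)\<^sup>2)"
      using T by (intro frac_le) (auto simp: power_mult_distrib add_pos_nonneg intro!: mult_right_mono)
    also have "\<dots> = 80 * T ^ 3 * case_prod k z" by (simp add: z k_def \<theta>_def power2_commute)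
    finally show "cmod (G z) * (10 * (2 * T) ^ 3 / (1 + (2 * T)\<^sup>2 * (\<theta> z)\<^sup>2)) \<le> 80 * T ^ 3 * (cmod (G z) * case_prod k z)"
      by (metis mult_left_mono norm_ge_zero mult.left_commute)
    show "0 \<le> 80 * T ^ 3 * (cmod (G z) * case_prod k z)" using T k01 by (simp add: z)
  qed
  also have "\<dots> = 80 * T ^ 3 * (\<integral>z. cmod (G z) * case_prod k z \<partial>P)" by simp
  \<comment> \<open>Schur test: |a(x) a(y)| is at most the mean of the two squares, and by the
    symmetry of \<open>k\<close> both halves reduce to the row integrals, which are at most
    \<kappa>.\<close>
  also have "(\<integral>z. cmod (G z) * case_prod k z \<partial>P) \<le> (\<integral>z. (cmod (a (fst z)))\<^sup>2 * case_prod k z / 2 + (cmod (a (snd z)))\<^sup>2 * case_prod k z / 2 \<partial>P)"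
    (is "_ \<le> integral\<^sup>L P ?h")
  proof (intro integral_mono')
    show "integrable P ?h"
      using i0 by (intro Bochner_Integration.integrable_add integrable_divide)
    fix z :: "'a \<times> 'a"
    have "cmod (G z) \<le> (cmod (a (fst z)))\<^sup>2 / 2 + (cmod (a (snd z)))\<^sup>2 / 2"
      using sum_squares_bound[of "cmod (a (fst z))" "cmod (a (snd z))"] by (simp add: G_def case_prod_beta norm_mult)
    hence "cmod (G z) * case_prod k z \<le> ((cmod (a (fst z)))\<^sup>2 / 2 + (cmod (a (snd z)))\<^sup>2 / 2) * case_prod k z"
      using k01 by (intro mult_right_mono) (auto simp: case_prod_beta)
    thus "cmod (G z) * case_prod k z \<le> ?h z" by (simp add: algebra_simps)
    show "0 \<le> ?h z" using k01 by (auto simp: case_prod_beta)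
  qed
  also have "\<dots> \<le> \<kappa> * (\<integral>x. (cmod (a x))\<^sup>2 \<partial>M)"
  proof -
    have int2: "integrable M (\<lambda>x. (cmod (a x))\<^sup>2)"
      by (rule M.integrable_const_bound[where B = "B'\<^sup>2"]) (use B' in \<open>auto intro!: AE_I2 power_mono\<close>)
    have \<kappa>': "(\<integral>y. k x y \<partial>M) \<le> \<kappa>" if "x \<in> space M" for x using \<kappa>[OF that] by (simp add: k_def)
    have "(\<integral>z. (cmod (a (fst z)))\<^sup>2 * case_prod k z \<partial>P) = (\<integral>x. (\<integral>y. (cmod (a x))\<^sup>2 * k x y \<partial>M) \<partial>M)"
      using MM.integral_fst'[of "\<lambda>z. (cmod (a (fst z)))\<^sup>2 * case_prod k z"] i0 by (simp add: P_def)
    also have "\<dots> = (\<integral>x. (cmod (a x))\<^sup>2 * (\<integral>y. k x y \<partial>M) \<partial>M)" by simp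
    also have "\<dots> \<le> (\<integral>x. (cmod (a x))\<^sup>2 * \<kappa> \<partial>M)"
    proof (rule integral_mono_AE)
      show "integrable M (\<lambda>x. (cmod (a x))\<^sup>2 * \<kappa>)" using int2 by simp
      have "integrable M (\<lambda>x. \<integral>y. (cmod (a x))\<^sup>2 * k x y \<partial>M)"
        using MM.integrable_fst'[of "\<lambda>z. (cmod (a (fst z)))\<^sup>2 * case_prod k z"] i0 by (simp add: P_def)
      thus "integrable M (\<lambda>x. (cmod (a x))\<^sup>2 * (\<integral>y. k x y \<partial>M))" by simp
      show "AE x in M. (cmod (a x))\<^sup>2 * (\<integral>y. k x y \<partial>M) \<le> (cmod (a x))\<^sup>2 * \<kappa>"
        by (intro AE_I2 mult_left_mono \<kappa>') auto
    qed
    finally have h1: "(\<integral>z. (cmod (a (fst z)))\<^sup>2 * case_prod k z \<partial>P) \<le> \<kappa> * (\<integral>x. (cmod (a x))\<^sup>2 \<partial>M)" by (simp add: mult.commute)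
    have "(\<integral>z. (cmod (a (snd z)))\<^sup>2 * case_prod k z \<partial>P) = (\<integral>z. (cmod (a (fst z)))\<^sup>2 * case_prod k z \<partial>P)"
      unfolding P_def
      using MM.integral_product_swap[of "\<lambda>z. (cmod (a (fst z)))\<^sup>2 * case_prod k z"] i0(1) borel_measurable_integrable[OF i0(1)] 
      by (simp add: P_def case_prod_beta' ksym)
    with h1 i0 show ?thesis by (simp add: field_simps)
  qed
  finally have "3 * T\<^sup>2 * integral {-T..T} (\<lambda>t. (cmod (f t))\<^sup>2) \<le> 80 * T ^ 3 * (\<kappa> * (\<integral>x. (cmod (a x))\<^sup>2 \<partial>M))"
    using T by (simp add: mult_left_mono)
  \<comment> \<open>Rounding 80 up to 81 makes 81 / 3 = 27 an integer. This needs a nonnegative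
    right-hand side; \<kappa> \<ge> 0 follows from its hypothesis as soon as the space has a
    point.\<close>
  also have "\<dots> \<le> 81 * T ^ 3 * (\<kappa> * (\<integral>x. (cmod (a x))\<^sup>2 \<partial>M))"
  proof (intro mult_right_mono)
    show "0 \<le> \<kappa> * (\<integral>x. (cmod (a x))\<^sup>2 \<partial>M)"
    proof (cases "space M = {}")
      case True
      thus ?thesis by (simp add: Bochner_Integration.integral_empty)
    next
      case False
      then obtain x where "x \<in> space M" by blast
      from \<kappa>[OF this] have "\<kappa> \<ge> 0" by (rule order_trans[rotated]) (auto intro!: integral_nonneg_AE AE_I2 divide_nonneg_nonneg)
      thus ?thesis by (intro mult_nonneg_nonneg integral_nonneg_AE AE_I2) auto
    qed
  qed (use T in auto)
  also have "\<dots> = 3 * T\<^sup>2 * (27 * T * \<kappa> * (\<integral>x. (cmod (a x))\<^sup>2 \<partial>M))"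
    by (simp add: power2_eq_square power3_eq_cube)
  finally have "3 * T\<^sup>2 * integral {-T..T} (\<lambda>t. (cmod (f t))\<^sup>2) \<le> 3 * T\<^sup>2 * (27 * T * \<kappa> * (\<integral>x. (cmod (a x))\<^sup>2 \<partial>M))" .
  thus "integral {-T..T} (\<lambda>t. (cmod (f t))\<^sup>2) \<le> 27 * T * \<kappa> * (\<integral>x. (cmod (a x))\<^sup>2 \<partial>M)"
    using T by (simp add: mult_le_cancel_left)
qed

section \<open>Mean squares of Dirichlet polynomials\<close>

lemma sum_inverse_one_plus_square_le:
  "(\<Sum>j=1..J. 1 / (1 + (real j)\<^sup>2)) \<le> 2"
proof (cases "J \<ge> 1")
  case True
  hence "(\<Sum>j=1..J. 1 / (1 + (real j)\<^sup>2)) \<le> 2 - 1 / real J"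
  proof (induction J rule: dec_induct)
    case (step n)
    have "1 / (1 + (real (Suc n))\<^sup>2) \<le> 1 / (real n * real (Suc n))"
      using step.hyps by (intro divide_left_mono) (auto simp: power2_eq_square algebra_simps intro!: add_pos_nonneg mult_pos_pos)
    also have "\<dots> = 1 / real n - 1 / real (Suc n)" using step.hyps by (simp add: field_simps)
    finally show ?case using step.IH by simp
  qed simp
  moreover have "1 / real J \<ge> 0" by simp
  ultimately show ?thesis by linarith
qed simp

text \<open>The term m = n contributes 1, the terms on either side of n at most 2.\<close>

lemma sum_inverse_one_plus_distance_square_le:
  fixes n :: nat
  assumes "finite A"
  shows "(\<Sum>m\<in>A. 1 / (1 + (real n - real m)\<^sup>2)) \<le> 5"
proof -
  define J where "J = n + (\<Sum>m\<in>A. m)"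
  define A1 A2 where "A1 = {m\<in>A. m < n}" and "A2 = {m\<in>A. m > n}"
  have J: "m \<le> J" if "m \<in> A" for m using member_le_sum[OF that, of "\<lambda>m. m"] assms by (simp add: J_def)
  have "(\<Sum>m\<in>A. 1 / (1 + (real n - real m)\<^sup>2)) \<le> (\<Sum>m\<in>insert n (A1 \<union> A2). 1 / (1 + (real n - real m)\<^sup>2))"
    using assms by (intro sum_mono2) (auto simp: A1_def A2_def)
  also have "\<dots> = 1 + ((\<Sum>m\<in>A1. 1 / (1 + (real n - real m)\<^sup>2)) + (\<Sum>m\<in>A2. 1 / (1 + (real n - real m)\<^sup>2)))"
  proof -
    have "finite A1" "finite A2" "n \<notin> A1 \<union> A2" "A1 \<inter> A2 = {}" using assms by (auto simp: A1_def A2_def)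
    thus ?thesis by (simp add: sum.union_disjoint)
  qed
  also have "(\<Sum>m\<in>A1. 1 / (1 + (real n - real m)\<^sup>2)) \<le> 2"
  proof -
    have inj: "inj_on (\<lambda>m. n - m) A1" by (auto simp: inj_on_def A1_def)
    have "(\<Sum>m\<in>A1. 1 / (1 + (real n - real m)\<^sup>2)) = (\<Sum>m\<in>A1. 1 / (1 + (real (n - m))\<^sup>2))"
      by (intro sum.cong refl) (auto simp: A1_def of_nat_diff)
    also have "\<dots> = (\<Sum>j\<in>(\<lambda>m. n - m) ` A1. 1 / (1 + (real j)\<^sup>2))" by (simp add: sum.reindex[OF inj])
    also have "\<dots> \<le> (\<Sum>j=1..J. 1 / (1 + (real j)\<^sup>2))"
      by (intro sum_mono2) (auto simp: A1_def J_def intro!: divide_nonneg_nonneg)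
    finally show ?thesis using sum_inverse_one_plus_square_le[of J] by linarith
  qed
  also have "(\<Sum>m\<in>A2. 1 / (1 + (real n - real m)\<^sup>2)) \<le> 2"
  proof -
    have inj: "inj_on (\<lambda>m. m - n) A2" by (auto simp: inj_on_def A2_def)
    have "(\<Sum>m\<in>A2. 1 / (1 + (real n - real m)\<^sup>2)) = (\<Sum>m\<in>A2. 1 / (1 + (real (m - n))\<^sup>2))"
      by (intro sum.cong refl) (auto simp: A2_def of_nat_diff power2_commute)
    also have "\<dots> = (\<Sum>j\<in>(\<lambda>m. m - n) ` A2. 1 / (1 + (real j)\<^sup>2))" by (simp add: sum.reindex[OF inj])
    also have "\<dots> \<le> (\<Sum>j=1..J. 1 / (1 + (real j)\<^sup>2))"
      using J by (intro sum_mono2) (auto simp: A2_def intro!: divide_nonneg_nonneg diff_le_self[THEN order_trans])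
    finally show ?thesis using sum_inverse_one_plus_square_le[of J] by linarith
  qed
  finally show ?thesis by simp
qed

text \<open>From ln u \<le> u - 1. The logarithms of integers up to X are thus at least as spread
  out as the integers scaled by 1 / X, so at T = X the row sums of the kernel are bounded by those
  for integers.\<close>

lemma abs_ln_diff_ge:
  assumes "n \<ge> 1" "m \<ge> 1" "real n \<le> X" "real m \<le> X"
  shows "\<bar>real n - real m\<bar> \<le> X * \<bar>ln (real n) - ln (real m)\<bar>"
proof -
  have *: "real n - real m \<le> X * (ln (real n) - ln (real m))" if "n \<ge> m" "m \<ge> 1" "real n \<le> X" for n m :: nat
  proof -
    have pos: "real n > 0" "real m > 0" using that by auto
    have "ln (real m / real n) \<le> real m / real n - 1" using pos by (intro ln_le_minus_one) auto
    hence "1 - real m / real n \<le> ln (real n) - ln (real m)" using pos by (simp add: ln_div)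
    hence "real n * (1 - real m / real n) \<le> real n * (ln (real n) - ln (real m))" using pos by (intro mult_left_mono) auto
    also have "\<dots> \<le> X * (ln (real n) - ln (real m))" using that pos by (intro mult_right_mono) auto
    finally show ?thesis using pos by (simp add: algebra_simps)
  qed
  show ?thesis
  proof (cases "n \<ge> m")
    case True
    thus ?thesis using *[of m n] assms by simp
  next
    case False
    hence "m \<ge> n" by simp
    from *[OF this assms(1,4)] False assms show ?thesis by (simp add: abs_if algebra_simps)
  qed
qed

lemma nat_powr_cis:
  assumes "n \<ge> 1"
  shows "of_nat n powr (- Complex \<sigma> t) = of_real (real n powr (-\<sigma>)) * cis (- (t * ln (real n)))"
proof -
  have "of_nat n powr (- Complex \<sigma> t) = exp (of_real (- \<sigma> * ln (real n)) + \<i> * of_real (- (t * ln (real n))))"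
    using assms by (simp add: powr_def Ln_of_nat complex_eq_iff Re_exp Im_exp)
  also have "\<dots> = of_real (real n powr (-\<sigma>)) * cis (- (t * ln (real n)))"
    using assms by (simp only: exp_add cis_conv_exp exp_of_real powr_def) simp
  finally show ?thesis .
qed

text \<open>\<open>mean_square_bound\<close> for the counting measure with row bound 5, whence 135 =
  27 * 5. A range of integration as long as the polynomial resolves the gaps between its
  frequencies, so only the diagonal is felt.\<close>

lemma dirichlet_polynomial_mean_square:
  fixes X Y :: nat
  assumes "Y \<ge> 1" "X \<ge> 1"
  shows "(\<lambda>t. (cmod (\<Sum>n=Y..<X. of_nat n powr (- Complex \<sigma> t)))\<^sup>2) integrable_on {- real X..real X}"
    and "integral {- real X..real X} (\<lambda>t. (cmod (\<Sum>n=Y..<X. of_nat n powr (- Complex \<sigma> t)))\<^sup>2)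
          \<le> 135 * real X * (\<Sum>n=Y..<X. real n powr (-(2 * \<sigma>)))"
proof -
  define M where "M = count_space {Y..<X}"
  define a where "a = (\<lambda>n. complex_of_real (real n powr (-\<sigma>)))"
  have M: "finite_measure M" unfolding M_def by (rule finite_measure_count_space) simp
  have int: "(\<integral>n. g n \<partial>M) = (\<Sum>n=Y..<X. g n)" for g :: "nat \<Rightarrow> 'z::{banach,second_countable_topology}"
    unfolding M_def by (simp add: lebesgue_integral_count_space_finite)
  have f: "(\<integral>n. a n * cis (- (t * ln (real n))) \<partial>M) = (\<Sum>n=Y..<X. of_nat n powr (- Complex \<sigma> t))" for t
    unfolding int a_def using assms by (intro sum.cong refl nat_powr_cis[symmetric]) auto
  have \<kappa>: "(\<integral>m. 1 / (1 + (real X)\<^sup>2 * (ln (real n) - ln (real m))\<^sup>2) \<partial>M) \<le> 5" if "n \<in> space M" for n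
  proof -
    have n: "Y \<le> n" "n < X" using that by (auto simp: M_def)
    have "(\<integral>m. 1 / (1 + (real X)\<^sup>2 * (ln (real n) - ln (real m))\<^sup>2) \<partial>M) \<le> (\<Sum>m=Y..<X. 1 / (1 + (real n - real m)\<^sup>2))"
      unfolding int
    proof (rule sum_mono)
      fix m assume m: "m \<in> {Y..<X}"
      have "\<bar>real n - real m\<bar> \<le> real X * \<bar>ln (real n) - ln (real m)\<bar>"
        using n m assms by (intro abs_ln_diff_ge) auto
      hence "\<bar>real n - real m\<bar>\<^sup>2 \<le> (real X * \<bar>ln (real n) - ln (real m)\<bar>)\<^sup>2" by (intro power_mono) auto
      hence "(real n - real m)\<^sup>2 \<le> (real X)\<^sup>2 * (ln (real n) - ln (real m))\<^sup>2" by (simp add: power_mult_distrib)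
      thus "1 / (1 + (real X)\<^sup>2 * (ln (real n) - ln (real m))\<^sup>2) \<le> 1 / (1 + (real n - real m)\<^sup>2)"
        by (intro divide_left_mono mult_pos_pos add_pos_nonneg) auto
    qed
    also have "\<dots> \<le> 5" by (rule sum_inverse_one_plus_distance_square_le) simp
    finally show ?thesis .
  qed
  have B: "cmod (a n) \<le> (\<Sum>n=Y..<X. real n powr (-\<sigma>))" if "n \<in> space M" for n
    using that member_le_sum[of n "{Y..<X}" "\<lambda>n. real n powr (-\<sigma>)"] by (simp add: a_def M_def)
  have meas: "a \<in> borel_measurable M" "(\<lambda>n. ln (real n)) \<in> borel_measurable M" by (auto simp: M_def)
  have X: "real X > 0" using assms by simp
  note ms = mean_square_bound[OF M meas B X \<kappa>, unfolded f]
  show "(\<lambda>t. (cmod (\<Sum>n=Y..<X. of_nat n powr (- Complex \<sigma> t)))\<^sup>2) integrable_on {- real X..real X}"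
    by (rule ms(1))
  have sq: "(\<integral>n. (cmod (a n))\<^sup>2 \<partial>M) = (\<Sum>n=Y..<X. real n powr (-(2 * \<sigma>)))"
    unfolding int a_def by (intro sum.cong refl) (auto simp: power2_eq_square simp flip: powr_add)
  show "integral {- real X..real X} (\<lambda>t. (cmod (\<Sum>n=Y..<X. of_nat n powr (- Complex \<sigma> t)))\<^sup>2)
          \<le> 135 * real X * (\<Sum>n=Y..<X. real n powr (-(2 * \<sigma>)))"
    using ms(2) unfolding sq by (simp add: mult_ac)
qed

text \<open>
  In the variable \<open>x = ln u\<close> the remainder of Euler summation is a Fourier integral of the sawtooth function, so
  that \<open>mean_square_bound\<close> applies; the pointwise bound of this remainder would be too weak.
\<close>
definition saw :: "real \<Rightarrow> real" where "saw x = 1 - frac (exp x)"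

lemma saw_bounds: "0 \<le> saw x" "saw x \<le> 1"
  using frac_lt_1[of "exp x"] frac_ge_0[of "exp x"] by (auto simp: saw_def)

lemma saw_measurable [measurable]: "saw \<in> borel_measurable borel"
  unfolding saw_def frac_def by measurable

lemma exp_ln_nat_powr:
  assumes "n \<ge> 1"
  shows "exp (z * of_real (ln (real n))) = of_nat n powr (z :: complex)"
  using assms by (simp add: powr_def Ln_of_nat mult.commute)

text \<open>With u = exp x this is the integral of s (n + 1 - u) u^(-s - 1) over n \<le> u \<le> n +
  1; an integration by parts yields the remainder for M = 1, divided by s - 1.\<close>

lemma taylor_rem_has_integral:
  assumes "n \<ge> 1" "s \<noteq> 1"
  shows "((\<lambda>x. s * (of_real (saw x) * exp (- s * of_real x))) has_integral (taylor_rem 1 n s / (s - 1))) {ln (real n)..ln (real (Suc n))}"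
proof -
  define \<Phi> where "\<Phi> = (\<lambda>z. - (of_nat (Suc n) * exp (- s * z)) - s * exp ((1 - s) * z) / (1 - s))"
  have der: "(\<Phi> has_field_derivative (s * ((of_nat (Suc n) - exp z) * exp (- s * z)))) (at z)" for z
  proof -
    have "(\<Phi> has_field_derivative (- (of_nat (Suc n) * (exp (- s * z) * (- s))) - s * (exp ((1 - s) * z) * (1 - s)) / (1 - s))) (at z)"
      unfolding \<Phi>_def by (auto intro!: derivative_eq_intros)
    also have "- (of_nat (Suc n) * (exp (- s * z) * (- s))) - s * (exp ((1 - s) * z) * (1 - s)) / (1 - s)
       = s * (of_nat (Suc n) * exp (- s * z)) - s * exp ((1 - s) * z)" using assms by simp
    also have "(1 - s) * z = z + (- s * z)" by (simp add: algebra_simps)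
    also have "exp (z + (- s * z)) = exp z * exp (- s * z)" by (rule exp_add)
    finally show ?thesis by (simp add: algebra_simps)
  qed
  let ?a = "ln (real n)" and ?b = "ln (real (Suc n))"
  have "((\<lambda>x. s * ((of_nat (Suc n) - exp (of_real x)) * exp (- s * of_real x))) has_integral (\<Phi> (of_real ?b) - \<Phi> (of_real ?a))) {?a..?b}"
    using assms by (intro fundamental_theorem_of_calculus has_vector_derivative_real_field der) auto
  hence "((\<lambda>x. s * (of_real (saw x) * exp (- s * of_real x))) has_integral (\<Phi> (of_real ?b) - \<Phi> (of_real ?a))) {?a..?b}"
  \<comment> \<open>At the right endpoint exp x is an integer and \<open>saw\<close> jumps from 0
    back to 1, so this single point is excepted.\<close>
  proof (rule has_integral_spike_finite[of "{?b}", rotated -1])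
    fix x assume x: "x \<in> {?a..?b} - {?b}"
    have "exp (ln (real n)) \<le> exp x" using x by simp
    hence "real n \<le> exp x" using assms by simp
    moreover have "exp x < real n + 1"
    proof -
      have "x < ln (real (Suc n))" using x by simp
      hence "exp x < exp (ln (real (Suc n)))" by (simp only: exp_less_cancel_iff)
      thus ?thesis by simp
    qed
    ultimately have "\<lfloor>exp x\<rfloor> = int n" by (intro floor_unique) auto
    hence "saw x = real (Suc n) - exp x" by (simp add: saw_def frac_def)
    hence "of_real (saw x) = of_nat (Suc n) - exp (complex_of_real x)" by (simp add: exp_of_real)
    thus "s * (of_real (saw x) * exp (- s * of_real x)) = s * ((of_nat (Suc n) - exp (of_real x)) * exp (- s * of_real x))" by simp
  qed simp
  also have "\<Phi> (of_real ?b) - \<Phi> (of_real ?a) = taylor_rem 1 n s / (s - 1)"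
  proof -
    have b: "of_nat (Suc n) * (of_nat (Suc n) powr (- s)) = (of_nat (Suc n) powr (1 - s) :: complex)"
      using powr_add[of "of_nat (Suc n) :: complex" 1 "- s"] by (simp add: powr_one' del: of_nat_Suc)
    have a: "of_nat n * (of_nat n powr (- s)) = (of_nat n powr (1 - s) :: complex)"
      using assms powr_add[of "of_nat n :: complex" 1 "- s"] by simp
    have "\<Phi> (of_real ?b) = - (of_nat (Suc n) powr (1 - s)) - s * (of_nat (Suc n) powr (1 - s)) / (1 - s)"
      unfolding \<Phi>_def by (subst exp_ln_nat_powr, simp)+ (simp only: b)
    moreover have "\<Phi> (of_real ?a) = - ((of_nat n + 1) * (of_nat n powr (- s))) - s * (of_nat n powr (1 - s)) / (1 - s)"
      unfolding \<Phi>_def by (subst exp_ln_nat_powr, use assms in simp)+ (simp add: add.commute)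
    moreover have "(of_nat n + 1) * (of_nat n powr (- s)) = (of_nat n powr (1 - s) :: complex) + of_nat n powr (- s)"
      using a by (simp add: algebra_simps)
    moreover have "taylor_rem 1 n s = of_nat (Suc n) powr (1 - s) - of_nat n powr (1 - s) - (1 - s) * of_nat n powr (- s)"
      by (simp add: taylor_rem_def)
    moreover have "(- p - s * p / (1 - s)) - (- (q + r) - s * q / (1 - s)) = (p - q - (1 - s) * r) / (s - 1)" for p q r
      using assms by (simp add: divide_simps) algebra
    ultimately show ?thesis by (simp only:)
  qed
  finally show ?thesis .
qed

lemma taylor_rem_sum_has_integral:
  assumes "X \<ge> 1" "s \<noteq> 1" "X \<le> Z"
  shows "((\<lambda>x. s * (of_real (saw x) * exp (- s * of_real x))) has_integral ((\<Sum>n=X..<Z. taylor_rem 1 n s) / (s - 1))) {ln (real X)..ln (real Z)}"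
  using assms(3)
proof (induction Z rule: dec_induct)
  case base
  show ?case using has_integral_refl(2)[of _ "ln (real X)"] by simp
next
  case (step Z)
  have "((\<lambda>x. s * (of_real (saw x) * exp (- s * of_real x))) has_integral
      ((\<Sum>n=X..<Z. taylor_rem 1 n s) / (s - 1) + taylor_rem 1 Z s / (s - 1))) {ln (real X)..ln (real (Suc Z))}"
    using step assms by (intro has_integral_combine[OF _ _ step.IH taylor_rem_has_integral]) auto
  thus ?case using step.hyps by (simp add: add_divide_distrib)
qed

text \<open>The row integral of the kernel is a difference of arctangents divided by X, at most
  \<pi> / X < 4 / X, and 108 = 27 * 4. The bound is uniform in Z. Multiplied by |s|^2, of order X^2
  in this range, it is still o(X) for \<sigma> > 1 / 2.\<close>

lemma saw_transform_mean_square: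
  fixes X Z :: nat
  assumes "X \<ge> 1" "Z \<ge> X" "\<sigma> > 1 / 2"
  shows "(\<lambda>t. (cmod (integral {ln (real X)..ln (real Z)} (\<lambda>x. of_real (saw x) * exp (- Complex \<sigma> t * of_real x))))\<^sup>2) integrable_on {- real X..real X}"
    and "integral {- real X..real X} (\<lambda>t. (cmod (integral {ln (real X)..ln (real Z)} (\<lambda>x. of_real (saw x) * exp (- Complex \<sigma> t * of_real x))))\<^sup>2)
        \<le> 108 * real X powr (-(2 * \<sigma>))"
proof -
  let ?a = "ln (real X)" and ?b = "ln (real Z)"
  define M where "M = lborel_on ?a ?b"
  have M: "finite_measure M" unfolding M_def by (rule finite_measure_lborel_on)
  interpret M: finite_measure M by fact
  have id [measurable]: "(\<lambda>x. x) \<in> borel_measurable M" unfolding M_def by (rule measurable_restrict_space1) simp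
  have sm [measurable]: "saw \<in> borel_measurable M" unfolding M_def by (rule measurable_restrict_space1) simp
  define a where "a = (\<lambda>x. complex_of_real (saw x * exp (- \<sigma> * x)))"
  have am: "a \<in> borel_measurable M" unfolding a_def by measurable
  have sp: "x \<in> space M \<longleftrightarrow> ?a \<le> x \<and> x \<le> ?b" for x by (simp add: M_def space_restrict_space)
  have a0: "?a \<ge> 0" using assms by simp
  have ax: "cmod (a x) \<le> exp (- \<sigma> * x)" for x
    using saw_bounds[of x] by (simp add: a_def norm_mult mult_left_le_one_le)
  have B: "cmod (a x) \<le> 1" if "x \<in> space M" for x
  proof -
    have "\<sigma> * x \<ge> 0" using that[unfolded sp] a0 assms by (intro mult_nonneg_nonneg) linarith+
    hence "exp (- \<sigma> * x) \<le> 1" by simp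
    thus ?thesis using ax[of x] by linarith
  qed
  have X: "real X > 0" using assms by simp
  have \<kappa>: "(\<integral>y. 1 / (1 + (real X)\<^sup>2 * (x - y)\<^sup>2) \<partial>M) \<le> 4 / real X" for x
  proof -
    have cont: "continuous_on {?a..?b} (\<lambda>y. 1 / (1 + (real X)\<^sup>2 * (x - y)\<^sup>2))"
      by (intro continuous_intros) (auto simp: add_nonneg_eq_0_iff)
    have "(\<integral>y. 1 / (1 + (real X)\<^sup>2 * (x - y)\<^sup>2) \<partial>M) = integral {?a..?b} (\<lambda>y. 1 / (1 + (real X)\<^sup>2 * (x - y)\<^sup>2))"
      unfolding M_def by (intro lborel_on_integral(2) integrable_lborel_on_continuous cont)
    also have "\<dots> = arctan (real X * (?b - x)) / real X - arctan (real X * (?a - x)) / real X"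
    proof (rule integral_unique, rule fundamental_theorem_of_calculus)
      show "?a \<le> ?b" using assms by simp
      fix y
      have "((\<lambda>y. arctan (real X * (y - x)) / real X) has_field_derivative (inverse (1 + (real X * (y - x))\<^sup>2) * real X / real X)) (at y)"
        by (auto intro!: derivative_eq_intros)
      moreover have "inverse (1 + (real X * (y - x))\<^sup>2) * real X / real X = 1 / (1 + (real X)\<^sup>2 * (x - y)\<^sup>2)"
        using X by (simp add: power_mult_distrib divide_inverse power2_commute)
      ultimately show "((\<lambda>y. arctan (real X * (y - x)) / real X) has_vector_derivative 1 / (1 + (real X)\<^sup>2 * (x - y)\<^sup>2)) (at y within {?a..?b})"
        by (simp add: has_real_derivative_iff_has_vector_derivative has_vector_derivative_at_within)
    qed
    also have "\<dots> \<le> 4 / real X"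
      using arctan_ubound[of "real X * (?b - x)"] arctan_lbound[of "real X * (?a - x)"] pi_less_4 X
      by (simp add: divide_right_mono flip: diff_divide_distrib)
    finally show ?thesis .
  qed
  have fI: "(\<integral>x. a x * cis (- (t * x)) \<partial>M) = integral {?a..?b} (\<lambda>x. of_real (saw x) * exp (- Complex \<sigma> t * of_real x))" for t
  proof -
    have eq: "a x * cis (- (t * x)) = of_real (saw x) * exp (- Complex \<sigma> t * of_real x)" for x
    proof -
      have "- Complex \<sigma> t * of_real x = of_real (- \<sigma> * x) + \<i> * of_real (- (t * x))" by (simp add: complex_eq_iff)
      hence "exp (- Complex \<sigma> t * of_real x) = of_real (exp (- \<sigma> * x)) * cis (- (t * x))"
        by (simp only: exp_add cis_conv_exp exp_of_real)
      thus ?thesis by (simp add: a_def)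
    qed
    have "integrable M (\<lambda>x. a x * cis (- (t * x)))"
      by (rule M.integrable_const_bound[where B = 1])
         (use B am in \<open>auto intro!: AE_I2 simp: norm_mult cis_conv_exp\<close>)
    from lborel_on_integral(2)[OF this[unfolded M_def]] show ?thesis unfolding M_def eq .
  qed
  note ms = mean_square_bound[OF M am id B X \<kappa>, unfolded fI]
  show "(\<lambda>t. (cmod (integral {?a..?b} (\<lambda>x. of_real (saw x) * exp (- Complex \<sigma> t * of_real x))))\<^sup>2) integrable_on {- real X..real X}"
    by (rule ms(1))
  have sq: "(\<integral>x. (cmod (a x))\<^sup>2 \<partial>M) \<le> real X powr (-(2 * \<sigma>))"
  proof -
    have "(\<integral>x. (cmod (a x))\<^sup>2 \<partial>M) \<le> (\<integral>x. exp (- (2 * \<sigma>) * x) \<partial>M)"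
    proof (rule integral_mono')
      show "integrable M (\<lambda>x. exp (- (2 * \<sigma>) * x))"
        unfolding M_def by (intro integrable_lborel_on_continuous continuous_intros)
      show "(cmod (a x))\<^sup>2 \<le> exp (- (2 * \<sigma>) * x)" for x
      proof -
        have "(cmod (a x))\<^sup>2 \<le> (exp (- \<sigma> * x))\<^sup>2" using ax by (intro power_mono) auto
        thus ?thesis by (simp add: power2_eq_square algebra_simps flip: exp_add)
      qed
    qed simp
    also have "\<dots> = integral {?a..?b} (\<lambda>x. exp (- (2 * \<sigma>) * x))"
      unfolding M_def by (intro lborel_on_integral(2) integrable_lborel_on_continuous continuous_intros)
    also have "\<dots> = - exp (- (2 * \<sigma>) * ?b) / (2 * \<sigma>) - (- exp (- (2 * \<sigma>) * ?a) / (2 * \<sigma>))"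
    proof (rule integral_unique, rule fundamental_theorem_of_calculus)
      show "?a \<le> ?b" using assms by simp
      fix x
      have "((\<lambda>x. - exp (- (2 * \<sigma>) * x) / (2 * \<sigma>)) has_field_derivative (- (exp (- (2 * \<sigma>) * x) * (- (2 * \<sigma>))) / (2 * \<sigma>))) (at x)"
        by (auto intro!: derivative_eq_intros)
      thus "((\<lambda>x. - exp (- (2 * \<sigma>) * x) / (2 * \<sigma>)) has_vector_derivative exp (- (2 * \<sigma>) * x)) (at x within {?a..?b})"
        using assms by (simp add: has_real_derivative_iff_has_vector_derivative has_vector_derivative_at_within)
    qed
    also have "\<dots> \<le> exp (- (2 * \<sigma>) * ?a) / (2 * \<sigma>)" using assms by (simp add: divide_nonneg_nonneg)
    also have "\<dots> \<le> exp (- (2 * \<sigma>) * ?a)" using assms by (simp add: divide_le_eq)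
    also have "\<dots> = real X powr (-(2 * \<sigma>))" using assms by (simp add: powr_def)
    finally show ?thesis .
  qed
  have "27 * real X * (4 / real X) * (\<integral>x. (cmod (a x))\<^sup>2 \<partial>M) = 108 * (\<integral>x. (cmod (a x))\<^sup>2 \<partial>M)" using X by simp
  also have "\<dots> \<le> 108 * real X powr (-(2 * \<sigma>))" using sq by simp
  finally show "integral {- real X..real X} (\<lambda>t. (cmod (integral {?a..?b} (\<lambda>x. of_real (saw x) * exp (- Complex \<sigma> t * of_real x))))\<^sup>2)
        \<le> 108 * real X powr (-(2 * \<sigma>))" using ms(2) by linarith
qed

section \<open>Mean square of zeta minus a partial sum of its series\<close>

lemma continuous_on_zeta_vertical:
  fixes e :: real
  assumes "e \<noteq> 0"
  shows "continuous_on {1..X} (\<lambda>t. zeta (Complex \<sigma> (e * t)))"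
proof (rule continuous_on_compose2[OF holomorphic_on_imp_continuous_on[OF holomorphic_zeta]])
  show "continuous_on {1..X} (\<lambda>t. Complex \<sigma> (e * t))" unfolding Complex_eq by (intro continuous_intros)
  show "(\<lambda>t. Complex \<sigma> (e * t)) ` {1..X} \<subseteq> - {1}" using assms by (auto simp: complex_eq_iff)
qed

lemma continuous_on_nat_powr_vertical:
  assumes "n \<ge> 1"
  shows "continuous_on A (\<lambda>t. of_nat n powr (- Complex \<sigma> (e * t)) :: complex)"
proof -
  have "of_nat n powr (- z) = exp (- z * of_real (ln (real n)))" for z :: complex
    using assms by (simp add: powr_def Ln_of_nat)
  thus ?thesis unfolding Complex_eq by (simp only:) (intro continuous_intros)
qed

lemma one_sided_integral_le:
  fixes g :: "real \<Rightarrow> real" and X :: real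
  assumes "g integrable_on {-X..X}" "\<And>t. g t \<ge> 0" "e = 1 \<or> e = -1"
  shows "(\<lambda>t. g (e * t)) integrable_on {1..X}" "integral {1..X} (\<lambda>t. g (e * t)) \<le> integral {-X..X} g"
proof -
  have A: "(\<lambda>t. h t) integrable_on {1..X} \<and> integral {1..X} h \<le> integral {-X..X} h"
    if "h integrable_on {-X..X}" "\<And>t. h t \<ge> 0" for h :: "real \<Rightarrow> real"
  proof (cases "X \<ge> 1")
    case True
    have sub: "{1..X} \<subseteq> {-X..X}" using True by auto
    have i: "h integrable_on {1..X}" using integrable_on_subinterval[OF that(1) sub] .
    thus ?thesis using integral_subset_le[OF sub i that(1)] that(2) by auto
  next
    case False
    hence "{1..X} = {}" by auto
    thus ?thesis using integral_nonneg[OF that(1)] that(2) by auto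
  qed
  have r: "(\<lambda>t. g (- t)) integrable_on {-X..X}" using assms(1) Henstock_Kurzweil_Integration.integrable_reflect_real[where f = g and a = "-X" and b = X] by simp
  have r2: "integral {-X..X} (\<lambda>t. g (- t)) = integral {-X..X} g"
    using Henstock_Kurzweil_Integration.integral_reflect_real[where f = g and a = "-X" and b = X] by simp
  show "(\<lambda>t. g (e * t)) integrable_on {1..X}" "integral {1..X} (\<lambda>t. g (e * t)) \<le> integral {-X..X} g"
    using assms(3) A[OF assms(1,2)] A[OF r assms(2)] r2 by auto
qed

lemma norm_sum4_square_le:
  fixes a b c d :: complex
  shows "(cmod (a + b + c + d))\<^sup>2 \<le> 4 * ((cmod a)\<^sup>2 + (cmod b)\<^sup>2 + (cmod c)\<^sup>2 + (cmod d)\<^sup>2)"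
proof -
  have "cmod (a + b + c + d) \<le> cmod a + cmod b + cmod c + cmod d"
    by (intro norm_triangle_le add_right_mono norm_triangle_ineq)
  hence "(cmod (a + b + c + d))\<^sup>2 \<le> (cmod a + cmod b + cmod c + cmod d)\<^sup>2" by (intro power_mono) auto
  also have "\<dots> \<le> 4 * ((cmod a)\<^sup>2 + (cmod b)\<^sup>2 + (cmod c)\<^sup>2 + (cmod d)\<^sup>2)"
  proof -
    have "0 \<le> (w - x)\<^sup>2 + (w - y)\<^sup>2 + (w - z)\<^sup>2 + (x - y)\<^sup>2 + (x - z)\<^sup>2 + (y - z)\<^sup>2" for w x y z :: real
      by (intro add_nonneg_nonneg) auto
    also have "(w - x)\<^sup>2 + (w - y)\<^sup>2 + (w - z)\<^sup>2 + (x - y)\<^sup>2 + (x - z)\<^sup>2 + (y - z)\<^sup>2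
       = 4 * (w\<^sup>2 + x\<^sup>2 + y\<^sup>2 + z\<^sup>2) - (w + x + y + z)\<^sup>2" for w x y z :: real
      by (simp add: power2_eq_square algebra_simps)
    finally show ?thesis by simp
  qed
  finally show ?thesis .
qed

text \<open>A crude pointwise bound, meant for the part beyond Z only: Z may depend on X, and a
  large Z makes up for the factor |s|. Here 16 = 2^4, since Re s + 1 \<le> 4.\<close>

lemma taylor_rem_tail_bound:
  assumes \<sigma>0: "\<sigma>0 > 0" and \<sigma>: "\<sigma>0 \<le> Re s" "Re s \<le> 3" and "Z \<ge> 1"
  shows "cmod (\<Sum>n. taylor_rem 1 (n + Z) s) \<le> cmod (s - 1) * (16 * cmod s * (\<Sum>n. real (n + Z) powr (- \<sigma>0 - 1)))"
proof -
  have sm: "summable (\<lambda>n. cmod (s - 1) * (16 * cmod s * real (n + Z) powr (- \<sigma>0 - 1)))"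
    using \<sigma>0 by (intro summable_mult summable_shifted_powr) auto
  have le: "cmod (taylor_rem 1 (n + Z) s) \<le> cmod (s - 1) * (16 * cmod s * real (n + Z) powr (- \<sigma>0 - 1))" for n
  proof -
    have n1: "n + Z \<ge> 1" using assms by simp
    have p2: "2 powr \<bar>Re s + real 1\<bar> \<le> (16::real)"
    proof -
      have "2 powr \<bar>Re s + real 1\<bar> \<le> (2::real) powr 4" using \<sigma> \<sigma>0 by (intro powr_mono) auto
      thus ?thesis by simp
    qed
    have pr: "(\<Prod>j<Suc 1. cmod (1 - s - of_nat j)) = cmod (s - 1) * cmod s"
      by (simp add: norm_minus_commute)
    have "cmod (taylor_rem 1 (n + Z) s) \<le> cmod (s - 1) * cmod s * 2 powr \<bar>Re s + real 1\<bar> * real (n + Z) powr (- Re s - real 1)"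
      using taylor_rem_bound[OF n1, of 1 s] unfolding pr .
    also have "\<dots> \<le> cmod (s - 1) * cmod s * 16 * real (n + Z) powr (- \<sigma>0 - 1)"
      using \<sigma> n1 p2 by (intro mult_mono powr_mono) auto
    finally show ?thesis by (simp add: mult_ac)
  qed
  have "cmod (\<Sum>n. taylor_rem 1 (n + Z) s) \<le> (\<Sum>n. cmod (s - 1) * (16 * cmod s * real (n + Z) powr (- \<sigma>0 - 1)))"
    by (rule norm_suminf_le[OF le sm])
  also have "\<dots> = cmod (s - 1) * (16 * cmod s * (\<Sum>n. real (n + Z) powr (- \<sigma>0 - 1)))"
    using \<sigma>0 by (subst suminf_mult, intro summable_mult summable_shifted_powr, simp)+ simp
  finally show ?thesis .
qed

text \<open>Four errors: the terms Y \<le> n < X, the main term X^(1 - s) / (s - 1), which is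
  harmless for t \<ge> 1, the sawtooth integral up to Z, and the remainder beyond Z. The range
  starts at 1 to stay away from the pole, and e = -1 covers the lower half-plane. The constant is 4
  * 135 + 4 * (1 + 16 * 108 + 1).\<close>

lemma zeta_mean_square:
  fixes \<sigma>0 \<sigma> e :: real and X Y :: nat
  assumes \<sigma>0: "1 / 2 < \<sigma>0" "\<sigma>0 < 1" and \<sigma>: "\<sigma>0 \<le> \<sigma>" "\<sigma> \<le> 3" and e: "e = 1 \<or> e = -1" and YX: "1 \<le> Y" "Y \<le> X"
  shows "integral {1..real X} (\<lambda>t. (cmod (zeta (Complex \<sigma> (e * t)) - (\<Sum>n=1..<Y. of_nat n powr (- Complex \<sigma> (e * t)))))\<^sup>2)
     \<le> 7460 * (real X * (\<Sum>n=Y..<X. real n powr (-(2 * \<sigma>0))) + real X powr (2 - 2 * \<sigma>0))"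
proof -
  have X1: "real X \<ge> 1" using YX by simp
  have "summable (\<lambda>n. real n powr (- \<sigma>0 - 1))" using \<sigma>0 by (simp add: summable_real_powr_iff)
  \<comment> \<open>Chosen so that, with |s| \<le> 4 X, the last remainder is at most 16 * 4 X / (64
    X^2) = 1 / X.\<close>
  from suminf_exist_split[OF _ this, of "1 / (64 * (real X)\<^sup>2)"] X1
  obtain N where N: "\<And>n. n \<ge> N \<Longrightarrow> norm (\<Sum>i. real (i + n) powr (- \<sigma>0 - 1)) < 1 / (64 * (real X)\<^sup>2)" by auto
  define Z where "Z = max N X"
  have Z: "Z \<ge> X" "Z \<ge> 1" "(\<Sum>i. real (i + Z) powr (- \<sigma>0 - 1)) < 1 / (64 * (real X)\<^sup>2)"
    using N[of Z] YX by (auto simp: Z_def)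
  define A where "A = (\<lambda>t. \<Sum>n=Y..<X. of_nat n powr (- Complex \<sigma> t) :: complex)"
  define J where "J = (\<lambda>t. integral {ln (real X)..ln (real Z)} (\<lambda>x. of_real (saw x) * exp (- Complex \<sigma> t * of_real x)))"
  define B where "B = (\<lambda>t. of_nat X powr (1 - Complex \<sigma> t) / (Complex \<sigma> t - 1))"
  define R where "R = (\<lambda>t. (\<Sum>n. taylor_rem 1 (n + Z) (Complex \<sigma> t)) / (Complex \<sigma> t - 1))"
  define F where "F = (\<lambda>t. zeta (Complex \<sigma> t) - (\<Sum>n=1..<Y. of_nat n powr (- Complex \<sigma> t)))"
  have decomp: "F t = A t + B t + Complex \<sigma> t * J t + R t" if "t \<noteq> 0" for t
  proof -
    let ?s = "Complex \<sigma> t"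
    have s: "?s \<noteq> 1" "Re ?s > 0" using that \<sigma> \<sigma>0 by (auto simp: complex_eq_iff)
    have X: "X \<ge> 1" using YX by simp
    have J': "?s * J t = (\<Sum>n=X..<Z. taylor_rem 1 n ?s) / (?s - 1)"
      using integral_unique[OF taylor_rem_sum_has_integral[OF X s(1) Z(1)]] unfolding J_def by simp
    have "(\<Sum>n. taylor_rem 1 (n + X) ?s) = (\<Sum>n. taylor_rem 1 (n + (Z - X) + X) ?s) + (\<Sum>n<Z-X. taylor_rem 1 (n + X) ?s)"
      using taylor_rem_summable[of X 1 ?s] X s by (intro suminf_split_initial_segment) auto
    also have "(\<Sum>n<Z-X. taylor_rem 1 (n + X) ?s) = (\<Sum>n=X..<Z. taylor_rem 1 n ?s)"
      by (rule sum.reindex_bij_witness[of _ "\<lambda>n. n - X" "\<lambda>n. n + X"]) auto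
    finally have split: "(\<Sum>n. taylor_rem 1 (n + X) ?s) = (\<Sum>n. taylor_rem 1 (n + Z) ?s) + (\<Sum>n=X..<Z. taylor_rem 1 n ?s)"
      using Z(1) by simp
    have "zeta ?s = ((?s - 1) * zeta ?s) / (?s - 1)" using s by simp
    also have "\<dots> = (\<Sum>n=1..<X. of_nat n powr (- ?s)) + B t + (\<Sum>n. taylor_rem 1 (n + X) ?s) / (?s - 1)"
      unfolding zeta_formula[OF s(2,1) X] B_def using s by (simp add: add_divide_distrib)
    also have "(\<Sum>n=1..<X. of_nat n powr (- ?s)) = (\<Sum>n=1..<Y. of_nat n powr (- ?s)) + A t"
      unfolding A_def using YX by (simp add: sum.atLeastLessThan_concat)
    finally show ?thesis unfolding F_def J' split R_def by (simp add: add_divide_distrib)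
  qed
  have Jms: "(\<lambda>t. (cmod (J t))\<^sup>2) integrable_on {- real X..real X}"
    "integral {- real X..real X} (\<lambda>t. (cmod (J t))\<^sup>2) \<le> 108 * real X powr (-(2 * \<sigma>))"
    unfolding J_def using saw_transform_mean_square[of X Z \<sigma>] Z YX \<sigma> \<sigma>0 by auto
  have Ams: "(\<lambda>t. (cmod (A t))\<^sup>2) integrable_on {- real X..real X}"
    "integral {- real X..real X} (\<lambda>t. (cmod (A t))\<^sup>2) \<le> 135 * real X * (\<Sum>n=Y..<X. real n powr (-(2 * \<sigma>)))"
    unfolding A_def using dirichlet_polynomial_mean_square[of Y X \<sigma>] YX by auto
  note J1 = one_sided_integral_le[OF Jms(1) zero_le_power2 e] and A1 = one_sided_integral_le[OF Ams(1) zero_le_power2 e]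
  have pw: "real X powr (2 - 2 * \<sigma>) \<le> real X powr (2 - 2 * \<sigma>0)" using X1 \<sigma> by (intro powr_mono) auto
  have inv: "((\<lambda>t. 1 / t\<^sup>2) has_integral (- (1 / real X) - (- (1 / 1)))) {1..real X}"
  proof (rule fundamental_theorem_of_calculus)
    fix t :: real assume t: "t \<in> {1..real X}"
    have "((\<lambda>t. - (1 / t)) has_field_derivative 1 / t\<^sup>2) (at t)"
      using t by (auto intro!: derivative_eq_intros simp: power2_eq_square)
    thus "((\<lambda>t. - (1 / t)) has_vector_derivative 1 / t\<^sup>2) (at t within {1..real X})"
      by (simp add: has_real_derivative_iff_has_vector_derivative has_vector_derivative_at_within)
  qed (use X1 in auto)
  define G where "G = (\<lambda>t. 4 * ((cmod (A (e * t)))\<^sup>2 + real X powr (2 - 2 * \<sigma>0) * (1 / t\<^sup>2) + 16 * (real X)\<^sup>2 * (cmod (J (e * t)))\<^sup>2 + 1 / (real X)\<^sup>2))"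
  define GI where "GI = 4 * (integral {1..real X} (\<lambda>t. (cmod (A (e * t)))\<^sup>2) + real X powr (2 - 2 * \<sigma>0) * (- (1 / real X) - (- (1 / 1)))
      + 16 * (real X)\<^sup>2 * integral {1..real X} (\<lambda>t. (cmod (J (e * t)))\<^sup>2) + (real X - 1) *\<^sub>R (1 / (real X)\<^sup>2))"
  have Ghas: "(G has_integral GI) {1..real X}"
  proof -
    have "((\<lambda>t. 1 / (real X)\<^sup>2) has_integral ((real X - 1) *\<^sub>R (1 / (real X)\<^sup>2))) {1..real X}"
      using has_integral_const_real[of "1 / (real X)\<^sup>2" 1 "real X"] X1 by simp
    thus ?thesis unfolding G_def GI_def
      by (intro has_integral_mult_right has_integral_add integrable_integral J1(1) A1(1) inv)
  qed
  have le: "(cmod (F (e * t)))\<^sup>2 \<le> G t" if t: "t \<in> {1..real X}" for t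
  proof -
    let ?s = "Complex \<sigma> (e * t)"
    have et: "\<bar>e * t\<bar> = t" "e * t \<noteq> 0" using e t by auto
    have s1: "cmod (?s - 1) \<ge> t" using abs_Im_le_cmod[of "?s - 1"] et by simp
    have sX: "cmod ?s \<le> 4 * real X"
      using cmod_le[of ?s] et \<sigma> \<sigma>0 t X1 by simp
    have "cmod (B (e * t)) \<le> real X powr (1 - \<sigma>0) / t"
    proof -
      have "cmod (B (e * t)) = real X powr (1 - \<sigma>) / cmod (?s - 1)" by (simp add: B_def norm_divide)
      also have "\<dots> \<le> real X powr (1 - \<sigma>0) / t" using s1 t X1 \<sigma> by (intro frac_le powr_mono) auto
      finally show ?thesis .
    qed
    hence "(cmod (B (e * t)))\<^sup>2 \<le> (real X powr (1 - \<sigma>0) / t)\<^sup>2" by (intro power_mono) auto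
    also have "\<dots> = real X powr (2 - 2 * \<sigma>0) * (1 / t\<^sup>2)"
      by (simp add: power_divide power2_eq_square[of "real X powr (1 - \<sigma>0)"] flip: powr_add)
    finally have b: "(cmod (B (e * t)))\<^sup>2 \<le> real X powr (2 - 2 * \<sigma>0) * (1 / t\<^sup>2)" .
    have "(cmod (?s * J (e * t)))\<^sup>2 = (cmod ?s)\<^sup>2 * (cmod (J (e * t)))\<^sup>2" by (simp add: norm_mult power_mult_distrib)
    also have "\<dots> \<le> (4 * real X)\<^sup>2 * (cmod (J (e * t)))\<^sup>2" using sX by (intro mult_right_mono power_mono) auto
    finally have c: "(cmod (?s * J (e * t)))\<^sup>2 \<le> 16 * (real X)\<^sup>2 * (cmod (J (e * t)))\<^sup>2" by (simp add: power_mult_distrib)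
    have "cmod (R (e * t)) \<le> 16 * cmod ?s * (\<Sum>n. real (n + Z) powr (- \<sigma>0 - 1))"
    proof -
      have "cmod (\<Sum>n. taylor_rem 1 (n + Z) ?s) \<le> cmod (?s - 1) * (16 * cmod ?s * (\<Sum>n. real (n + Z) powr (- \<sigma>0 - 1)))"
        using \<sigma>0 \<sigma> Z by (intro taylor_rem_tail_bound) auto
      moreover have "cmod (?s - 1) > 0" using s1 t by auto
      ultimately show ?thesis by (simp add: R_def norm_divide divide_le_eq mult_ac)
    qed
    also have "\<dots> \<le> 16 * (4 * real X) * (1 / (64 * (real X)\<^sup>2))"
      using sX Z(3) by (intro mult_mono suminf_nonneg summable_shifted_powr) (use \<sigma>0 in auto)
    also have "\<dots> = 1 / real X" using X1 by (simp add: power2_eq_square)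
    finally have "(cmod (R (e * t)))\<^sup>2 \<le> (1 / real X)\<^sup>2" by (intro power_mono) auto
    hence r: "(cmod (R (e * t)))\<^sup>2 \<le> 1 / (real X)\<^sup>2" by (simp add: power_divide)
    have "(cmod (F (e * t)))\<^sup>2 \<le> 4 * ((cmod (A (e * t)))\<^sup>2 + (cmod (B (e * t)))\<^sup>2 + (cmod (?s * J (e * t)))\<^sup>2 + (cmod (R (e * t)))\<^sup>2)"
      unfolding decomp[OF et(2)] by (rule norm_sum4_square_le)
    also have "\<dots> \<le> G t" unfolding G_def using b c r by (intro mult_left_mono add_mono) auto
    finally show ?thesis .
  qed
  have "integral {1..real X} (\<lambda>t. (cmod (F (e * t)))\<^sup>2) \<le> integral {1..real X} G"
  proof (rule integral_le[OF _ has_integral_integrable[OF Ghas] le])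
    show "(\<lambda>t. (cmod (F (e * t)))\<^sup>2) integrable_on {1..real X}"
      unfolding F_def using e
      by (intro integrable_continuous_interval continuous_intros continuous_on_zeta_vertical continuous_on_nat_powr_vertical) auto
  qed
  also have "integral {1..real X} G = GI" by (rule integral_unique[OF Ghas])
  also have "GI = 4 * (integral {1..real X} (\<lambda>t. (cmod (A (e * t)))\<^sup>2) + real X powr (2 - 2 * \<sigma>0) * (1 - 1 / real X)
      + 16 * (real X)\<^sup>2 * integral {1..real X} (\<lambda>t. (cmod (J (e * t)))\<^sup>2) + (real X - 1) / (real X)\<^sup>2)"
    by (simp add: GI_def)
  also have "\<dots> \<le> 4 * (135 * real X * (\<Sum>n=Y..<X. real n powr (-(2 * \<sigma>0))) + real X powr (2 - 2 * \<sigma>0) * 1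
      + 1728 * real X powr (2 - 2 * \<sigma>0) + real X powr (2 - 2 * \<sigma>0))"
  proof (intro mult_left_mono add_mono)
    have "integral {1..real X} (\<lambda>t. (cmod (A (e * t)))\<^sup>2) \<le> 135 * real X * (\<Sum>n=Y..<X. real n powr (-(2 * \<sigma>)))"
      using A1(2) Ams(2) by force
    also have "\<dots> \<le> 135 * real X * (\<Sum>n=Y..<X. real n powr (-(2 * \<sigma>0)))"
      using \<sigma> YX by (intro mult_left_mono sum_mono powr_mono) auto
    finally show "integral {1..real X} (\<lambda>t. (cmod (A (e * t)))\<^sup>2) \<le> 135 * real X * (\<Sum>n=Y..<X. real n powr (-(2 * \<sigma>0)))" .
    have "16 * (real X)\<^sup>2 * integral {1..real X} (\<lambda>t. (cmod (J (e * t)))\<^sup>2) \<le> 16 * (real X)\<^sup>2 * (108 * real X powr (-(2 * \<sigma>)))"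
      using J1(2) Jms(2) by (intro mult_left_mono) force+
    also have "\<dots> = 1728 * (real X powr 2 * real X powr (-(2 * \<sigma>)))" using X1 by simp
    also have "real X powr 2 * real X powr (-(2 * \<sigma>)) = real X powr (2 - 2 * \<sigma>)" by (simp only: powr_add[symmetric]) simp
    also note pw
    finally show "16 * (real X)\<^sup>2 * integral {1..real X} (\<lambda>t. (cmod (J (e * t)))\<^sup>2) \<le> 1728 * real X powr (2 - 2 * \<sigma>0)" by simp
    have "(real X - 1) / (real X)\<^sup>2 \<le> 1" 
    proof -
      have "real X - 1 \<le> (real X)\<^sup>2" using self_le_power[OF X1, of 2] by linarith
      thus ?thesis using X1 by (simp add: divide_le_eq)
    qed
    also have "1 \<le> real X powr (2 - 2 * \<sigma>0)" using X1 \<sigma>0 by (intro ge_one_powr_ge_zero) auto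
    finally show "(real X - 1) / (real X)\<^sup>2 \<le> real X powr (2 - 2 * \<sigma>0)" .
  qed (use X1 in auto)
  also have "\<dots> \<le> 7460 * (real X * (\<Sum>n=Y..<X. real n powr (-(2 * \<sigma>0))) + real X powr (2 - 2 * \<sigma>0))"
  proof -
    have "real X * (\<Sum>n=Y..<X. real n powr (-(2 * \<sigma>0))) \<ge> 0" by (intro mult_nonneg_nonneg sum_nonneg) auto
    thus ?thesis by simp
  qed
  finally show ?thesis unfolding F_def .
qed

section \<open>A rational case of the six exponentials theorem\<close>

text \<open>The Vandermonde argument by duality: the relations extend from powers to all polynomials
  in the nodes, in particular to one that vanishes at all nodes but one.\<close>

lemma exponential_sums_independent:
  fixes B c :: "'a \<Rightarrow> real"
  assumes "finite W" "inj_on B W" "\<And>k. (\<Sum>w\<in>W. c w * B w ^ k) = 0" "w \<in> W"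
  shows "c w = 0"
proof -
  have poly0: "(\<Sum>v\<in>W. c v * poly P (B v)) = 0" for P
  proof -
    have "(\<Sum>v\<in>W. c v * poly P (B v)) = (\<Sum>v\<in>W. \<Sum>i\<le>degree P. coeff P i * (c v * B v ^ i))"
      by (simp add: poly_altdef sum_distrib_left mult_ac)
    also have "\<dots> = (\<Sum>i\<le>degree P. coeff P i * (\<Sum>v\<in>W. c v * B v ^ i))"
      by (subst sum.swap) (simp add: sum_distrib_left)
    finally show ?thesis by (simp add: assms(3))
  qed
  define P where "P = (\<Prod>v\<in>W-{w}. [:- B v, 1:])"
  have P: "poly P x = (\<Prod>v\<in>W-{w}. x - B v)" for x by (simp add: P_def poly_prod)
  have "(\<Sum>v\<in>W. c v * poly P (B v)) = (\<Sum>v\<in>{w}. c v * poly P (B v))"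
    by (rule sum.mono_neutral_right) (use assms in \<open>auto simp: P prod_zero_iff\<close>)
  hence "c w * poly P (B w) = 0" using poly0 by simp
  moreover have "poly P (B w) \<noteq> 0"
    using assms by (auto simp: P prod_zero_iff inj_on_eq_iff)
  ultimately show ?thesis by simp
qed

lemma entire_factor_zeros:
  fixes f :: "complex \<Rightarrow> complex"
  assumes "finite Z" "f holomorphic_on UNIV" "\<And>z. z \<in> Z \<Longrightarrow> f z = 0"
  shows "\<exists>g. g holomorphic_on UNIV \<and> (\<forall>z. f z = g z * (\<Prod>a\<in>Z. z - a))"
  using assms(1,3)
proof (induction Z rule: finite_induct)
  case empty
  show ?case using assms(2) by (intro exI[of _ f]) simp
next
  case (insert a Z)
  from insert.IH insert.prems obtain g where g: "g holomorphic_on UNIV" "\<forall>z. f z = g z * (\<Prod>a\<in>Z. z - a)" by auto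
  have "f a = 0" using insert.prems by simp
  moreover have "(\<Prod>b\<in>Z. a - b) \<noteq> 0" using insert.hyps by (auto simp: prod_zero_iff)
  ultimately have ga: "g a = 0" using g(2) by (metis mult_eq_0_iff)
  define h where "h = (\<lambda>z. if z = a then deriv g a else (g z - g a) / (z - a))"
  have "h holomorphic_on UNIV" unfolding h_def by (rule pole_lemma_open[OF g(1)]) simp
  moreover have "g z = h z * (z - a)" for z using ga by (simp add: h_def)
  ultimately show ?case using g(2) insert.hyps by (intro exI[of _ h]) (auto simp: mult_ac)
qed

text \<open>Divide by the zeros and apply the maximum principle to the quotient on the disc of
  radius 7 r. On its boundary each |z - a| is at least 6 r, while |w - a| \<le> 2 r, so every zero
  gains a factor 1 / 3; later this is compared with powers of e.\<close>

lemma schwarz_many_zeros: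
  fixes f :: "complex \<Rightarrow> complex"
  assumes "finite Z" "f holomorphic_on UNIV" "\<And>z. z \<in> Z \<Longrightarrow> f z = 0"
    and r: "r > 0" "\<And>z. z \<in> Z \<Longrightarrow> cmod z \<le> r" and w: "cmod w \<le> r"
    and B: "\<And>z. cmod z = 7 * r \<Longrightarrow> cmod (f z) \<le> B"
  shows "cmod (f w) \<le> B * (1 / 3) ^ card Z"
proof -
  obtain g where g: "g holomorphic_on UNIV" "\<And>z. f z = g z * (\<Prod>a\<in>Z. z - a)"
    using entire_factor_zeros[OF assms(1-3)] by auto
  let ?n = "card Z"
  have gb: "cmod (g z) \<le> B / (6 * r) ^ ?n" if z: "cmod z = 7 * r" for z
  proof -
    have "(6 * r) ^ ?n = (\<Prod>a\<in>Z. 6 * r)" by simp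
    also have "\<dots> \<le> (\<Prod>a\<in>Z. cmod (z - a))"
    proof (rule prod_mono)
      fix a assume "a \<in> Z"
      hence "cmod a \<le> r" by (rule r(2))
      thus "0 \<le> 6 * r \<and> 6 * r \<le> cmod (z - a)"
        using r(1) z norm_triangle_ineq2[of z a] by linarith
    qed
    finally have "cmod (g z) * (6 * r) ^ ?n \<le> cmod (g z) * (\<Prod>a\<in>Z. cmod (z - a))"
      by (intro mult_left_mono) auto
    also have "\<dots> = cmod (f z)" by (simp add: g(2) norm_mult prod_norm)
    also have "\<dots> \<le> B" using B z by simp
    finally show ?thesis using r by (simp add: field_simps)
  qed
  have "cmod (g w) \<le> B / (6 * r) ^ ?n"
  proof (rule maximum_modulus_frontier[of g "cball 0 (7 * r)"])
    show "g holomorphic_on interior (cball 0 (7 * r))" using g(1) holomorphic_on_subset by blast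
    show "continuous_on (closure (cball 0 (7 * r))) g"
      using g(1) holomorphic_on_imp_continuous_on continuous_on_subset by blast
    show "w \<in> cball 0 (7 * r)" using w r by simp
    fix z :: complex assume "z \<in> frontier (cball 0 (7 * r))"
    hence "cmod z = 7 * r" using r by (simp add: frontier_cball)
    thus "cmod (g z) \<le> B / (6 * r) ^ ?n" by (rule gb)
  qed simp
  moreover have "(\<Prod>a\<in>Z. cmod (w - a)) \<le> (\<Prod>a\<in>Z. 2 * r)"
  proof (rule prod_mono)
    fix a assume "a \<in> Z"
    hence "cmod a \<le> r" by (rule r(2))
    thus "0 \<le> cmod (w - a) \<and> cmod (w - a) \<le> 2 * r"
      using norm_triangle_ineq4[of w a] w by (auto intro: order_trans)
  qed
  ultimately have "cmod (g w) * (\<Prod>a\<in>Z. cmod (w - a)) \<le> B / (6 * r) ^ ?n * (2 * r) ^ ?n"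
    by (intro mult_mono prod_nonneg) (auto intro: order_trans[OF norm_ge_zero])
  also have "\<dots> = B * (1 / 3) ^ ?n"
  proof -
    have "B / (6 * r) ^ ?n * (2 * r) ^ ?n = B * ((2 * r) / (6 * r)) ^ ?n" by (simp only: power_divide times_divide_eq_left times_divide_eq_right)
    also have "(2 * r) / (6 * r) = 1 / 3" using r(1) by simp
    finally show ?thesis .
  qed
  finally show ?thesis by (simp add: g(2) norm_mult prod_norm)
qed

text \<open>With C = |I| H, vectors with entries in 0, ..., C - 1 are mapped to vectors with entries
  below C^2, so |I| > 2 |K| forces a collision. The difference of two colliding vectors is the
  solution.\<close>

lemma siegel_pigeonhole:
  fixes \<alpha> :: "'i \<Rightarrow> 'k \<Rightarrow> nat"
  assumes fin: "finite I" "finite K" and card: "card I > 2 * card K" "card I \<ge> 2" and H: "H \<ge> 1"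
    and le: "\<And>i k. i \<in> I \<Longrightarrow> k \<in> K \<Longrightarrow> \<alpha> i k \<le> H"
  shows "\<exists>c :: 'i \<Rightarrow> int. (\<exists>i\<in>I. c i \<noteq> 0) \<and> (\<forall>i\<in>I. \<bar>c i\<bar> \<le> int (card I * H)) \<and>
           (\<forall>k\<in>K. (\<Sum>i\<in>I. c i * int (\<alpha> i k)) = 0)"
proof -
  define C where "C = card I * H"
  have C: "C \<ge> 2" using mult_le_mono[OF card(2) H] by (simp add: C_def)
  define A where "A = PiE I (\<lambda>_. {..<C})"
  define f where "f = (\<lambda>c. \<lambda>k\<in>K. \<Sum>i\<in>I. c i * \<alpha> i k)"
  have "f ` A \<subseteq> PiE K (\<lambda>_. {..<C ^ 2})"
  proof
    fix y assume "y \<in> f ` A"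
    then obtain c where c: "c \<in> A" "y = f c" by blast
    have "(\<Sum>i\<in>I. c i * \<alpha> i k) < C ^ 2" if k: "k \<in> K" for k
    proof -
      have "(\<Sum>i\<in>I. c i * \<alpha> i k) \<le> (\<Sum>i\<in>I. (C - 1) * H)"
      proof (intro sum_mono mult_mono)
        fix i assume i: "i \<in> I"
        have "c i < C" using c i by (auto simp: A_def PiE_def Pi_def)
        thus "c i \<le> C - 1" by simp
        show "\<alpha> i k \<le> H" using le i k by simp
      qed auto
      also have "\<dots> = (C - 1) * C" by (simp add: C_def)
      also have "\<dots> < C ^ 2" using C by (simp add: power2_eq_square)
      finally show ?thesis .
    qed
    thus "y \<in> PiE K (\<lambda>_. {..<C ^ 2})" using c by (auto simp: f_def)
  qed
  moreover have "finite (PiE K (\<lambda>_. {..<C ^ 2}))" using fin by (intro finite_PiE) auto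
  ultimately have "card (f ` A) \<le> card (PiE K (\<lambda>_. {..<C ^ 2}))" by (rule card_mono[rotated])
  also have "\<dots> = C ^ (2 * card K)" using fin by (simp add: card_PiE power_mult)
  also have "\<dots> < C ^ card I" using C card by (intro power_strict_increasing) auto
  also have "\<dots> = card A" using fin by (simp add: A_def card_PiE)
  finally have "\<not> inj_on f A" using pigeonhole by blast
  then obtain c c' where c: "c \<in> A" "c' \<in> A" "f c = f c'" "c \<noteq> c'" unfolding inj_on_def by blast
  define e where "e = (\<lambda>i. int (c i) - int (c' i))"
  have "\<exists>i\<in>I. c i \<noteq> c' i"
  proof (rule ccontr)
    assume "\<not> (\<exists>i\<in>I. c i \<noteq> c' i)"
    hence "c = c'" using c(1,2) unfolding A_def by (intro PiE_ext) auto
    thus False using c(4) by simp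
  qed
  hence "\<exists>i\<in>I. e i \<noteq> 0" by (simp add: e_def)
  moreover have "\<bar>e i\<bar> \<le> int (card I * H)" if "i \<in> I" for i
  proof -
    have "c i < C" "c' i < C" using c that by (auto simp: A_def PiE_def Pi_def)
    thus ?thesis unfolding e_def C_def by linarith
  qed
  moreover have "(\<Sum>i\<in>I. e i * int (\<alpha> i k)) = 0" if "k \<in> K" for k
  proof -
    have "f c k = f c' k" using c(3) by simp
    hence "(\<Sum>i\<in>I. c i * \<alpha> i k) = (\<Sum>i\<in>I. c' i * \<alpha> i k)" using that by (simp add: f_def)
    hence "int (\<Sum>i\<in>I. c i * \<alpha> i k) = int (\<Sum>i\<in>I. c' i * \<alpha> i k)" by (rule arg_cong)
    thus ?thesis by (simp add: e_def left_diff_distrib sum_subtractf)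
  qed
  ultimately show ?thesis by (intro exI[of _ e]) blast
qed

lemma positive_rationals_common_denominator:
  fixes q :: "'a \<Rightarrow> real"
  assumes "finite S" "\<And>i. i \<in> S \<Longrightarrow> q i \<in> \<rat> \<and> q i > 0"
  shows "\<exists>D A. D > (0::nat) \<and> (\<forall>i\<in>S. (A i :: nat) > 0 \<and> q i = real (A i) / real D)"
  using assms
proof (induction S rule: finite_induct)
  case (insert j S)
  then obtain D A where D: "D > (0::nat)" "\<forall>i\<in>S. (A i :: nat) > 0 \<and> q i = real (A i) / real D" by auto
  have "q j \<in> \<rat>" "q j > 0" using insert.prems by auto
  then obtain m n :: nat where mn: "n \<noteq> 0" "\<bar>q j\<bar> = real m / real n" by (elim Rats_abs_nat_div_natE)
  hence mn: "n > 0" "q j = real m / real n" "m > 0" using \<open>q j > 0\<close> by (auto intro!: Nat.gr0I)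
  define A' where "A' = (\<lambda>i. if i = j then m * D else A i * n)"
  have "A' i > 0 \<and> q i = real (A' i) / real (D * n)" if "i \<in> insert j S" for i
    using that D mn by (auto simp: A'_def)
  thus ?case using D mn by (intro exI[of _ "D * n"] exI[of _ A']) auto
qed (intro exI[of _ 1], simp)

text \<open>
  Siegel's method: an exponential polynomial with exponents \<open>a + b \<gamma>\<close>, \<open>a, b < L = 5 m\<^sup>3\<close>, and small integer
  coefficients is made to vanish at the points \<open>k\<^sub>0 x\<^sub>0 + k\<^sub>1 x\<^sub>1 + k\<^sub>2 x\<^sub>2\<close>, \<open>k\<^sub>i < N = 2 m\<^sup>2\<close>. At the first such point where it does
  not vanish, its value is rational with bounded denominator, yet tiny by the Schwarz lemma.
\<close>
lemma six_exponentials_rational: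
  fixes \<gamma> :: real and x :: "nat \<Rightarrow> real"
  assumes irr: "\<gamma> \<notin> \<rat>"
    and indep: "\<And>k :: nat \<Rightarrow> int. (\<Sum>i<3. of_int (k i) * x i) = 0 \<Longrightarrow> \<forall>i<3. k i = 0"
    and rat: "\<And>i. i < 3 \<Longrightarrow> exp (x i) \<in> \<rat>" "\<And>i. i < 3 \<Longrightarrow> exp (\<gamma> * x i) \<in> \<rat>"
  shows False
proof -
  define q where "q = (\<lambda>i. exp ((if snd i = (0::nat) then 1 else \<gamma>) * x (fst i)))"
  have "q i \<in> \<rat> \<and> q i > 0" if "i \<in> {..<3}\<times>{0,1}" for i
    using that rat unfolding q_def by auto
  moreover have "finite ({..<3::nat}\<times>{0,1::nat})" by simp
  ultimately have "\<exists>D A. D > (0::nat) \<and> (\<forall>i\<in>{..<3}\<times>{0,1}. (A i :: nat) > 0 \<and> q i = real (A i) / real D)"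
    by (intro positive_rationals_common_denominator)
  then obtain D A where D: "D > 0" "\<forall>i\<in>{..<3}\<times>{0,1::nat}. (A i :: nat) > 0 \<and> q i = real (A i) / real D"
    by (elim exE conjE)
  define A0 where "A0 = (\<lambda>i. A (i, 0))"
  define A1 where "A1 = (\<lambda>i. A (i, 1))"
  have A0: "A0 i > 0" "exp (x i) = real (A0 i) / real D" and A1: "A1 i > 0" "exp (\<gamma> * x i) = real (A1 i) / real D"
    if "i < 3" for i
    using bspec[OF D(2), of "(i,0)"] bspec[OF D(2), of "(i,1)"] that by (auto simp: A0_def A1_def q_def)
  \<comment> \<open>One number above the common denominator and all six numerators, so that every
    arithmetic estimate becomes a power of \<open>Q\<close>.\<close>
  define Q where "Q = D + (\<Sum>i<3. A0 i) + (\<Sum>i<3. A1 i) + 2"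
  have Q: "D \<le> Q" "Q \<ge> 2" "\<And>i. i < 3 \<Longrightarrow> A0 i \<le> Q" "\<And>i. i < 3 \<Longrightarrow> A1 i \<le> Q"
  proof -
    show "A0 i \<le> Q" if "i < 3" for i using member_le_sum[of i "{..<3}" A0] that by (simp add: Q_def)
    show "A1 i \<le> Q" if "i < 3" for i using member_le_sum[of i "{..<3}" A1] that by (simp add: Q_def)
  qed (auto simp: Q_def)
  define X where "X = (\<Sum>i<3. \<bar>x i\<bar>)"
  have x0: "x 0 \<noteq> 0"
  proof
    assume "x 0 = 0"
    hence "(\<Sum>i<3. of_int ((if i = 0 then 1 else 0 :: int)) * x i) = 0" by (intro sum.neutral) auto
    from indep[OF this, THEN spec, of 0] show False by simp
  qed
  hence X: "X > 0" unfolding X_def by (intro sum_pos2[of _ 0]) auto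
  \<comment> \<open>Collects the exponents of the final inequality in units of L N1: 6 ln Q each
    from the coefficients and from the denominator, 4 from L^4, and the rest from the growth of the
    exponentials on the circle of radius 7 r.\<close>
  define C where "C = 12 * ln (real Q) + 4 + 7 * (1 + \<bar>\<gamma>\<bar>) * X"
  define m where "m = nat \<lceil>2 * C\<rceil> + 1"
  have m: "real m > 2 * C" "m \<ge> 1" unfolding m_def by linarith+
  \<comment> \<open>Two requirements: 2 N^3 = 16 m^6 < 25 m^6 = L^2, so there are more than twice as
    many coefficients as conditions; and N^2 = 4 m^4 exceeds C L = 5 C m^3 once m > 2 C.\<close>
  define N where "N = 2 * m ^ 2"
  define L where "L = 5 * m ^ 3"
  define I where "I = {..<L} \<times> {..<L}"
  define box where "box = (\<lambda>n. PiE {..<3::nat} (\<lambda>_. {..<n::nat}))"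
  define z where "z = (\<lambda>k. \<Sum>i<3. real (k i) * x i)"
  define ex where "ex = (\<lambda>p. real (fst p) + real (snd p) * \<gamma>)"
  \<comment> \<open>The number exp (ex p * z k) cleared of denominators by the factor D^(6 L n), one
    D^(L n) for each of the six exponentials.\<close>
  define \<alpha> where "\<alpha> = (\<lambda>n p k. \<Prod>i<3. (A0 i ^ (fst p * k i) * D ^ (L * n - fst p * k i)) *
                                   (A1 i ^ (snd p * k i) * D ^ (L * n - snd p * k i)))"
  have finI: "finite I" "card I = L ^ 2" by (auto simp: I_def power2_eq_square)
  have box: "finite (box n)" "card (box n) = n ^ 3" for n
    by (auto simp: box_def card_PiE intro!: finite_PiE)
  have pw: "a ^ e * D ^ (M - e) \<le> Q ^ M" if "a \<le> Q" "e \<le> M" for a e M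
  proof -
    have "a ^ e * D ^ (M - e) \<le> Q ^ e * Q ^ (M - e)" using that Q by (intro mult_mono power_mono) auto
    thus ?thesis using that by (simp flip: power_add)
  qed
  have kle: "fst p * k i \<le> L * n" "snd p * k i \<le> L * n" if "p \<in> I" "\<And>i. i < 3 \<Longrightarrow> k i \<le> n" "i < 3" for p k n i
    using that(1) that(2)[OF that(3)] by (auto simp: I_def intro!: mult_mono)
  have \<alpha>_le: "\<alpha> n p k \<le> Q ^ (6 * L * n)" if p: "p \<in> I" and k: "\<And>i. i < 3 \<Longrightarrow> k i \<le> n" for n p k
  proof -
    have "\<alpha> n p k \<le> (\<Prod>i<3::nat. Q ^ (L * n) * Q ^ (L * n))"
      unfolding \<alpha>_def
    proof (intro prod_mono conjI)
      fix i :: nat assume "i \<in> {..<3}"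
      hence i: "i < 3" by simp
      show "A0 i ^ (fst p * k i) * D ^ (L * n - fst p * k i) * (A1 i ^ (snd p * k i) * D ^ (L * n - snd p * k i))
          \<le> Q ^ (L * n) * Q ^ (L * n)"
        by (rule mult_le_mono[OF pw[OF Q(3)[OF i] kle(1)[OF p k i]] pw[OF Q(4)[OF i] kle(2)[OF p k i]]])
    qed simp
    also have "\<dots> = Q ^ (6 * L * n)" by (simp flip: power_add power_mult) (simp add: algebra_simps)
    finally show ?thesis .
  qed
  have \<alpha>_eq: "real (\<alpha> n p k) = real D ^ (6 * L * n) * exp (ex p * z k)"
    if p: "p \<in> I" and k: "\<And>i. i < 3 \<Longrightarrow> k i \<le> n" for n p k
  proof -
    have *: "real a ^ e * real D ^ (M - e) = real D ^ M * y ^ e" if "y = real a / real D" "e \<le> M" for a e M y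
    proof -
      have "real D ^ M = real D ^ e * real D ^ (M - e)" using that by (simp flip: power_add)
      thus ?thesis using that D by (simp add: power_divide)
    qed
    have "real (\<alpha> n p k) = (\<Prod>i<3. (real D ^ (L * n) * exp (x i) ^ (fst p * k i)) * (real D ^ (L * n) * exp (\<gamma> * x i) ^ (snd p * k i)))"
      unfolding \<alpha>_def of_nat_prod of_nat_mult of_nat_power
    proof (rule prod.cong[OF refl])
      fix i :: nat assume "i \<in> {..<3}"
      hence i: "i < 3" by simp
      show "real (A0 i) ^ (fst p * k i) * real D ^ (L * n - fst p * k i) * (real (A1 i) ^ (snd p * k i) * real D ^ (L * n - snd p * k i))
        = (real D ^ (L * n) * exp (x i) ^ (fst p * k i)) * (real D ^ (L * n) * exp (\<gamma> * x i) ^ (snd p * k i))"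
        by (rule arg_cong2[where f = "(*)", OF *[OF A0(2)[OF i] kle(1)[OF p k i]] *[OF A1(2)[OF i] kle(2)[OF p k i]]])
    qed
    also have "\<dots> = (\<Prod>i<3::nat. (real D ^ (2 * L * n)) * exp (ex p * (real (k i) * x i)))"
    proof (intro prod.cong refl)
      fix i
      have e: "exp (x i) ^ (fst p * k i) * exp (\<gamma> * x i) ^ (snd p * k i) = exp (ex p * (real (k i) * x i))"
        by (simp add: ex_def flip: exp_of_nat_mult exp_add) (simp add: algebra_simps)
      have d: "real D ^ (L * n) * real D ^ (L * n) = real D ^ (2 * L * n)"
        by (simp only: mult_2 distrib_right power_add)
      show "(real D ^ (L * n) * exp (x i) ^ (fst p * k i)) * (real D ^ (L * n) * exp (\<gamma> * x i) ^ (snd p * k i))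
        = real D ^ (2 * L * n) * exp (ex p * (real (k i) * x i))"
        unfolding e[symmetric] d[symmetric] by (simp add: mult_ac)
    qed
    also have "\<dots> = real D ^ (6 * L * n) * exp (ex p * z k)"
      by (simp add: prod.distrib z_def sum_distrib_left exp_sum flip: power_mult) (simp add: algebra_simps)
    finally show ?thesis .
  qed
  have boxle: "k i \<le> n" if "k \<in> box n" "i < 3" for k n i using that by (auto simp: box_def PiE_def Pi_def less_imp_le)
  have cardlt: "card I > 2 * card (box N)" "card I \<ge> 2"
  proof -
    have "m ^ 6 > 0" using m by simp
    thus "card I > 2 * card (box N)" by (simp add: finI box L_def N_def power_mult_distrib flip: power_mult)
    have "m ^ 6 \<ge> 1" using m by simp
    thus "card I \<ge> 2" by (simp add: finI L_def power_mult_distrib flip: power_mult)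
  qed
  have "\<exists>c. (\<exists>i\<in>I. c i \<noteq> 0) \<and> (\<forall>i\<in>I. \<bar>c i\<bar> \<le> int (card I * Q ^ (6 * L * N))) \<and>
     (\<forall>k\<in>box N. (\<Sum>i\<in>I. c i * int (\<alpha> N i k)) = 0)"
  proof (rule siegel_pigeonhole[OF finI(1) box(1)[of N] cardlt])
    show "Q ^ (6 * L * N) \<ge> 1" using Q by simp
    show "\<alpha> N p k \<le> Q ^ (6 * L * N)" if "p \<in> I" "k \<in> box N" for p k
      by (rule \<alpha>_le[OF that(1) boxle[OF that(2)]])
  qed
  then obtain c :: "nat \<times> nat \<Rightarrow> int" where c: "\<exists>i\<in>I. c i \<noteq> 0" "\<forall>i\<in>I. \<bar>c i\<bar> \<le> int (card I * Q ^ (6 * L * N))"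
     "\<forall>k\<in>box N. (\<Sum>i\<in>I. c i * int (\<alpha> N i k)) = 0"
    by (elim exE conjE)
  define F where "F = (\<lambda>w::complex. \<Sum>p\<in>I. of_int (c p) * exp (of_real (ex p) * w))"
  have F_real: "F (of_real u) = of_real (\<Sum>p\<in>I. of_int (c p) * exp (ex p * u))" for u
    unfolding F_def of_real_sum of_real_mult of_real_of_int_eq exp_of_real[symmetric] by simp
  have F_int: "of_real (real D ^ (6 * L * n)) * F (of_real (z k)) = of_int (\<Sum>p\<in>I. c p * int (\<alpha> n p k))"
    if "\<And>i. i < 3 \<Longrightarrow> k i \<le> n" for n k
  proof -
    have "of_int (\<Sum>p\<in>I. c p * int (\<alpha> n p k)) = (\<Sum>p\<in>I. of_int (c p) * real (\<alpha> n p k))" by simp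
    also have "\<dots> = (\<Sum>p\<in>I. of_int (c p) * (real D ^ (6 * L * n) * exp (ex p * z k)))"
      by (intro sum.cong refl arg_cong2[where f = "(*)"] \<alpha>_eq that) auto
    also have "\<dots> = real D ^ (6 * L * n) * (\<Sum>p\<in>I. of_int (c p) * exp (ex p * z k))"
      by (simp add: sum_distrib_left mult_ac)
    finally have "of_real (of_int (\<Sum>p\<in>I. c p * int (\<alpha> n p k))) = 
       (of_real (real D ^ (6 * L * n) * (\<Sum>p\<in>I. of_int (c p) * exp (ex p * z k))) :: complex)" by (rule arg_cong)
    thus ?thesis unfolding F_real by (simp only: of_real_mult of_real_of_int_eq)
  qed
  define V where "V = (\<lambda>n. \<forall>k\<in>box n. F (of_real (z k)) = 0)"
  have VN: "V N" unfolding V_def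
  proof
    fix k assume k: "k \<in> box N"
    show "F (of_real (z k)) = 0" using F_int[of k N] boxle[OF k] c(3) k D by simp
  qed
  have ex_inj: "inj ex"
  proof (rule injI)
    fix p q assume *: "ex p = ex q"
    have "snd p = snd q"
    proof (rule ccontr)
      assume ne: "snd p \<noteq> snd q"
      hence "\<gamma> = (real (fst q) - real (fst p)) / (real (snd p) - real (snd q))"
        using * by (simp add: ex_def field_simps)
      also have "\<dots> \<in> \<rat>" by simp
      finally show False using irr by simp
    qed
    with * show "p = q" by (auto simp: ex_def prod_eq_iff)
  qed
  \<comment> \<open>Otherwise \<open>F\<close> would vanish at all multiples of \<open>x 0\<close>,
    where it is an exponential sum whose bases are distinct because \<gamma> is irrational; all
    coefficients would be 0.\<close>
  have "\<exists>n. \<not> V n"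
  proof (rule ccontr)
    assume "\<nexists>n. \<not> V n"
    hence V: "V n" for n by (rule contrapos_np) (rule exI)
    from c(1) obtain p where p: "p \<in> I" "c p \<noteq> 0" ..
    have p0: "real_of_int (c p) \<noteq> 0" using p(2) by simp
    moreover have "real_of_int (c p) = 0"
    proof (rule exponential_sums_independent[where c = "\<lambda>p. real_of_int (c p)" and B = "\<lambda>p. exp (ex p * x 0)", OF finI(1) _ _ p(1)])
      show "inj_on (\<lambda>p. exp (ex p * x 0)) I"
      proof (rule inj_onI)
        fix p q assume "exp (ex p * x 0) = exp (ex q * x 0)"
        hence "ex p = ex q" using x0 by simp
        thus "p = q" by (rule injD[OF ex_inj])
      qed
      fix k :: nat
      define kk where "kk = (\<lambda>i\<in>{..<3::nat}. if i = 0 then k else 0)"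
      have "kk \<in> box (Suc k)" by (auto simp: kk_def box_def)
      hence "F (of_real (z kk)) = 0" using V[of "Suc k"] by (simp add: V_def)
      moreover have "z kk = (\<Sum>i\<in>{0}. real (kk i) * x i)"
        unfolding z_def by (rule sum.mono_neutral_right) (auto simp: kk_def)
      hence "z kk = real k * x 0" by (simp add: kk_def)
      ultimately have "(\<Sum>p\<in>I. of_int (c p) * exp (ex p * (real k * x 0))) = 0"
        unfolding F_real by (simp only: of_real_eq_0_iff)
      thus "(\<Sum>p\<in>I. real_of_int (c p) * exp (ex p * x 0) ^ k) = 0"
        by (simp add: mult_ac flip: exp_of_nat_mult)
    qed
    ultimately show False by contradiction
  qed
  \<comment> \<open>Minimality provides both halves of the contradiction: zeros on the whole box of
    side N1 \<ge> N, and a point of the next box at which \<open>F\<close> does not vanish.\<close>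
  define N2 where "N2 = (LEAST n. \<not> V n)"
  have N2: "\<not> V N2" unfolding N2_def using \<open>\<exists>n. \<not> V n\<close> by (rule LeastI_ex)
  have "N2 > N"
  proof (rule ccontr)
    assume "\<not> N2 > N"
    hence "box N2 \<subseteq> box N" unfolding box_def by (intro PiE_mono) auto
    thus False using N2 VN unfolding V_def by blast
  qed
  then obtain N1 where N1: "N2 = Suc N1" "N1 \<ge> N" by (cases N2) auto
  have "V N1" using not_less_Least[of N1 "\<lambda>n. \<not> V n"] N1 unfolding N2_def by auto
  obtain k where k: "k \<in> box (Suc N1)" "F (of_real (z k)) \<noteq> 0" using N2 N1 unfolding V_def by blast
  have kN1: "k i \<le> N1" if "i < 3" for i using k that by (auto simp: box_def PiE_def Pi_def less_Suc_eq_le)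
  have m2: "m^2 \<ge> 1" "m^3 \<ge> 1" using m by simp_all
  have N1pos: "N1 \<ge> 1" "L \<ge> 1" using N1(2) m2 unfolding N_def L_def by linarith+
  define r where "r = real N1 * X"
  have r: "r > 0" using N1pos X by (simp add: r_def)
  have zle: "\<bar>z k\<bar> \<le> r" if "\<And>i. i < 3 \<Longrightarrow> k i \<le> N1" for k
  proof -
    have "\<bar>z k\<bar> \<le> (\<Sum>i<3. \<bar>real (k i) * x i\<bar>)" unfolding z_def by (rule sum_abs)
    also have "\<dots> \<le> (\<Sum>i<3. real N1 * \<bar>x i\<bar>)" using that by (intro sum_mono) (auto simp: abs_mult intro!: mult_right_mono)
    finally show ?thesis by (simp add: r_def X_def sum_distrib_left)
  qed
  \<comment> \<open>Independence of the \<open>x i\<close> makes the points distinct, so that there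
    really are N1^3 zeros to divide out.\<close>
  have z_inj: "inj_on z (box N1)"
  proof (rule inj_onI)
    fix k l assume kl: "k \<in> box N1" "l \<in> box N1" "z k = z l"
    have "(\<Sum>i<3. of_int (int (k i) - int (l i)) * x i) = 0"
      using kl(3) by (simp add: z_def left_diff_distrib sum_subtractf)
    from indep[OF this] have "\<forall>i<3. k i = l i" by auto
    thus "k = l" using kl unfolding box_def by (intro PiE_ext) auto
  qed
  define Z where "Z = (\<lambda>k. complex_of_real (z k)) ` box N1"
  have Z: "finite Z" "card Z = N1 ^ 3"
  proof -
    have "inj_on (\<lambda>k. complex_of_real (z k)) (box N1)" using z_inj by (auto simp: inj_on_def)
    thus "card Z = N1 ^ 3" unfolding Z_def by (simp add: card_image box)
    show "finite Z" unfolding Z_def using box by simp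
  qed
  define B where "B = (real L ^ 2) * ((real L ^ 2) * real Q ^ (6 * L * N1)) * exp (real L * (1 + \<bar>\<gamma>\<bar>) * (7 * r))"
  have "cmod (F (of_real (z k))) \<le> B * (1 / 3) ^ card Z"
  proof (rule schwarz_many_zeros[where f = F and w = "of_real (z k)" and r = r and B = B, OF Z(1)])
    show "F holomorphic_on UNIV" unfolding F_def by (intro holomorphic_intros)
    show "F w = 0" if "w \<in> Z" for w using that \<open>V N1\<close> by (auto simp: Z_def V_def)
    show "r > 0" by fact
    show "cmod w \<le> r" if "w \<in> Z" for w using that zle boxle by (auto simp: Z_def)
    show "cmod (of_real (z k)) \<le> r" using zle[OF kN1] by simp
    fix w :: complex assume w: "cmod w = 7 * r"
    have "cmod (F w) \<le> (\<Sum>p\<in>I. real L ^ 2 * real Q ^ (6 * L * N1) * exp (real L * (1 + \<bar>\<gamma>\<bar>) * (7 * r)))"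
      unfolding F_def
    proof (rule sum_norm_le)
      fix p assume p: "p \<in> I"
      have "\<bar>c p\<bar> \<le> int (card I * Q ^ (6 * L * N))" using c(2) p by blast
      hence "real_of_int \<bar>c p\<bar> \<le> real_of_int (int (card I * Q ^ (6 * L * N)))" by (rule of_int_le_iff[THEN iffD2])
      hence "\<bar>real_of_int (c p)\<bar> \<le> real L ^ 2 * real Q ^ (6 * L * N)" by (simp add: finI)
      also have "\<dots> \<le> real L ^ 2 * real Q ^ (6 * L * N1)"
        using N1 Q by (intro mult_left_mono power_increasing) auto
      finally have 1: "cmod (of_int (c p)) \<le> real L ^ 2 * real Q ^ (6 * L * N1)" by simp
      have "\<bar>ex p\<bar> \<le> real (fst p) + real (snd p) * \<bar>\<gamma>\<bar>"
        unfolding ex_def by (rule order_trans[OF abs_triangle_ineq]) (simp add: abs_mult)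
      also have "\<dots> \<le> real L + real L * \<bar>\<gamma>\<bar>" using p by (intro add_mono mult_right_mono) (auto simp: I_def)
      finally have "\<bar>ex p\<bar> \<le> real L * (1 + \<bar>\<gamma>\<bar>)" by (simp add: algebra_simps)
      hence "\<bar>ex p\<bar> * cmod w \<le> real L * (1 + \<bar>\<gamma>\<bar>) * (7 * r)" using w r by (intro mult_mono) auto
      hence "cmod (of_real (ex p) * w) \<le> real L * (1 + \<bar>\<gamma>\<bar>) * (7 * r)" by (simp add: norm_mult)
      hence "cmod (exp (of_real (ex p) * w)) \<le> exp (real L * (1 + \<bar>\<gamma>\<bar>) * (7 * r))"
        using complex_Re_le_cmod[of "of_real (ex p) * w"] by (simp only: norm_exp_eq_Re exp_le_cancel_iff)
      with 1 show "cmod (of_int (c p) * exp (of_real (ex p) * w)) \<le> real L ^ 2 * real Q ^ (6 * L * N1) * exp (real L * (1 + \<bar>\<gamma>\<bar>) * (7 * r))"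
        unfolding norm_mult by (intro mult_mono) auto
    qed
    thus "cmod (F w) \<le> B" by (simp add: B_def finI mult.assoc del: mult_cancel_left)
  qed
  \<comment> \<open>Liouville's argument: multiplied by D^(6 L N1), the value is a nonzero
    integer.\<close>
  moreover have "1 \<le> real Q ^ (6 * L * N1) * cmod (F (of_real (z k)))"
  proof -
    have *: "of_real (real D ^ (6 * L * N1)) * F (of_real (z k)) = of_int (\<Sum>p\<in>I. c p * int (\<alpha> N1 p k))"
      by (rule F_int[OF kN1])
    have "of_real (real D ^ (6 * L * N1)) * F (of_real (z k)) \<noteq> 0" using k(2) D(1) by simp
    hence "(\<Sum>p\<in>I. c p * int (\<alpha> N1 p k)) \<noteq> 0" unfolding * by (simp only: of_int_eq_0_iff simp_thms)
    hence "1 \<le> \<bar>\<Sum>p\<in>I. c p * int (\<alpha> N1 p k)\<bar>" by linarith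
    hence "1 \<le> real_of_int \<bar>\<Sum>p\<in>I. c p * int (\<alpha> N1 p k)\<bar>" by linarith
    also have "\<dots> = cmod (of_int (\<Sum>p\<in>I. c p * int (\<alpha> N1 p k)))" by (simp only: norm_of_int of_int_abs)
    also have "\<dots> = real D ^ (6 * L * N1) * cmod (F (of_real (z k)))"
      unfolding *[symmetric] norm_mult by (simp add: norm_power)
    also have "\<dots> \<le> real Q ^ (6 * L * N1) * cmod (F (of_real (z k)))"
      using Q by (intro mult_right_mono power_mono) auto
    finally show ?thesis .
  qed
  moreover have "3 ^ n \<le> a * b" if "f \<le> b * (1 / 3) ^ n" "1 \<le> a * f" "a \<ge> 0" for a b f :: real and n
  proof -
    have "1 \<le> a * (b * (1 / 3) ^ n)" using that by (meson mult_left_mono order_trans)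
    thus ?thesis by (simp add: power_divide field_simps)
  qed
  ultimately have "3 ^ (N1 ^ 3) \<le> real Q ^ (6 * L * N1) * B"
    unfolding Z(2) using zero_le_power[OF of_nat_0_le_iff] by blast
  also have "\<dots> = exp (12 * real L * real N1 * ln (real Q)) * real L ^ 4 * exp (real L * (1 + \<bar>\<gamma>\<bar>) * (7 * r))"
  proof -
    have "real Q ^ (6 * L * N1) = exp (real (6 * L * N1) * ln (real Q))"
      using Q by (subst exp_of_nat_mult) simp
    thus ?thesis by (simp add: B_def power2_eq_square power4_eq_xxxx algebra_simps flip: exp_add)
  qed
  also have "\<dots> \<le> exp (12 * real L * real N1 * ln (real Q)) * exp (4 * real L * real N1) * exp (real L * (1 + \<bar>\<gamma>\<bar>) * (7 * r))"
  proof (intro mult_right_mono mult_left_mono)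
    have "real L \<le> exp (real L)" using exp_ge_add_one_self[of "real L"] by linarith
    hence "real L ^ 4 \<le> exp (real L) ^ 4" by (intro power_mono) auto
    also have "\<dots> = exp (4 * real L)" by (simp flip: exp_of_nat_mult)
    also have "\<dots> \<le> exp (4 * real L * real N1)" using N1pos by (simp add: mult_le_cancel_left1)
    finally show "real L ^ 4 \<le> exp (4 * real L * real N1)" .
  qed auto
  also have "\<dots> = exp (C * real L * real N1)"
    by (simp add: C_def r_def algebra_simps flip: exp_add)
  finally have up: "3 ^ (N1 ^ 3) \<le> exp (C * real L * real N1)" .
  \<comment> \<open>As e \<le> 3, the inequality becomes N1^3 \<le> C L N1, hence N^2 \<le> N1^2
    \<le> C L, against the choice of m.\<close>
  have "exp (real (N1 ^ 3)) = exp 1 ^ (N1 ^ 3)" by (simp flip: exp_of_nat_mult)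
  also have "\<dots> \<le> 3 ^ (N1 ^ 3)" using exp_le by (intro power_mono) auto
  also note up
  finally have "real N1 ^ 3 \<le> C * real L * real N1" by simp
  hence "real N1 * real N1 ^ 2 \<le> real N1 * (C * real L)" by (simp add: power2_eq_square power3_eq_cube mult_ac)
  hence "real N1 ^ 2 \<le> C * real L" using N1pos by (simp add: mult_le_cancel_left)
  moreover have "real N ^ 2 \<le> real N1 ^ 2" using N1 by (intro power_mono) auto
  ultimately have "real N ^ 2 \<le> C * real L" by linarith
  hence "4 * real m ^ 4 \<le> 5 * C * real m ^ 3" by (simp add: N_def L_def power_mult_distrib mult_ac flip: power_mult)
  hence "real m ^ 3 * (4 * real m) \<le> real m ^ 3 * (5 * C)" by (simp add: power4_eq_xxxx power3_eq_cube mult_ac)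
  hence "4 * real m \<le> 5 * C" using m by (simp add: mult_le_cancel_left)
  moreover have "C > 0" unfolding C_def using Q X by (intro add_pos_nonneg add_nonneg_pos) auto
  ultimately show False using m by linarith
qed

section \<open>Logarithms of rationals with disjoint prime factors\<close>

lemma int_log_combination:
  fixes a a' :: "'j \<Rightarrow> nat" and e :: "'j \<Rightarrow> int"
  assumes "finite J" "\<And>j. j \<in> J \<Longrightarrow> a j > 0 \<and> a' j > 0"
  shows "\<exists>P P'. P > 0 \<and> P' > 0 \<and> (\<forall>q. prime q \<longrightarrow> q dvd P * P' \<longrightarrow> (\<exists>j\<in>J. q dvd a j * a' j)) \<and>
     (\<Sum>j\<in>J. of_int (e j) * (ln (real (a j)) - ln (real (a' j)))) = ln (real P) - ln (real P')"
  using assms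
proof (induction J rule: finite_induct)
  case empty
  show ?case by (intro exI[of _ 1]) auto
next
  case (insert i J)
  then obtain P P' where P: "P > 0" "P' > 0" "\<And>q. prime q \<Longrightarrow> q dvd P * P' \<Longrightarrow> \<exists>j\<in>J. q dvd a j * a' j"
     "(\<Sum>j\<in>J. of_int (e j) * (ln (real (a j)) - ln (real (a' j)))) = ln (real P) - ln (real P')" by auto
  \<comment> \<open>A negative coefficient exchanges numerator and denominator, so that only natural
    exponents occur.\<close>
  define b b' where "b = (if e i \<ge> 0 then a i else a' i)" and "b' = (if e i \<ge> 0 then a' i else a i)"
  have b: "b > 0" "b' > 0" "b * b' = a i * a' i" using insert.prems[of i] by (auto simp: b_def b'_def)
  define m where "m = nat \<bar>e i\<bar>"
  have tm: "of_int (e i) * (ln (real (a i)) - ln (real (a' i))) = real m * (ln (real b) - ln (real b'))"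
    by (auto simp: b_def b'_def m_def algebra_simps)
  have dv: "\<exists>j\<in>insert i J. q dvd a j * a' j" if "prime q" "q dvd (P * b ^ m) * (P' * b' ^ m)" for q
  proof -
    have "q dvd (P * P') * (b * b') ^ m" using that(2) by (simp add: power_mult_distrib mult_ac)
    hence "q dvd P * P' \<or> q dvd b * b'" using that(1) by (meson prime_dvd_mult_iff prime_dvd_power)
    thus ?thesis using P(3)[OF that(1)] b(3) by auto
  qed
  have "(\<Sum>j\<in>insert i J. of_int (e j) * (ln (real (a j)) - ln (real (a' j)))) = ln (real (P * b ^ m)) - ln (real (P' * b' ^ m))"
    unfolding sum.insert[OF insert.hyps] tm P(4) using P(1,2) b(1,2) by (simp add: ln_mult ln_realpow algebra_simps)
  thus ?case using dv P b by (intro exI[of _ "P * b ^ m"] exI[of _ "P' * b' ^ m"]) auto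
qed

lemma coprime_if_no_common_prime:
  fixes a b :: nat
  assumes "\<And>q. prime q \<Longrightarrow> q dvd a \<Longrightarrow> q dvd b \<Longrightarrow> False"
  shows "coprime a b"
proof (rule ccontr)
  assume "\<not> coprime a b"
  hence "gcd a b \<noteq> 1" by (simp add: coprime_iff_gcd_eq_1)
  then obtain q where "prime q" "q dvd gcd a b" using prime_factor_nat by blast
  thus False using assms[of q] by simp
qed

text \<open>Exponentiation gives n^|c| R' = n'^|c| R, where R and R' are P and P' in an order given
  by the sign of c. As n is prime to R and n' to R', the two powers divide each other.\<close>

lemma log_ratio_eq_1:
  fixes c :: int and n n' P P' :: nat
  assumes "c \<noteq> 0" "n > 0" "n' > 0" "P > 0" "P' > 0"
    and disj: "\<And>q. prime q \<Longrightarrow> q dvd n * n' \<Longrightarrow> q dvd P * P' \<Longrightarrow> False"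
    and eq: "of_int c * (ln (real n) - ln (real n')) = ln (real P) - ln (real P')"
  shows "n = n'"
proof -
  define m where "m = nat \<bar>c\<bar>"
  define R R' where "R = (if c \<ge> 0 then P else P')" and "R' = (if c \<ge> 0 then P' else P)"
  have m: "m > 0" using assms by (simp add: m_def)
  have R: "R > 0" "R' > 0" "R * R' = P * P'" using assms by (auto simp: R_def R'_def)
  have "real m * (ln (real n) - ln (real n')) = ln (real R) - ln (real R')"
    using eq by (auto simp: m_def R_def R'_def algebra_simps)
  hence "ln (real (n ^ m * R')) = ln (real (n' ^ m * R))"
    using R assms by (simp add: ln_mult ln_realpow algebra_simps)
  hence "real (n ^ m * R') = real (n' ^ m * R)"
    using R assms by (subst (asm) ln_inj_iff) auto
  hence e: "n ^ m * R' = n' ^ m * R" by (simp only: of_nat_eq_iff)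
  have "coprime n R" "coprime n' R'"
    using disj R(3) by (metis coprime_if_no_common_prime dvd_mult dvd_mult2)+
  hence cp: "coprime (n ^ m) R" "coprime (n' ^ m) R'" by simp_all
  have "n ^ m dvd n' ^ m" using cp(1) e by (metis coprime_dvd_mult_left_iff dvd_triv_left)
  moreover have "n' ^ m dvd n ^ m" using cp(2) e by (metis coprime_dvd_mult_left_iff dvd_triv_left)
  ultimately have "n ^ m = n' ^ m" by (rule dvd_antisym)
  thus ?thesis using m by (simp add: power_eq_iff_eq_base)
qed

lemma smooth_log_combination:
  fixes k :: "nat \<Rightarrow> int"
  shows "\<exists>P P'. P > 0 \<and> P' > 0 \<and> (\<forall>q. prime q \<longrightarrow> q dvd P * P' \<longrightarrow> q \<le> N) \<and>
    (\<Sum>p | prime p \<and> p \<le> N. of_int (k p) * ln (real p)) = ln (real P) - ln (real P')"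
proof -
  have "finite {p. prime p \<and> p \<le> N}" by simp
  from int_log_combination[OF this, of "\<lambda>p. p" "\<lambda>_. 1" k]
  obtain P P' where P: "P > 0" "P' > 0" "\<And>q. prime q \<Longrightarrow> q dvd P * P' \<Longrightarrow> \<exists>j\<in>{p. prime p \<and> p \<le> N}. q dvd j * 1"
    "(\<Sum>p | prime p \<and> p \<le> N. of_int (k p) * (ln (real p) - ln (real 1))) = ln (real P) - ln (real P')"
    by (auto simp: prime_gt_0_nat)
  have "q \<le> N" if "prime q" "q dvd P * P'" for q
    using P(3)[OF that] that(1) primes_dvd_imp_eq by auto
  thus ?thesis using P by auto
qed

text \<open>Multiplying by the denominator of \<beta> turns both sides into logarithms of rationals,
  one free of primes up to N and one composed of them.\<close>

lemma log_independence_rational: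
  fixes \<beta> :: real
  assumes "\<beta> \<in> \<rat>" "n > 0" "n' > 0" "\<And>p. prime p \<Longrightarrow> p \<le> N \<Longrightarrow> \<not> p dvd n * n'"
    and "ln (real n) - ln (real n') = \<beta> * (\<Sum>p | prime p \<and> p \<le> N. of_int (k p) * ln (real p))"
  shows "n = n'"
proof -
  obtain a b :: int where ab: "b > 0" "\<beta> = of_int a / of_int b" using assms(1) by (rule Rats_cases') 
  obtain P P' where P: "P > 0" "P' > 0" "\<And>q. prime q \<Longrightarrow> q dvd P * P' \<Longrightarrow> q \<le> N"
    "(\<Sum>p | prime p \<and> p \<le> N. of_int (a * k p) * ln (real p)) = ln (real P) - ln (real P')"
    using smooth_log_combination[of N "\<lambda>p. a * k p"] by auto
  have "of_int b * (ln (real n) - ln (real n')) = (\<Sum>p | prime p \<and> p \<le> N. of_int (a * k p) * ln (real p))"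
    using assms(5) ab by (simp add: sum_distrib_left mult.assoc)
  hence "of_int b * (ln (real n) - ln (real n')) = ln (real P) - ln (real P')" using P by simp
  thus ?thesis using log_ratio_eq_1[of b n n' P P'] ab assms P by blast
qed

text \<open>For irrational \<beta>, failure at arbitrarily large N yields three fractions n / n'
  without common primes such that the logarithm of each, divided by \<beta>, is again the logarithm
  of a rational. Two such fractions would only give the situation of the four exponentials
  conjecture, so three are collected. Arguing by contradiction, no explicit N0 results.\<close>

lemma log_independence:
  fixes \<beta> :: real
  shows "\<exists>N0. \<forall>N\<ge>N0. \<forall>(k :: nat \<Rightarrow> int) n n'. n > 0 \<longrightarrow> n' > 0 \<longrightarrow>
    (\<forall>p. prime p \<longrightarrow> p \<le> N \<longrightarrow> \<not> p dvd n * n') \<longrightarrow>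
    ln (real n) - ln (real n') = \<beta> * (\<Sum>p | prime p \<and> p \<le> N. of_int (k p) * ln (real p)) \<longrightarrow> n = n'"
proof (cases "\<beta> \<in> \<rat>")
  case True
  thus ?thesis using log_independence_rational by blast
next
  case False
  hence \<beta>0: "\<beta> \<noteq> 0" by auto
  define bad where "bad = (\<lambda>N n n' P P'. n > 0 \<and> n' > 0 \<and> P > 0 \<and> P' > 0 \<and> n \<noteq> n' \<and>
     (\<forall>p. prime p \<longrightarrow> p \<le> N \<longrightarrow> \<not> p dvd n * n') \<and> ln (real n) - ln (real n') = \<beta> * (ln (real P) - ln (real P')))"
  show ?thesis
  proof (rule ccontr)
    assume contr: "\<not> ?thesis"
    have ex: "\<exists>n n' P P'. bad N0 n n' P P'" for N0
    proof -
      from contr obtain N and k :: "nat \<Rightarrow> int" and n n' where *: "N \<ge> N0" "n > 0" "n' > 0" "n \<noteq> n'"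
        "\<forall>p. prime p \<longrightarrow> p \<le> N \<longrightarrow> \<not> p dvd n * n'"
        "ln (real n) - ln (real n') = \<beta> * (\<Sum>p | prime p \<and> p \<le> N. of_int (k p) * ln (real p))" by blast
      obtain P P' where P: "P > 0" "P' > 0"
        "(\<Sum>p | prime p \<and> p \<le> N. of_int (k p) * ln (real p)) = ln (real P) - ln (real P')"
        using smooth_log_combination[of N k] by auto
      have "bad N0 n n' P P'" unfolding bad_def using * P by auto
      thus ?thesis by blast
    qed
    obtain n0 n0' P0 P0' where 0: "bad 0 n0 n0' P0 P0'" using ex by blast
    \<comment> \<open>The level n0 n0' is at least as large as every prime dividing n0 n0', so the
      second fraction shares no prime with the first. The level for the third covers both.\<close>
    obtain n1 n1' P1 P1' where 1: "bad (n0 * n0') n1 n1' P1 P1'" using ex by blast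
    obtain n2 n2' P2 P2' where 2: "bad (n0 * n0' * (n1 * n1')) n2 n2' P2 P2'" using ex by blast
    define n where "n = (\<lambda>i::nat. if i = 0 then n0 else if i = 1 then n1 else n2)"
    define n' where "n' = (\<lambda>i::nat. if i = 0 then n0' else if i = 1 then n1' else n2')"
    define P where "P = (\<lambda>i::nat. if i = 0 then P0 else if i = 1 then P1 else P2)"
    define P' where "P' = (\<lambda>i::nat. if i = 0 then P0' else if i = 1 then P1' else P2')"
    define x where "x = (\<lambda>i. ln (real (n i)) - ln (real (n' i)))"
    have pos: "n i > 0" "n' i > 0" "P i > 0" "P' i > 0" "n i \<noteq> n' i"
      and xP: "x i = \<beta> * (ln (real (P i)) - ln (real (P' i)))" for i
      using 0 1 2 by (auto simp: bad_def n_def n'_def P_def P'_def x_def)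
    have disj0: False if h: "prime q" "q dvd n i * n' i" "q dvd n j * n' j" "i < j" "j < 3" for q i j
    proof -
      have pp: "n0 * n0' > 0" "n1 * n1' > 0" using 0 1 by (auto simp: bad_def)
      have "q \<le> n i * n' i" using h(2) pos[of i] by (intro dvd_imp_le) auto
      moreover have le: "n0 * n0' \<le> n0 * n0' * (n1 * n1')" "n1 * n1' \<le> n0 * n0' * (n1 * n1')" using pp by auto
      have b1: "\<not> q dvd n1 * n1'" if "q \<le> n0 * n0'" using that 1 \<open>prime q\<close> by (simp add: bad_def)
      have b2: "\<not> q dvd n2 * n2'" if "q \<le> n0 * n0' * (n1 * n1')" using that 2 \<open>prime q\<close> by (simp add: bad_def)
      consider "i = 0" "j = 1" | "i = 0" "j = 2" | "i = 1" "j = 2" using h(4,5) by linarith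
      thus False
      proof cases
        case 1 thus ?thesis using b1 calculation h(3) by (simp add: n_def n'_def)
      next
        case 2 thus ?thesis using b2 order_trans[OF calculation] le(1) h(3) by (simp add: n_def n'_def)
      next
        case 3 thus ?thesis using b2 order_trans[OF calculation] le(2) h(3) by (simp add: n_def n'_def)
      qed
    qed
    have disj: False if "prime q" "q dvd n i * n' i" "q dvd n j * n' j" "i \<noteq> j" "i < 3" "j < 3" for q i j
      using disj0[of q i j] disj0[of q j i] that by (meson linorder_neqE_nat)
    show False
    proof (rule six_exponentials_rational[where x = x and \<gamma> = "1 / \<beta>"])
      show "1 / \<beta> \<notin> \<rat>"
      proof
        assume "1 / \<beta> \<in> \<rat>"
        from Rats_divide[OF Rats_1 this] have "1 / (1 / \<beta>) \<in> \<rat>" .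
        thus False using False by simp
      qed
      show "exp (x i) \<in> \<rat>" for i using pos[of i] by (simp add: x_def exp_diff)
      show "exp (1 / \<beta> * x i) \<in> \<rat>" for i using pos[of i] \<beta>0 by (simp add: xP exp_diff)
      fix k :: "nat \<Rightarrow> int"
      assume sum0: "(\<Sum>i<3. of_int (k i) * x i) = 0"
      show "\<forall>i<3. k i = 0"
      proof (intro allI impI, rule ccontr)
        fix i :: nat assume i: "i < 3" "k i \<noteq> 0"
        define J where "J = {..<3} - {i}"
        have "(\<Sum>i<3. of_int (k i) * x i) = of_int (k i) * x i + (\<Sum>j\<in>J. of_int (k j) * x j)"
          unfolding J_def using i by (intro sum.remove) auto
        hence s: "of_int (k i) * x i = (\<Sum>j\<in>J. of_int (- k j) * x j)" using sum0 by (simp add: sum_negf)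
        have "finite J" by (simp add: J_def)
        from int_log_combination[OF this, of n n' "\<lambda>j. - k j"] pos
        obtain R R' where R: "R > 0" "R' > 0" "\<And>q. prime q \<Longrightarrow> q dvd R * R' \<Longrightarrow> \<exists>j\<in>J. q dvd n j * n' j"
          "(\<Sum>j\<in>J. of_int (- k j) * (ln (real (n j)) - ln (real (n' j)))) = ln (real R) - ln (real R')" by auto
        \<comment> \<open>A relation with \<open>k i \<noteq> 0\<close> expresses a power of the
          fraction number i by the two others, whose primes are different; this forces the fraction
          to be 1.\<close>
        have "n i = n' i"
        proof (rule log_ratio_eq_1[OF i(2) pos(1) pos(2) R(1,2)])
          fix q assume q: "prime q" "q dvd n i * n' i" "q dvd R * R'"
          then obtain j where "j \<in> J" "q dvd n j * n' j" using R(3) by blast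
          thus False using disj[OF q(1,2), of j] i by (auto simp: J_def)
        next
          show "of_int (k i) * (ln (real (n i)) - ln (real (n' i))) = ln (real R) - ln (real R')"
            using s R(4) by (simp add: x_def)
        qed
        thus False using pos by blast
      qed
    qed
  qed
qed

section \<open>Removing finitely many Euler factors\<close>

definition sieved :: "nat set \<Rightarrow> nat \<Rightarrow> bool" where "sieved S n \<longleftrightarrow> (\<forall>p\<in>S. \<not> p dvd n)"

text \<open>The cutoff is real because striking out a further prime p leads to the cutoff
  \<open>Y / real p\<close>.\<close>

definition sieved_sum :: "nat set \<Rightarrow> real \<Rightarrow> complex \<Rightarrow> complex" where
  "sieved_sum S Y s = (\<Sum>n | n \<ge> 1 \<and> real n < Y \<and> sieved S n. of_nat n powr (-s))"

definition euler_factor :: "nat set \<Rightarrow> complex \<Rightarrow> complex" where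
  "euler_factor S s = (\<Prod>p\<in>S. 1 - of_nat p powr (-s))"

definition sieve_error :: "nat set \<Rightarrow> real \<Rightarrow> complex \<Rightarrow> complex" where
  "sieve_error S Y s = zeta s * euler_factor S s - sieved_sum S Y s"

abbreviation primes_upto :: "nat \<Rightarrow> nat set" where "primes_upto N \<equiv> {p. prime p \<and> p \<le> N}"

lemma finite_nat_below: "finite {n::nat. n \<ge> 1 \<and> real n < Y \<and> P n}"
proof (rule finite_subset)
  show "{n. n \<ge> 1 \<and> real n < Y \<and> P n} \<subseteq> {..nat \<lceil>Y\<rceil>}" by (auto simp: le_nat_iff) linarith
qed simp

lemma nat_powr_exp: "n \<ge> 1 \<Longrightarrow> of_nat n powr (z::complex) = exp (z * of_real (ln (real n)))"
  by (rule exp_ln_nat_powr[symmetric])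

lemma of_nat_mult_powr:
  assumes "m \<ge> 1" "n \<ge> 1"
  shows "of_nat (m * n) powr (z::complex) = of_nat m powr z * of_nat n powr z"
proof -
  have "m * n \<ge> 1" using assms by simp
  thus ?thesis using assms by (simp only: nat_powr_exp) (simp add: ln_mult distrib_left exp_add)
qed

text \<open>One step of Legendre's sieve: the terms lost by adding p are the n = p m, and m is free
  of the old primes exactly if p m is, since p is none of them.\<close>

lemma sieved_sum_insert:
  assumes p: "prime p" "p \<notin> S" and S: "\<And>q. q \<in> S \<Longrightarrow> prime q"
  shows "sieved_sum (insert p S) Y s = sieved_sum S Y s - of_nat p powr (-s) * sieved_sum S (Y / real p) s"
proof -
  let ?A = "\<lambda>S Y. {n. n \<ge> 1 \<and> real n < Y \<and> sieved S n}"
  have p1: "p \<ge> 1" "real p > 0" using prime_gt_0_nat[OF p(1)] by auto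
  have sv: "sieved S (p * m) \<longleftrightarrow> sieved S m" for m
  proof -
    have "q dvd p * m \<longleftrightarrow> q dvd m" if "q \<in> S" for q
      using that S[OF that] p primes_dvd_imp_eq[of q p] by (auto simp: prime_dvd_mult_iff)
    thus ?thesis by (auto simp: sieved_def)
  qed
  have split: "?A S Y = ?A (insert p S) Y \<union> (\<lambda>m. p * m) ` ?A S (Y / real p)" (is "_ = _ \<union> ?B")
  proof (intro equalityI subsetI)
    fix n assume n: "n \<in> ?A S Y"
    show "n \<in> ?A (insert p S) Y \<union> ?B"
    proof (cases "p dvd n")
      case True
      then obtain m where m: "n = p * m" by blast
      have "m \<ge> 1" using n m by (cases m) auto
      moreover have "real m < Y / real p" using n m p1 by (simp add: field_simps)
      moreover have "sieved S m" using n m sv by simp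
      ultimately show ?thesis using m by blast
    next
      case False
      thus ?thesis using n by (auto simp: sieved_def)
    qed
  next
    fix n assume "n \<in> ?A (insert p S) Y \<union> ?B"
    thus "n \<in> ?A S Y"
    proof
      assume "n \<in> ?B"
      then obtain m where m: "n = p * m" "m \<ge> 1" "real m < Y / real p" "sieved S m" by blast
      thus ?thesis using p1 sv by (auto simp: field_simps)
    qed (auto simp: sieved_def)
  qed
  have inj: "inj_on (\<lambda>m. p * m) (?A S (Y / real p))" using p1 by (auto simp: inj_on_def)
  have "sieved_sum S Y s = (\<Sum>n\<in>?A (insert p S) Y. of_nat n powr (-s)) + (\<Sum>n\<in>?B. of_nat n powr (-s))"
    unfolding sieved_sum_def split
  proof (rule sum.union_disjoint)
    show "?A (insert p S) Y \<inter> ?B = {}" by (auto simp: sieved_def)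
  qed (intro finite_imageI finite_nat_below)+
  also have "(\<Sum>n\<in>?B. of_nat n powr (-s)) = (\<Sum>m\<in>?A S (Y / real p). of_nat (p * m) powr (-s))"
    by (subst sum.reindex[OF inj]) (simp only: o_def)
  also have "\<dots> = (\<Sum>m\<in>?A S (Y / real p). of_nat p powr (-s) * of_nat m powr (-s))"
    using p1 by (intro sum.cong refl of_nat_mult_powr) auto
  finally show ?thesis by (simp add: sieved_sum_def sum_distrib_left)
qed

lemma sieve_error_insert:
  assumes "prime p" "p \<notin> S" "\<And>q. q \<in> S \<Longrightarrow> prime q" "finite S"
  shows "sieve_error (insert p S) Y s = sieve_error S Y s - of_nat p powr (-s) * sieve_error S (Y / real p) s"
proof -
  have e1: "sieved_sum (insert p S) Y s = sieved_sum S Y s - of_nat p powr (-s) * sieved_sum S (Y / real p) s"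
    by (rule sieved_sum_insert[OF assms(1-3)])
  have e2: "euler_factor (insert p S) s = (1 - of_nat p powr (-s)) * euler_factor S s"
    using assms by (simp add: euler_factor_def)
  show ?thesis unfolding sieve_error_def e1 e2 by (simp add: algebra_simps)
qed

lemma sieved_sum_empty: "sieved_sum {} Y s = (\<Sum>n=1..<nat \<lceil>Y\<rceil>. of_nat n powr (-s))"
proof -
  have "{n. n \<ge> 1 \<and> real n < Y \<and> sieved {} n} = {1..<nat \<lceil>Y\<rceil>}"
    by (auto simp: sieved_def) linarith+
  thus ?thesis by (simp add: sieved_sum_def)
qed

lemma continuous_on_sieve_error_vertical:
  assumes "e \<noteq> 0" "\<And>p. p \<in> S \<Longrightarrow> prime p"
  shows "continuous_on {1..X} (\<lambda>t. sieve_error S Y (Complex \<sigma> (e * t)))"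
proof -
  have "continuous_on {1..X} (\<lambda>t. of_nat n powr (- Complex \<sigma> (e * t)) :: complex)" if "n \<ge> 1" for n
    using that by (rule continuous_on_nat_powr_vertical)
  thus ?thesis
    unfolding sieve_error_def euler_factor_def sieved_sum_def
    by (intro continuous_intros continuous_on_zeta_vertical)
       (use assms prime_ge_1_nat in auto)
qed

text \<open>Induction over the primes: each one turns the error into two, at Y and at Y / p, with
  |p^(-s)| \<le> 1. The point is the order of quantifiers: \<eta> is arbitrary for a fixed
  \<open>S\<close>, and this freedom later beats the mean of the weight.\<close>

lemma sieve_error_mean_square:
  fixes \<sigma>0 :: real
  assumes "finite S" "\<And>p. p \<in> S \<Longrightarrow> prime p" and \<sigma>0: "1 / 2 < \<sigma>0" "\<sigma>0 < 1" and "\<eta> > 0"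
  shows "\<exists>Y0. \<forall>Y\<ge>Y0. \<exists>T0. \<forall>T\<ge>T0. \<forall>\<sigma> e. \<sigma>0 \<le> \<sigma> \<longrightarrow> \<sigma> \<le> 3 \<longrightarrow> e = 1 \<or> e = -1 \<longrightarrow>
    integral {1..T} (\<lambda>t. (cmod (sieve_error S Y (Complex \<sigma> (e * t))))\<^sup>2) \<le> \<eta> * T"
  using assms(1,2,5)
proof (induction S arbitrary: \<eta> rule: finite_induct)
  case empty
  have "summable (\<lambda>n. real n powr (-(2 * \<sigma>0)))" using \<sigma>0 by (simp add: summable_real_powr_iff)
  \<comment> \<open>Each of the two terms in \<open>zeta_mean_square\<close> is to contribute at
    most \<eta> T / 2, with X \<le> 2 T.\<close>
  from suminf_exist_split[OF _ this, of "\<eta> / (4 * 7460)"] empty(2)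
  obtain N where N: "\<And>n. n \<ge> N \<Longrightarrow> norm (\<Sum>i. real (i + n) powr (-(2 * \<sigma>0))) < \<eta> / (4 * 7460)" by auto
  have tail: "(\<Sum>n=y..<x. real n powr (-(2 * \<sigma>0))) \<le> \<eta> / (4 * 7460)" if "y \<ge> N" for x y
  proof -
    have "(\<Sum>n=y..<x. real n powr (-(2 * \<sigma>0))) = (\<Sum>i<x - y. real (i + y) powr (-(2 * \<sigma>0)))"
      by (rule sum.reindex_bij_witness[of _ "\<lambda>i. i + y" "\<lambda>n. n - y"]) auto
    also have "\<dots> \<le> (\<Sum>i. real (i + y) powr (-(2 * \<sigma>0)))"
      using \<sigma>0 by (intro sum_le_suminf summable_shifted_powr) auto
    also have "\<dots> < \<eta> / (4 * 7460)" using N[OF that] by simp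
    finally show ?thesis by simp
  qed
  show ?case
  proof (rule exI[of _ "real N + 1"], intro allI impI)
    fix Y :: real assume Y: "Y \<ge> real N + 1"
    define y where "y = nat \<lceil>Y\<rceil>"
    have y: "y \<ge> N" "y \<ge> 1" using Y by (auto simp: y_def) linarith+
    have "((\<lambda>T. (2 * T) powr (1 - 2 * \<sigma>0)) \<longlongrightarrow> 0) at_top"
      using \<sigma>0 by (intro tendsto_neg_powr filterlim_tendsto_pos_mult_at_top[of _ 2] filterlim_ident) auto
    hence "\<forall>\<^sub>F T in at_top. (2 * T) powr (1 - 2 * \<sigma>0) < \<eta> / (4 * 7460)"
      using empty(2) by (intro order_tendstoD) auto
    then obtain T1 where T1: "\<And>T. T \<ge> T1 \<Longrightarrow> (2 * T) powr (1 - 2 * \<sigma>0) < \<eta> / (4 * 7460)"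
      unfolding eventually_at_top_linorder by blast
    show "\<exists>T0. \<forall>T\<ge>T0. \<forall>\<sigma> e. \<sigma>0 \<le> \<sigma> \<longrightarrow> \<sigma> \<le> 3 \<longrightarrow> e = 1 \<or> e = -1 \<longrightarrow>
      integral {1..T} (\<lambda>t. (cmod (sieve_error {} Y (Complex \<sigma> (e * t))))\<^sup>2) \<le> \<eta> * T"
    proof (intro exI[of _ "max 1 (max T1 (real y))"] allI impI)
      fix T \<sigma> e :: real assume T: "T \<ge> max 1 (max T1 (real y))" and \<sigma>: "\<sigma>0 \<le> \<sigma>" "\<sigma> \<le> 3" and e: "e = 1 \<or> e = -1"
      define X where "X = nat \<lceil>T\<rceil>"
      have X: "T \<le> real X" "real X \<le> 2 * T" "y \<le> X" using T by (auto simp: X_def) linarith+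
      have c: "(\<lambda>t. (cmod (sieve_error {} Y (Complex \<sigma> (e * t))))\<^sup>2) integrable_on {1..u}" for u
        using e by (intro integrable_continuous_interval continuous_intros continuous_on_sieve_error_vertical) auto
      have "integral {1..T} (\<lambda>t. (cmod (sieve_error {} Y (Complex \<sigma> (e * t))))\<^sup>2)
         \<le> integral {1..real X} (\<lambda>t. (cmod (sieve_error {} Y (Complex \<sigma> (e * t))))\<^sup>2)"
        using X by (intro integral_subset_le c) auto
      also have "\<dots> \<le> 7460 * (real X * (\<Sum>n=y..<X. real n powr (-(2 * \<sigma>0))) + real X powr (2 - 2 * \<sigma>0))"
        using zeta_mean_square[OF \<sigma>0 \<sigma> e y(2) X(3)]
        by (simp add: sieve_error_def euler_factor_def sieved_sum_empty y_def)
      also have "\<dots> \<le> 7460 * (2 * T * (\<eta> / (4 * 7460)) + (2 * T) * (\<eta> / (4 * 7460)))"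
      proof (intro mult_left_mono add_mono mult_mono)
        have "real X powr (2 - 2 * \<sigma>0) \<le> (2 * T) powr (2 - 2 * \<sigma>0)" using X \<sigma>0 by (intro powr_mono2) auto
        also have "\<dots> = (2 * T) * (2 * T) powr (1 - 2 * \<sigma>0)"
          using T powr_add[of "2 * T" 1 "1 - 2 * \<sigma>0"] by simp
        also have "\<dots> \<le> (2 * T) * (\<eta> / (4 * 7460))" using T1[of T] T by (intro mult_left_mono) auto
        finally show "real X powr (2 - 2 * \<sigma>0) \<le> (2 * T) * (\<eta> / (4 * 7460))" .
      qed (use X T y tail in \<open>auto intro: sum_nonneg\<close>)
      also have "\<dots> = \<eta> * T" by simp
      finally show "integral {1..T} (\<lambda>t. (cmod (sieve_error {} Y (Complex \<sigma> (e * t))))\<^sup>2) \<le> \<eta> * T" .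
    qed
  qed
next
  case (insert p S)
  have pr: "prime p" "\<And>q. q \<in> S \<Longrightarrow> prime q" using insert.prems by auto
  have p0: "real p > 0" "p \<ge> 1" using prime_gt_0_nat[OF pr(1)] by auto
  \<comment> \<open>By (a + b)^2 \<le> 2 a^2 + 2 b^2, two errors of size \<eta> / 4 add up to
    \<eta>.\<close>
  have "\<eta> / 4 > 0" using insert.prems by simp
  from insert.IH[OF pr(2) this] obtain Y0 where Y0: "\<And>Y. Y \<ge> Y0 \<Longrightarrow> \<exists>T0. \<forall>T\<ge>T0. \<forall>\<sigma> e. \<sigma>0 \<le> \<sigma> \<longrightarrow> \<sigma> \<le> 3 \<longrightarrow> e = 1 \<or> e = -1 \<longrightarrow>
      integral {1..T} (\<lambda>t. (cmod (sieve_error S Y (Complex \<sigma> (e * t))))\<^sup>2) \<le> \<eta> / 4 * T" by auto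
  show ?case
  proof (rule exI[of _ "max Y0 (Y0 * real p)"], intro allI impI)
    fix Y assume Y: "Y \<ge> max Y0 (Y0 * real p)"
    hence "Y / real p \<ge> Y0" using p0 by (simp add: field_simps)
    from Y0[OF this] obtain T2 where T2: "\<forall>T\<ge>T2. \<forall>\<sigma> e. \<sigma>0 \<le> \<sigma> \<longrightarrow> \<sigma> \<le> 3 \<longrightarrow> e = 1 \<or> e = -1 \<longrightarrow>
      integral {1..T} (\<lambda>t. (cmod (sieve_error S (Y / real p) (Complex \<sigma> (e * t))))\<^sup>2) \<le> \<eta> / 4 * T" by blast
    from Y0[of Y] Y obtain T1 where T1: "\<forall>T\<ge>T1. \<forall>\<sigma> e. \<sigma>0 \<le> \<sigma> \<longrightarrow> \<sigma> \<le> 3 \<longrightarrow> e = 1 \<or> e = -1 \<longrightarrow>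
      integral {1..T} (\<lambda>t. (cmod (sieve_error S Y (Complex \<sigma> (e * t))))\<^sup>2) \<le> \<eta> / 4 * T" by auto
    show "\<exists>T0. \<forall>T\<ge>T0. \<forall>\<sigma> e. \<sigma>0 \<le> \<sigma> \<longrightarrow> \<sigma> \<le> 3 \<longrightarrow> e = 1 \<or> e = -1 \<longrightarrow>
      integral {1..T} (\<lambda>t. (cmod (sieve_error (insert p S) Y (Complex \<sigma> (e * t))))\<^sup>2) \<le> \<eta> * T"
    proof (intro exI[of _ "max T1 T2"] allI impI)
      fix T \<sigma> e :: real assume T: "T \<ge> max T1 T2" and \<sigma>: "\<sigma>0 \<le> \<sigma>" "\<sigma> \<le> 3" and e: "e = 1 \<or> e = -1"
      let ?E = "\<lambda>S Y t. (cmod (sieve_error S Y (Complex \<sigma> (e * t))))\<^sup>2"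
      have c: "?E S Y integrable_on {1..T}" if "\<And>q. q \<in> S \<Longrightarrow> prime q" for S Y
        using e that by (intro integrable_continuous_interval continuous_intros continuous_on_sieve_error_vertical) auto
      have "integral {1..T} (?E (insert p S) Y) \<le> integral {1..T} (\<lambda>t. 2 * ?E S Y t + 2 * ?E S (Y / real p) t)"
      proof (intro integral_le c integrable_add integrable_on_cmult_left)
        fix t assume "t \<in> {1..T}"
        let ?s = "Complex \<sigma> (e * t)"
        have "cmod (of_nat p powr (- ?s)) \<le> 1"
          using p0 \<sigma> \<sigma>0 powr_mono[of "-\<sigma>" 0 "real p"] by simp
        hence "cmod (of_nat p powr (- ?s) * sieve_error S (Y / real p) ?s) \<le> cmod (sieve_error S (Y / real p) ?s)"
          unfolding norm_mult by (intro mult_left_le_one_le) auto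
        hence "cmod (sieve_error (insert p S) Y ?s) \<le> cmod (sieve_error S Y ?s) + cmod (sieve_error S (Y / real p) ?s)"
          using norm_triangle_ineq4[of "sieve_error S Y ?s" "of_nat p powr (- ?s) * sieve_error S (Y / real p) ?s"]
            sieve_error_insert[OF pr(1) insert.hyps(2) pr(2) insert.hyps(1), of Y ?s] by simp
        hence "?E (insert p S) Y t \<le> (cmod (sieve_error S Y ?s) + cmod (sieve_error S (Y / real p) ?s))\<^sup>2" by (intro power_mono) auto
        also have "\<dots> \<le> 2 * ?E S Y t + 2 * ?E S (Y / real p) t"
          using sum_squares_bound[of "cmod (sieve_error S Y ?s)" "cmod (sieve_error S (Y / real p) ?s)"] by (simp add: power2_sum)
        finally show "?E (insert p S) Y t \<le> 2 * ?E S Y t + 2 * ?E S (Y / real p) t" .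
      qed (use c[OF pr(2)] insert.prems(1) in \<open>auto intro!: integrable_on_cmult_left\<close>)
      also have "\<dots> = 2 * integral {1..T} (?E S Y) + 2 * integral {1..T} (?E S (Y / real p))"
        using c[of S] pr by (subst integral_add) (auto intro!: integrable_on_cmult_left)
      also have "\<dots> \<le> 2 * (\<eta> / 4 * T) + 2 * (\<eta> / 4 * T)"
        using T1 T2 T \<sigma> e by (intro add_mono mult_left_mono) auto
      also have "\<dots> = \<eta> * T" by simp
      finally show "integral {1..T} (?E (insert p S) Y) \<le> \<eta> * T" .
    qed
  qed
qed

lemma sieve_error_tendsto_0:
  assumes "finite S" "\<And>p. p \<in> S \<Longrightarrow> prime p" "Re s > 1"
  shows "((\<lambda>Y. sieve_error S Y s) \<longlongrightarrow> 0) at_top"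
  using assms(1,2)
proof (induction S rule: finite_induct)
  case empty
  have lim: "(\<lambda>n. \<Sum>k<n. of_nat (Suc k) powr (-s)) \<longlonglongrightarrow> zeta s"
    using dirichlet_zeta_sums[OF assms(3)] zeta_eq_dirichlet_zeta[OF assms(3)] by (simp add: sums_def)
  have ceil: "filterlim (\<lambda>Y::real. nat \<lceil>Y\<rceil> - 1) sequentially at_top"
    unfolding filterlim_at_top
  proof
    fix Z :: nat
    show "\<forall>\<^sub>F Y in at_top. Z \<le> nat \<lceil>Y::real\<rceil> - 1"
      using eventually_ge_at_top[of "real Z + 1"] by eventually_elim linarith
  qed
  from filterlim_compose[OF lim ceil]
  have "((\<lambda>Y::real. \<Sum>k<nat \<lceil>Y\<rceil> - 1. of_nat (Suc k) powr (-s)) \<longlongrightarrow> zeta s) at_top" .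
  moreover have "(\<Sum>k<nat \<lceil>Y\<rceil> - 1. of_nat (Suc k) powr (-s)) = sieved_sum {} Y s" for Y :: real
    unfolding sieved_sum_empty by (rule sum.reindex_bij_witness[of _ "\<lambda>n. n - 1" Suc]) auto
  ultimately have "((\<lambda>Y. sieved_sum {} Y s) \<longlongrightarrow> zeta s) at_top" by simp
  from tendsto_diff[OF tendsto_const[of "zeta s"] this] show ?case by (simp add: sieve_error_def euler_factor_def)
next
  case (insert p S)
  have pr: "prime p" "\<And>q. q \<in> S \<Longrightarrow> prime q" using insert.prems by auto
  have p0: "real p > 0" using prime_gt_0_nat[OF pr(1)] by simp
  have IH: "((\<lambda>Y. sieve_error S Y s) \<longlongrightarrow> 0) at_top" using insert.IH pr by blast
  have "filterlim (\<lambda>Y. 1 / real p * Y) at_top at_top"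
    using p0 by (intro filterlim_tendsto_pos_mult_at_top[OF tendsto_const _ filterlim_ident]) auto
  hence "filterlim (\<lambda>Y. Y / real p) at_top at_top" by simp
  from filterlim_compose[OF IH this] have "((\<lambda>Y. sieve_error S (Y / real p) s) \<longlongrightarrow> 0) at_top" .
  hence "((\<lambda>Y. sieve_error S Y s - of_nat p powr (-s) * sieve_error S (Y / real p) s) \<longlongrightarrow> 0 - of_nat p powr (-s) * 0) at_top"
    by (intro tendsto_intros IH)
  thus ?case using sieve_error_insert[OF pr(1) insert.hyps(2) pr(2) insert.hyps(1)] by simp
qed

lemma sieved_imp_gt:
  assumes "sieved (primes_upto N) n" "n > 1"
  shows "n > N"
proof -
  obtain q where q: "prime q" "q dvd n" using prime_factor_nat[of n] assms by auto
  hence "\<not> q \<le> N" using assms by (auto simp: sieved_def)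
  moreover have "q \<le> n" using q assms by (intro dvd_imp_le) auto
  ultimately show ?thesis by simp
qed

lemma sieved_sum_split_1:
  assumes "Y > 1"
  shows "sieved_sum (primes_upto N) Y s = 1 + (\<Sum>n | n > 1 \<and> real n < Y \<and> sieved (primes_upto N) n. of_nat n powr (-s))"
proof -
  have s1: "sieved (primes_upto N) 1" by (auto simp: sieved_def)
  have "{n. n \<ge> 1 \<and> real n < Y \<and> sieved (primes_upto N) n} = insert 1 {n. n > 1 \<and> real n < Y \<and> sieved (primes_upto N) n}"
    using assms s1 by (auto simp: order.order_iff_strict)
  moreover have "finite {n. n > 1 \<and> real n < Y \<and> sieved (primes_upto N) n}"
    by (rule finite_subset[OF _ finite_nat_below[of Y "\<lambda>_. True"]]) auto
  ultimately show ?thesis by (simp add: sieved_sum_def)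
qed

lemma sum_sieved_powr_le:
  fixes a :: real
  assumes "a > 1"
  shows "(\<Sum>n | n > 1 \<and> real n < Y \<and> sieved (primes_upto N) n. real n powr (-a)) \<le> (\<Sum>n. real (n + Suc N) powr (-a))"
proof -
  define A where "A = {n. n > 1 \<and> real n < Y \<and> sieved (primes_upto N) n}"
  have fin: "finite A" unfolding A_def by (rule finite_subset[OF _ finite_nat_below[of Y "\<lambda>_. True"]]) auto
  have A: "n > N" if "n \<in> A" for n using sieved_imp_gt that by (auto simp: A_def)
  have "(\<Sum>n\<in>A. real n powr (-a)) = (\<Sum>k\<in>(\<lambda>n. n - Suc N) ` A. real (k + Suc N) powr (-a))"
  proof (subst sum.reindex)
    show "inj_on (\<lambda>n. n - Suc N) A"
    proof (rule inj_onI)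
      fix x y assume "x \<in> A" "y \<in> A" "x - Suc N = y - Suc N"
      thus "x = y" using A[of x] A[of y] by linarith
    qed
    show "(\<Sum>n\<in>A. real n powr (-a)) = sum ((\<lambda>k. real (k + Suc N) powr (-a)) \<circ> (\<lambda>n. n - Suc N)) A"
      using A by (intro sum.cong refl) (simp add: Suc_leI)
  qed
  also have "\<dots> \<le> (\<Sum>n. real (n + Suc N) powr (-a))"
    using fin assms by (intro sum_le_suminf summable_shifted_powr) auto
  finally show ?thesis unfolding A_def .
qed

text \<open>For Re s > 1 the sieved sums converge to the product, and apart from n = 1 they contain
  only n > N. To the right of the strip this pointwise bound takes the place of mean values.\<close>

lemma zeta_euler_factor_bound:
  assumes "a > 1" "Re s \<ge> a"
  shows "cmod (zeta s * euler_factor (primes_upto N) s - 1) \<le> (\<Sum>n. real (n + Suc N) powr (-a))"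
proof -
  let ?S = "primes_upto N"
  have "((\<lambda>Y. sieve_error ?S Y s) \<longlongrightarrow> 0) at_top" using assms by (intro sieve_error_tendsto_0) auto
  from tendsto_diff[OF tendsto_const[of "zeta s * euler_factor ?S s - 1"] this]
  have "((\<lambda>Y. sieved_sum ?S Y s - 1) \<longlongrightarrow> zeta s * euler_factor ?S s - 1) at_top"
    by (simp add: sieve_error_def algebra_simps)
  hence "((\<lambda>Y. cmod (sieved_sum ?S Y s - 1)) \<longlongrightarrow> cmod (zeta s * euler_factor ?S s - 1)) at_top" by (rule tendsto_norm)
  thus ?thesis
  proof (rule tendsto_upperbound)
    show "\<forall>\<^sub>F Y in at_top. cmod (sieved_sum ?S Y s - 1) \<le> (\<Sum>n. real (n + Suc N) powr (-a))"
      using eventually_gt_at_top[of 1]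
    proof eventually_elim
      case (elim Y)
      have "cmod (sieved_sum ?S Y s - 1) \<le> (\<Sum>n | n > 1 \<and> real n < Y \<and> sieved ?S n. real n powr (-a))"
        unfolding sieved_sum_split_1[OF elim] add_diff_cancel_left'
        using assms by (intro sum_norm_le) (auto intro!: powr_mono)
      thus ?case using sum_sieved_powr_le[OF assms(1), of Y N] by linarith
    qed
  qed simp
qed

lemma powr_tail_tendsto_0:
  assumes "a > (1::real)"
  shows "(\<lambda>N. \<Sum>n. real (n + Suc N) powr (-a)) \<longlonglongrightarrow> 0"
proof -
  have sm: "summable (\<lambda>n. real n powr (-a))" using assms by (simp add: summable_real_powr_iff)
  show ?thesis
  proof (rule LIMSEQ_I)
    fix r :: real assume "r > 0"
    from suminf_exist_split[OF this sm] obtain M where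
      "\<And>n. n \<ge> M \<Longrightarrow> norm (\<Sum>i. real (i + n) powr (-a)) < r" by auto
    hence "norm ((\<Sum>i. real (i + Suc n) powr (-a)) - 0) < r" if "n \<ge> M" for n
      using that by (metis diff_zero le_SucI)
    thus "\<exists>no. \<forall>n\<ge>no. norm ((\<Sum>i. real (i + Suc n) powr (-a)) - 0) < r" by blast
  qed
qed

section \<open>The logarithm of the zeta function\<close>

text \<open>Extended by 0 off the primes, to make sums over primes ordinary series over the
  naturals.\<close>

definition euler_log :: "complex \<Rightarrow> nat \<Rightarrow> complex" where
  "euler_log s n = (if prime n then - Ln (1 - of_nat n powr (-s)) else 0)"

lemma norm_prime_powr_less_half:
  assumes "prime p" "Re s > 1"
  shows "cmod (of_nat p powr (-s)) < 1 / 2"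
proof -
  have p: "p \<ge> 2" using assms prime_ge_2_nat by simp
  have "cmod (of_nat p powr (-s)) = real p powr (- Re s)" by simp
  also have "\<dots> \<le> 2 powr (- Re s)" using p assms by (intro powr_mono2') auto
  also have "\<dots> < 2 powr (-1)" using assms by (intro powr_less_mono) auto
  finally show ?thesis by (simp add: powr_minus)
qed

lemma norm_euler_log_le:
  assumes "Re s > 1"
  shows "cmod (euler_log s n) \<le> 2 * real n powr (- Re s)"
proof (cases "prime n")
  case True
  from norm_Ln_le[of "- (of_nat n powr (-s))"] norm_prime_powr_less_half[OF True assms]
  show ?thesis using True by (simp add: euler_log_def)
qed (simp add: euler_log_def)

lemma summable_euler_log:
  assumes "Re s > 1"
  shows "summable (\<lambda>n. cmod (euler_log s n))"
proof (rule summable_comparison_test'[of "\<lambda>n. 2 * real n powr (- Re s)" 0])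
  show "summable (\<lambda>n. 2 * real n powr (- Re s))"
    using assms by (intro summable_mult) (simp add: summable_real_powr_iff)
qed (use norm_euler_log_le[OF assms] in auto)

text \<open>The double sum is unordered. Absolute convergence identifies the inner sum with the
  power series of -Ln (1 - p^(-s)) and the outer one with a series in increasing order.\<close>

lemma log_zeta_series_eq:
  assumes "Re s > 1"
  shows "log_zeta_series s = (\<Sum>n. euler_log s n)"
proof -
  have inner: "(\<Sum>\<^sub>\<infinity>k\<in>{1::nat..}. of_nat p powr (- (of_nat k * s)) / of_nat k) = euler_log s p" if p: "prime p" for p
  proof -
    define w where "w = of_nat p powr (-s)"
    have w: "cmod w < 1" using norm_prime_powr_less_half[OF p assms] by (simp add: w_def)
    have p1: "p \<ge> 1" using prime_gt_0_nat[OF p] by simp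
    have pw: "of_nat p powr (- (of_nat k * s)) = w ^ k" for k
    proof -
      have "- (of_nat k * s) * of_real (ln (real p)) = of_nat k * (- s * of_real (ln (real p)))" by (simp add: algebra_simps)
      thus ?thesis unfolding w_def nat_powr_exp[OF p1] by (simp only: exp_of_nat_mult)
    qed
    have "(\<lambda>n. - ((- (- w)) ^ n) / of_nat n) sums ln (1 + (- w))" by (rule Ln_series') (use w in simp)
    from sums_minus[OF this] have S: "(\<lambda>n. w ^ n / of_nat n) sums (- Ln (1 - w))" by simp
    have "summable (\<lambda>n. cmod (w ^ n / of_nat n))"
    proof (rule summable_comparison_test'[of "\<lambda>n. cmod w ^ n" 0])
      show "summable (\<lambda>n. cmod w ^ n)" using w by (intro summable_geometric) simp
      show "norm (cmod (w ^ n / of_nat n)) \<le> cmod w ^ n" for n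
        by (cases "n = 0") (auto simp: norm_divide norm_power divide_le_eq mult_le_cancel_left1)
    qed
    from norm_summable_imp_has_sum[OF this S] have "((\<lambda>n. w ^ n / of_nat n) has_sum (- Ln (1 - w))) UNIV" .
    hence "((\<lambda>n. w ^ n / of_nat n) has_sum (- Ln (1 - w))) {1::nat..}"
      by (rule has_sum_cong_neutral[THEN iffD1, rotated -1]) auto
    hence "(\<Sum>\<^sub>\<infinity>k\<in>{1::nat..}. w ^ k / of_nat k) = - Ln (1 - w)" by (rule infsumI)
    thus ?thesis using p by (simp add: pw euler_log_def w_def)
  qed
  have "summable (euler_log s)" using summable_euler_log[OF assms] by (rule summable_norm_cancel)
  from norm_summable_imp_has_sum[OF summable_euler_log[OF assms] summable_sums[OF this]]
  have "(euler_log s has_sum (\<Sum>n. euler_log s n)) UNIV" .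
  hence "(euler_log s has_sum (\<Sum>n. euler_log s n)) {p. prime p}"
    by (rule has_sum_cong_neutral[THEN iffD1, rotated -1]) (auto simp: euler_log_def)
  hence "infsum (euler_log s) {p. prime p} = (\<Sum>n. euler_log s n)" by (rule infsumI)
  moreover have "log_zeta_series s = infsum (euler_log s) {p. prime p}"
    unfolding log_zeta_series_def by (intro infsum_cong inner) simp
  ultimately show ?thesis by simp
qed

lemma holomorphic_nat_powr: "n \<ge> 1 \<Longrightarrow> (\<lambda>s. of_nat n powr (-s)) holomorphic_on A"
  by (intro holomorphic_intros) auto

lemma one_minus_not_nonpos: "cmod w < 1 \<Longrightarrow> 1 - w \<notin> \<real>\<^sub>\<le>\<^sub>0"
proof
  assume w: "cmod w < 1" "1 - w \<in> \<real>\<^sub>\<le>\<^sub>0"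
  have "Re w \<le> cmod w" by (rule complex_Re_le_cmod)
  thus False using w by (auto simp: complex_nonpos_Reals_iff)
qed

lemma holomorphic_euler_log:
  assumes "A \<subseteq> {s. Re s > 0}"
  shows "(\<lambda>s. euler_log s n) holomorphic_on A"
proof (cases "prime n")
  case True
  have n: "n \<ge> 2" using True prime_ge_2_nat by simp
  have "(\<lambda>s. - Ln (1 - of_nat n powr (-s))) holomorphic_on A"
  proof (intro holomorphic_intros holomorphic_nat_powr one_minus_not_nonpos)
    fix s assume "s \<in> A"
    hence "Re s > 0" using assms by auto
    hence "real n powr (- Re s) < real n powr 0" using n by (intro powr_less_mono) auto
    thus "cmod (of_nat n powr (- s)) < 1" using n by simp
  qed
  thus ?thesis using True by (simp add: euler_log_def)
qed (simp add: euler_log_def)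

lemma holomorphic_log_zeta_series: "log_zeta_series holomorphic_on {s. Re s > 1}"
proof -
  have "(\<lambda>s. \<Sum>n. euler_log s n) holomorphic_on {s. Re s > 1}"
  proof (rule holomorphic_suminf)
    show "open {s. Re s > 1}" by (rule open_halfspace_Re_gt)
    show "(\<lambda>s. euler_log s n) holomorphic_on {s. Re s > 1}" for n by (rule holomorphic_euler_log) auto
    fix x assume "x \<in> {s. Re s > 1}"
    hence x: "Re x > 1" by simp
    define d where "d = (Re x - 1) / 2"
    have d: "d > 0" using x by (simp add: d_def)
    have re: "Re y \<ge> Re x - d" if "y \<in> cball x d" for y
      using that abs_Re_le_cmod[of "x - y"] by (simp add: dist_norm)
    have gt: "Re x - d > 1" using x by (simp add: d_def field_simps)
    have "cball x d \<subseteq> {s. Re s > 1}" using re gt by force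
    moreover have "summable (\<lambda>n. 2 * real n powr (- (Re x - d)))"
      using gt by (intro summable_mult) (simp add: summable_real_powr_iff)
    moreover have "norm (euler_log y n) \<le> 2 * real n powr (- (Re x - d))" if y: "y \<in> cball x d" for n y
    proof (cases "n \<ge> 1")
      case True
      have "Re y > 1" using re[OF y] gt by linarith
      hence "norm (euler_log y n) \<le> 2 * real n powr (- Re y)" by (rule norm_euler_log_le)
      also have "\<dots> \<le> 2 * real n powr (- (Re x - d))" using re[OF y] True by (intro mult_left_mono powr_mono) auto
      finally show ?thesis .
    next
      case False
      hence "\<not> prime n" by (cases n) auto
      thus ?thesis by (simp add: euler_log_def)
    qed
    ultimately show "\<exists>d h. d > 0 \<and> cball x d \<subseteq> {s. Re s > 1} \<and> summable h \<and> (\<forall>n. \<forall>y\<in>cball x d. norm (euler_log y n) \<le> h n)"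
      using d by (intro exI[of _ d] exI[of _ "\<lambda>n. 2 * real n powr (- (Re x - d))"]) simp
  qed
  thus ?thesis by (rule holomorphic_transform) (simp add: log_zeta_series_eq)
qed

lemma exp_sum_euler_log:
  assumes "Re s > 0" "finite S" "\<And>p. p \<in> S \<Longrightarrow> prime p"
  shows "exp (\<Sum>p\<in>S. euler_log s p) * euler_factor S s = 1"
proof -
  have "exp (euler_log s p) * (1 - of_nat p powr (-s)) = 1" if "p \<in> S" for p
  proof -
    have p: "prime p" "p \<ge> 2" using assms(3)[OF that] prime_ge_2_nat by auto
    have "real p powr (- Re s) < real p powr 0" using p assms by (intro powr_less_mono) auto
    hence "cmod (of_nat p powr (-s)) < 1" using p by simp
    hence "1 - of_nat p powr (-s) \<noteq> (0::complex)" using one_minus_not_nonpos[of "of_nat p powr (-s)"] by force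
    thus ?thesis using p by (simp add: euler_log_def exp_minus)
  qed
  thus ?thesis unfolding euler_factor_def using assms(2)
    by (simp add: exp_sum flip: prod.distrib)
qed

text \<open>Euler's product as a limit: the exponential of the partial sum up to N is the reciprocal
  of the Euler factors, and \<zeta> times the Euler factors tends to 1.\<close>

lemma exp_log_zeta_series:
  assumes "Re s > 1"
  shows "exp (log_zeta_series s) = zeta s"
proof -
  have "(\<lambda>N. zeta s * euler_factor (primes_upto N) s) \<longlonglongrightarrow> 1"
  proof (rule LIMSEQ_I)
    fix r :: real assume "r > 0"
    from LIMSEQ_D[OF powr_tail_tendsto_0[OF assms] this] obtain M where
      M: "\<And>N. N \<ge> M \<Longrightarrow> norm ((\<Sum>n. real (n + Suc N) powr (- Re s)) - 0) < r" by blast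
    have "norm (zeta s * euler_factor (primes_upto N) s - 1) < r" if "N \<ge> M" for N
      using zeta_euler_factor_bound[OF assms order_refl, of N] M[OF that] by simp
    thus "\<exists>M. \<forall>N\<ge>M. norm (zeta s * euler_factor (primes_upto N) s - 1) < r" by blast
  qed
  moreover have "(\<lambda>N. \<Sum>n\<le>N. euler_log s n) \<longlonglongrightarrow> log_zeta_series s"
    unfolding log_zeta_series_eq[OF assms]
    using summable_norm_cancel[OF summable_euler_log[OF assms]] summable_LIMSEQ' by blast
  hence "(\<lambda>N. exp (\<Sum>n\<le>N. euler_log s n)) \<longlonglongrightarrow> exp (log_zeta_series s)" by (rule tendsto_exp)
  ultimately have "(\<lambda>N. zeta s * euler_factor (primes_upto N) s * exp (\<Sum>n\<le>N. euler_log s n)) \<longlonglongrightarrow> 1 * exp (log_zeta_series s)"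
    by (rule tendsto_mult)
  moreover have "zeta s * euler_factor (primes_upto N) s * exp (\<Sum>n\<le>N. euler_log s n) = zeta s" for N
  proof -
    have "(\<Sum>n\<le>N. euler_log s n) = (\<Sum>p\<in>primes_upto N. euler_log s p)"
      by (rule sum.mono_neutral_right) (auto simp: euler_log_def)
    moreover have "exp (\<Sum>p\<in>primes_upto N. euler_log s p) * euler_factor (primes_upto N) s = 1"
      using assms by (intro exp_sum_euler_log) auto
    ultimately show ?thesis by (simp add: mult.assoc mult.commute[of "euler_factor (primes_upto N) s"])
  qed
  ultimately have "(\<lambda>N::nat. zeta s) \<longlonglongrightarrow> exp (log_zeta_series s)" by simp
  thus ?thesis using LIMSEQ_unique tendsto_const by blast
qed

lemma zeta_nonzero: "Re s > 1 \<Longrightarrow> zeta s \<noteq> 0"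
  using exp_log_zeta_series by (metis exp_not_eq_zero)

section \<open>Continuation of the logarithm along horizontal rays\<close>

lemma connected_right_ray: "connected (right_ray s)"
proof (rule convex_connected)
  show "convex (right_ray s)"
  proof (rule convexI)
    fix x y :: complex and u v :: real
    assume *: "x \<in> right_ray s" "y \<in> right_ray s" "u \<ge> 0" "v \<ge> 0" "u + v = 1"
    have "u * Re s + v * Re s \<le> u * Re x + v * Re y"
      using * by (intro add_mono mult_left_mono) (auto simp: right_ray_def)
    moreover have "u * Re s + v * Re s = Re s" "u * Im s + v * Im s = Im s" using *(5) by (simp_all flip: distrib_right)
    ultimately show "u *\<^sub>R x + v *\<^sub>R y \<in> right_ray s" using * by (simp add: right_ray_def)
  qed
qed

text \<open>The intersection of two admissible neighbourhoods may be disconnected; the identity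
  theorem is applied on its component containing the ray, which reaches into Re z > 1.\<close>

lemma log_zeta_unique:
  assumes "open U" "right_ray s \<subseteq> U" "g holomorphic_on U" "\<And>z. z \<in> U \<Longrightarrow> Re z > 1 \<Longrightarrow> g z = log_zeta_series z"
    and "open V" "right_ray s \<subseteq> V" "h holomorphic_on V" "\<And>z. z \<in> V \<Longrightarrow> Re z > 1 \<Longrightarrow> h z = log_zeta_series z"
  shows "g s = h s"
proof -
  have s: "s \<in> U \<inter> V" using assms(2,6) by (auto simp: right_ray_def)
  define C where "C = connected_component_set (U \<inter> V) s"
  have "right_ray s \<subseteq> C" unfolding C_def
    by (rule connected_component_maximal) (use assms connected_right_ray in \<open>auto simp: right_ray_def\<close>)
  moreover have "Complex (max (Re s) 2) (Im s) \<in> right_ray s" by (simp add: right_ray_def)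
  ultimately have w: "Complex (max (Re s) 2) (Im s) \<in> C" by blast
  have Cs: "s \<in> C" unfolding C_def using connected_component_refl[OF s] by (rule CollectI)
  have C3: "open C" "connected C" "C \<subseteq> U \<inter> V"
    unfolding C_def using assms(1,5)
    by (intro open_connected_component open_Int connected_connected_component connected_component_subset; simp)+
  note C = C3 Cs
  show ?thesis
  proof (rule holomorphic_eq_from_halfplane[where A = C and f = g and g = h, OF _ _ C(1,2,4) w])
    show "g holomorphic_on C" by (rule holomorphic_on_subset[OF assms(3)]) (use C(3) in simp)
    show "h holomorphic_on C" by (rule holomorphic_on_subset[OF assms(7)]) (use C(3) in simp)
    show "Re (Complex (max (Re s) 2) (Im s)) > 1" by simp
    fix w assume w: "w \<in> C" "Re w > 1"
    have wUV: "w \<in> U" "w \<in> V" using C(3) w(1) by auto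
    show "g w = h w" by (simp only: assms(4)[OF wUV(1) w(2)] assms(8)[OF wUV(2) w(2)])
  qed
qed

lemma log_zeta_eqI:
  assumes "open U" "connected U" "right_ray s \<subseteq> U" "g holomorphic_on U" "\<And>z. z \<in> U \<Longrightarrow> Re z > 1 \<Longrightarrow> g z = log_zeta_series z"
  shows "log_zeta s = g s"
  unfolding log_zeta_def
proof (rule the_equality)
  show "\<exists>U h. open U \<and> connected U \<and> right_ray s \<subseteq> U \<and> h holomorphic_on U \<and> (\<forall>z\<in>U. Re z > 1 \<longrightarrow> h z = log_zeta_series z) \<and> h s = g s"
    using assms by (intro exI[of _ U] exI[of _ g]) auto
next
  fix w assume "\<exists>U h. open U \<and> connected U \<and> right_ray s \<subseteq> U \<and> h holomorphic_on U \<and> (\<forall>z\<in>U. Re z > 1 \<longrightarrow> h z = log_zeta_series z) \<and> h s = w"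
  then obtain V h where V: "open V" "right_ray s \<subseteq> V" "h holomorphic_on V" "\<forall>z\<in>V. Re z > 1 \<longrightarrow> h z = log_zeta_series z" "h s = w" by auto
  thus "w = g s" using log_zeta_unique[OF assms(1,3,4,5) V(1-3)] by auto
qed

definition right_strip :: "complex \<Rightarrow> real \<Rightarrow> complex set" where
  "right_strip s \<delta> = {z. Re z > Re s - \<delta> \<and> \<bar>Im z - Im s\<bar> < \<delta>}"

lemma right_strip: "open (right_strip s \<delta>)" "convex (right_strip s \<delta>)" "z \<in> right_strip s \<delta> \<Longrightarrow> right_ray z \<subseteq> right_strip s \<delta>"
proof -
  have eq: "right_strip s \<delta> = {z. Re z > Re s - \<delta>} \<inter> {z. Im z > Im s - \<delta>} \<inter> {z. Im z < Im s + \<delta>}"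
    by (auto simp: right_strip_def)
  show "open (right_strip s \<delta>)" unfolding eq
    by (intro open_Int open_halfspace_Re_gt open_halfspace_Im_gt open_halfspace_Im_lt)
  show "convex (right_strip s \<delta>)" unfolding eq
    by (intro convex_Int convex_halfspace_Re_gt convex_halfspace_Im_gt convex_halfspace_Im_lt)
qed (auto simp: right_strip_def right_ray_def)

text \<open>A compact initial segment of the ray has a tube free of zeros and of the pole, and for
  Re z > 1 there are none at all. On the resulting convex half strip \<zeta> has a holomorphic
  logarithm, which continues the series after adding a constant.\<close>

lemma log_zeta_dom_strip:
  assumes s: "s \<in> log_zeta_dom"
  shows "\<exists>\<delta>>0. right_strip s \<delta> \<subseteq> log_zeta_dom \<and> log_zeta holomorphic_on right_strip s \<delta>"
proof -
  define G where "G = {z. z \<noteq> 1 \<and> zeta z \<noteq> 0}"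
  have "open (-{1} \<inter> zeta -` (-{0}))"
    by (rule continuous_open_preimage[OF holomorphic_on_imp_continuous_on[OF holomorphic_zeta]]) auto
  moreover have "-{1} \<inter> zeta -` (-{0}) = G" by (auto simp: G_def)
  ultimately have Gopen: "open G" by simp
  define L where "L = closed_segment s (Complex (max (Re s) 2) (Im s))"
  have L: "z \<in> right_ray s" if "z \<in> L" for z
  proof -
    from that obtain u where u: "0 \<le> u" "u \<le> 1" "z = (1 - u) *\<^sub>R s + u *\<^sub>R Complex (max (Re s) 2) (Im s)"
      unfolding L_def closed_segment_def by blast
    have "u * Re s \<le> u * max (Re s) 2" using u(1) by (intro mult_left_mono) auto
    thus ?thesis unfolding u(3) by (simp add: right_ray_def algebra_simps)
  qed
  have "L \<subseteq> G" using L s by (auto simp: G_def log_zeta_dom_def)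
  moreover have "compact L" by (simp add: L_def)
  ultimately obtain e where e: "e > 0" "(\<Union>x\<in>L. ball x e) \<subseteq> G"
    using compact_subset_open_imp_ball_epsilon_subset[of L G] Gopen by blast
  define \<delta> where "\<delta> = e / 2"
  have \<delta>: "\<delta> > 0" using e by (simp add: \<delta>_def)
  have UG: "right_strip s \<delta> \<subseteq> G"
  proof
    fix z assume z: "z \<in> right_strip s \<delta>"
    show "z \<in> G"
    proof (cases "Re z > 1")
      case True
      thus ?thesis using zeta_nonzero[of z] by (auto simp: G_def)
    next
      case False
      \<comment> \<open>A point of \<open>L\<close> near z: z is moved to the height of s and, if it
        lies to the left of s, also to the right.\<close>
      define x where "x = Complex (max (Re z) (Re s)) (Im s)"
      have xL: "x \<in> L"
      proof -
        define b where "b = max (Re s) 2"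
        define u where "u = (if b = Re s then 0 else (Re x - Re s) / (b - Re s))"
        have b: "Re s \<le> Re x" "Re x \<le> b" "Re s \<le> b" using False by (auto simp: x_def b_def)
        have u: "0 \<le> u" "u \<le> 1" "Re x = Re s + u * (b - Re s)" using b by (auto simp: u_def divide_le_eq)
        have "x = (1 - u) *\<^sub>R s + u *\<^sub>R Complex b (Im s)"
          using u(3) by (simp add: complex_eq_iff x_def algebra_simps)
        thus ?thesis using u unfolding L_def b_def closed_segment_def by blast
      qed
      have "cmod (x - z) \<le> \<bar>Re (x - z)\<bar> + \<bar>Im (x - z)\<bar>" by (rule cmod_le)
      also have "\<dots> < e"
      proof -
        have "Re s - Re z < e / 2" "\<bar>Im z - Im s\<bar> < e / 2" using z by (auto simp: right_strip_def \<delta>_def)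
        moreover have "Re (x - z) = max 0 (Re s - Re z)" "Im (x - z) = Im s - Im z" by (auto simp: x_def)
        ultimately show ?thesis using e(1) by linarith
      qed
      finally have "z \<in> ball x e" by (simp add: dist_norm)
      thus ?thesis using e xL by blast
    qed
  qed
  have U: "open (right_strip s \<delta>)" "convex (right_strip s \<delta>)" by (rule right_strip)+
  have sU: "s \<in> right_strip s \<delta>" using \<delta> by (simp add: right_strip_def)
  have "zeta holomorphic_on right_strip s \<delta>" using holomorphic_on_subset[OF holomorphic_zeta] UG by (auto simp: G_def)
  moreover have "zeta z \<noteq> 0" if "z \<in> right_strip s \<delta>" for z using UG that by (auto simp: G_def)
  ultimately obtain h where h: "h holomorphic_on right_strip s \<delta>" "\<And>z. z \<in> right_strip s \<delta> \<Longrightarrow> exp (h z) = zeta z"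
    using holomorphic_logarithm_exists[OF U(2,1), of zeta s] sU by metis
  define U1 where "U1 = right_strip s \<delta> \<inter> {z. Re z > 1}"
  have U1: "open U1" "convex U1" unfolding U1_def
    using U by (auto intro!: open_Int convex_Int open_halfspace_Re_gt convex_halfspace_Re_gt)
  \<comment> \<open>The difference of two logarithms of \<zeta> has exponential 1, hence derivative
    0, hence is constant on the convex set \<open>U1\<close>.\<close>
  define f where "f = (\<lambda>z. log_zeta_series z - h z)"
  have fh: "f holomorphic_on U1" unfolding f_def U1_def
    by (intro holomorphic_intros holomorphic_on_subset[OF holomorphic_log_zeta_series] holomorphic_on_subset[OF h(1)]) auto
  have ef: "exp (f z) = 1" if "z \<in> U1" for z
    using that h(2)[of z] exp_log_zeta_series[of z] zeta_nonzero[of z] by (simp add: f_def exp_diff U1_def)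
  have "(f has_field_derivative 0) (at z within U1)" if z: "z \<in> U1" for z
  proof -
    from fh z U1 obtain f' where f': "(f has_field_derivative f') (at z)" by (auto simp: holomorphic_on_open)
    have "((\<lambda>z. exp (f z)) has_field_derivative exp (f z) * f') (at z)"
      using f' by (auto intro!: derivative_eq_intros)
    moreover have "((\<lambda>z. exp (f z)) has_field_derivative 0) (at z)"
      by (rule has_field_derivative_transform_within_open[OF DERIV_const U1(1) z]) (use ef in auto)
    ultimately have "exp (f z) * f' = 0" by (rule DERIV_unique)
    hence "f' = 0" by simp
    thus ?thesis using f' has_field_derivative_at_within by blast
  qed
  from has_field_derivative_zero_constant[OF U1(2) this] obtain c where c: "\<forall>z\<in>U1. f z = c" by blast
  have g: "(\<lambda>z. h z + c) holomorphic_on right_strip s \<delta>" by (intro holomorphic_intros h)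
  have lz: "log_zeta z = h z + c" if z: "z \<in> right_strip s \<delta>" for z
  proof (rule log_zeta_eqI[OF U(1) convex_connected[OF U(2)] right_strip(3)[OF z] g])
    fix w assume "w \<in> right_strip s \<delta>" "Re w > 1"
    hence "f w = c" using c by (simp add: U1_def)
    hence "log_zeta_series w = c + h w" unfolding f_def by (rule diff_eq_eq[THEN iffD1])
    thus "h w + c = log_zeta_series w" by (simp add: add.commute)
  qed
  have "log_zeta holomorphic_on right_strip s \<delta>" by (rule holomorphic_transform[OF g]) (simp add: lz)
  moreover have "right_strip s \<delta> \<subseteq> log_zeta_dom"
  proof
    fix z assume "z \<in> right_strip s \<delta>"
    hence "right_ray z \<subseteq> G" using right_strip(3) UG by blast
    thus "z \<in> log_zeta_dom" by (auto simp: log_zeta_dom_def G_def)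
  qed
  ultimately show ?thesis using \<delta> by blast
qed

lemma open_log_zeta_dom: "open log_zeta_dom"
proof (subst open_subopen, intro ballI)
  fix s assume "s \<in> log_zeta_dom"
  then obtain \<delta> where "\<delta> > 0" "right_strip s \<delta> \<subseteq> log_zeta_dom" using log_zeta_dom_strip by blast
  thus "\<exists>T. open T \<and> s \<in> T \<and> T \<subseteq> log_zeta_dom"
    by (intro exI[of _ "right_strip s \<delta>"]) (auto simp: right_strip(1), simp add: right_strip_def)
qed

lemma continuous_on_log_zeta: "continuous_on log_zeta_dom log_zeta"
proof (rule continuous_at_imp_continuous_on, intro ballI)
  fix s assume "s \<in> log_zeta_dom"
  then obtain \<delta> where \<delta>: "\<delta> > 0" "log_zeta holomorphic_on right_strip s \<delta>" using log_zeta_dom_strip by blast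
  have "s \<in> right_strip s \<delta>" using \<delta> by (simp add: right_strip_def)
  thus "isCont log_zeta s"
    using holomorphic_on_imp_continuous_on[OF \<delta>(2)] right_strip(1)[of s \<delta>] by (simp add: continuous_on_eq_continuous_at)
qed

section \<open>The logarithm where zeta is close to a finite Euler product\<close>

lemma holomorphic_euler_factor: "(\<And>p. p \<in> S \<Longrightarrow> prime p) \<Longrightarrow> euler_factor S holomorphic_on A"
  unfolding euler_factor_def[abs_def]
  by (intro holomorphic_intros holomorphic_nat_powr) (use prime_ge_1_nat in auto)

text \<open>The tail bound makes the part of the series from primes beyond N smaller than 1 in
  modulus. Its imaginary part is then below \<pi>, so it is the principal logarithm of its
  exponential.\<close>

lemma log_zeta_series_tail:
  assumes tail: "(\<Sum>n. real (n + Suc N) powr (-2)) < 1 / 4" and s: "Re s > 2"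
  shows "log_zeta_series s = (\<Sum>p\<in>primes_upto N. euler_log s p) + Ln (zeta s * euler_factor (primes_upto N) s)"
proof -
  have s1: "Re s > 1" "Re s > 0" using s by auto
  have sum: "summable (euler_log s)" using summable_euler_log[OF s1(1)] by (rule summable_norm_cancel)
  define L where "L = (\<Sum>n. euler_log s (n + Suc N))"
  have "(\<Sum>n. euler_log s n) = L + (\<Sum>n<Suc N. euler_log s n)"
    unfolding L_def by (rule suminf_split_initial_segment[OF sum])
  also have "(\<Sum>n<Suc N. euler_log s n) = (\<Sum>p\<in>primes_upto N. euler_log s p)"
    by (rule sum.mono_neutral_right) (auto simp: euler_log_def)
  finally have split: "log_zeta_series s = L + (\<Sum>p\<in>primes_upto N. euler_log s p)"
    by (simp add: log_zeta_series_eq[OF s1(1)])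
  have sm2: "summable (\<lambda>n. 2 * real (n + Suc N) powr (-2))" by (intro summable_mult summable_shifted_powr) simp
  have "cmod L \<le> (\<Sum>n. 2 * real (n + Suc N) powr (-2))"
    unfolding L_def
  proof (rule norm_suminf_le[OF _ sm2])
    fix n
    have "norm (euler_log s (n + Suc N)) \<le> 2 * real (n + Suc N) powr (- Re s)" by (rule norm_euler_log_le[OF s1(1)])
    also have "\<dots> \<le> 2 * real (n + Suc N) powr (-2)" using s by (intro mult_left_mono powr_mono) auto
    finally show "norm (euler_log s (n + Suc N)) \<le> 2 * real (n + Suc N) powr (-2)" .
  qed
  also have "\<dots> = 2 * (\<Sum>n. real (n + Suc N) powr (-2))" by (intro suminf_mult summable_shifted_powr) simp
  finally have "cmod L < 1" using tail by linarith
  hence "\<bar>Im L\<bar> < pi" using abs_Im_le_cmod[of L] pi_gt3 by linarith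
  hence "Ln (exp L) = L" by (intro Ln_exp) auto
  moreover have "exp L = zeta s * euler_factor (primes_upto N) s"
  proof -
    have e1: "exp (\<Sum>p\<in>primes_upto N. euler_log s p) * euler_factor (primes_upto N) s = 1"
      by (rule exp_sum_euler_log[OF s1(2)]) auto
    have e2: "zeta s = exp L * exp (\<Sum>p\<in>primes_upto N. euler_log s p)"
      using exp_log_zeta_series[OF s1(1)] by (simp only: split exp_add)
    show ?thesis unfolding e2 mult.assoc e1 by simp
  qed
  ultimately show ?thesis using split by (simp add: add.commute)
qed

text \<open>On the whole half strip the product stays within 1 / 2 of 1, so the right-hand side is
  holomorphic there; it agrees with the series for Re z > 2 and is therefore the continuation.
  Closeness is assumed up to Re z = 2 only, since beyond that the tail bound provides it, and
  \<open>H \<le> \<bar>t0\<bar>\<close> keeps the pole out.\<close>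

lemma log_zeta_near_euler_product:
  assumes tail: "(\<Sum>n. real (n + Suc N) powr (-2)) < 1 / 4" and \<sigma>1: "\<sigma>1 > 0" and H: "H \<le> \<bar>t0\<bar>"
    and close: "\<And>z. \<sigma>1 < Re z \<Longrightarrow> Re z \<le> 2 \<Longrightarrow> \<bar>Im z - t0\<bar> < H \<Longrightarrow> cmod (zeta z * euler_factor (primes_upto N) z - 1) < 1 / 2"
    and s: "\<sigma>1 < Re s" "\<bar>Im s - t0\<bar> < H"
  shows "s \<in> log_zeta_dom"
    and "log_zeta s = (\<Sum>p\<in>primes_upto N. euler_log s p) + Ln (zeta s * euler_factor (primes_upto N) s)"
proof -
  define q where "q = (\<lambda>z. zeta z * euler_factor (primes_upto N) z)"
  define U where "U = {z. Re z > \<sigma>1 \<and> \<bar>Im z - t0\<bar> < H}"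
  have Ueq: "U = {z. Re z > \<sigma>1} \<inter> {z. Im z > t0 - H} \<inter> {z. Im z < t0 + H}" by (auto simp: U_def)
  have U: "open U" "convex U" unfolding Ueq
    by (intro open_Int convex_Int open_halfspace_Re_gt open_halfspace_Im_gt open_halfspace_Im_lt
         convex_halfspace_Re_gt convex_halfspace_Im_gt convex_halfspace_Im_lt)+
  have ray: "right_ray z \<subseteq> U" if "z \<in> U" for z using that by (auto simp: U_def right_ray_def)
  have q1: "cmod (q z - 1) < 1 / 2" if "z \<in> U" for z
  proof (cases "Re z \<le> 2")
    case True
    thus ?thesis unfolding q_def using close that by (auto simp: U_def)
  next
    case False
    hence "cmod (q z - 1) \<le> (\<Sum>n. real (n + Suc N) powr (-2))"
      unfolding q_def by (intro zeta_euler_factor_bound) auto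
    thus ?thesis using tail by linarith
  qed
  have no1: "z \<noteq> 1" if "z \<in> U" for z using that H by (auto simp: U_def)
  have nz: "zeta z \<noteq> 0" if "z \<in> U" for z using q1[OF that] by (auto simp: q_def)
  show "s \<in> log_zeta_dom"
  proof -
    have "s \<in> U" using s by (simp add: U_def)
    hence "right_ray s \<subseteq> U" by (rule ray)
    thus ?thesis using no1 nz by (auto simp: log_zeta_dom_def)
  qed
  have qh: "q holomorphic_on U" unfolding q_def
    by (intro holomorphic_intros holomorphic_euler_factor holomorphic_on_subset[OF holomorphic_zeta]) (use no1 in auto)
  define g where "g = (\<lambda>z. (\<Sum>p\<in>primes_upto N. euler_log z p) + Ln (q z))"
  have gh: "g holomorphic_on U"
  proof -
    have "(\<lambda>z. Ln (q z)) holomorphic_on U"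
    proof (intro holomorphic_intros qh)
      fix z assume "z \<in> U"
      hence "cmod (1 - q z) < 1" using q1[of z] by (simp add: norm_minus_commute)
      from one_minus_not_nonpos[OF this] show "q z \<notin> \<real>\<^sub>\<le>\<^sub>0" by simp
    qed
    thus ?thesis unfolding g_def
      by (intro holomorphic_on_add holomorphic_on_sum holomorphic_euler_log) (use \<sigma>1 in \<open>auto simp: U_def\<close>)
  qed
  have geq: "g z = log_zeta_series z" if z: "z \<in> U" "Re z > 1" for z
  proof (rule analytic_continuation_open[where s = "U \<inter> {z. Re z > 2}" and s' = "U \<inter> {z. Re z > 1}" and f = g and g = log_zeta_series])
    show "open (U \<inter> {z. Re z > 2})" "open (U \<inter> {z. Re z > 1})" using U by (intro open_Int open_halfspace_Re_gt; simp)+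
    show "connected (U \<inter> {z. Re z > 1})" using U by (intro convex_connected convex_Int convex_halfspace_Re_gt)
    have "Complex (max 3 (Re z)) (Im z) \<in> U \<inter> {z. Re z > 2}" using z by (auto simp: U_def)
    thus "U \<inter> {z. Re z > 2} \<noteq> {}" by blast
    show "g holomorphic_on U \<inter> {z. Re z > 1}" by (rule holomorphic_on_subset[OF gh]) simp
    show "log_zeta_series holomorphic_on U \<inter> {z. Re z > 1}" by (rule holomorphic_on_subset[OF holomorphic_log_zeta_series]) simp
    show "g w = log_zeta_series w" if "w \<in> U \<inter> {z. Re z > 2}" for w
      using log_zeta_series_tail[OF tail, of w] that by (simp add: g_def q_def)
  qed (use z in auto)
  have "log_zeta s = g s"
    by (rule log_zeta_eqI[OF U(1) convex_connected[OF U(2)] ray gh geq]) (use s in \<open>auto simp: U_def\<close>)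
  thus "log_zeta s = (\<Sum>p\<in>primes_upto N. euler_log s p) + Ln (zeta s * euler_factor (primes_upto N) s)"
    by (simp add: g_def q_def)
qed

text \<open>The radius 3 / 4 admits p^(-s) for every prime and Re s \<ge> 1 / 2, as 1 / sqrt 2 < 3 /
  4; on this disc the derivative is at most 4.\<close>

lemma Ln_one_minus_lipschitz:
  assumes "cmod w \<le> 3 / 4" "cmod w' \<le> 3 / 4"
  shows "cmod (Ln (1 - w) - Ln (1 - w')) \<le> 4 * cmod (w - w')"
proof (rule field_differentiable_bound[of "cball 0 (3 / 4)" "\<lambda>w. Ln (1 - w)" "\<lambda>w. - (1 / (1 - w))" 4 w w'])
  fix z :: complex assume z: "z \<in> cball 0 (3 / 4)"
  hence z1: "cmod z < 1" by simp
  show "((\<lambda>w. Ln (1 - w)) has_field_derivative - (1 / (1 - z))) (at z within cball 0 (3 / 4))"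
    using one_minus_not_nonpos[OF z1] by (auto intro!: derivative_eq_intros simp: field_simps)
  have "cmod (1 - z) \<ge> 1 / 4" using z norm_triangle_ineq2[of 1 z] by simp
  hence "1 / cmod (1 - z) \<le> 4" by (simp add: divide_le_eq)
  thus "cmod (- (1 / (1 - z))) \<le> 4" by (simp only: norm_minus_cancel norm_divide norm_one)
next
  show "convex (cball (0::complex) (3 / 4))" by (rule convex_cball)
  show "w \<in> cball 0 (3 / 4)" "w' \<in> cball 0 (3 / 4)" using assms by simp_all
qed

text \<open>Vertical shifts change p^(-s) only by a phase, so the Lipschitz bound leaves the
  distance of a single phase from 1.\<close>

lemma euler_log_diff_le:
  assumes p: "prime p" and s: "Re s \<ge> 1 / 2"
  shows "cmod (euler_log (s + \<i> * of_real a) p - euler_log (s + \<i> * of_real b) p) \<le> 4 * cmod (1 - cis ((a - b) * ln (real p)))"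
proof -
  have p2: "p \<ge> 2" "p \<ge> 1" using prime_ge_2_nat[OF p] by simp_all
  define w where "w = (\<lambda>a. of_nat p powr (- (s + \<i> * of_real a)))"
  have w: "w a = of_nat p powr (-s) * cis (- (a * ln (real p)))" for a
    unfolding w_def nat_powr_exp[OF p2(2)] cis_conv_exp by (simp add: algebra_simps flip: exp_add)
  have nw: "cmod (w a) \<le> 3 / 4" for a
  proof -
    have "cmod (w a) = real p powr (- Re s)" by (simp add: w norm_mult)
    also have "\<dots> \<le> real p powr (- (1 / 2))" using p2 s by (intro powr_mono) auto
    also have "\<dots> \<le> 2 powr (- (1 / 2))" using p2 by (intro powr_mono2') auto
    also have "\<dots> = 1 / sqrt 2"
    proof -
      have "(2::real) powr (1 / 2) = sqrt 2" by (rule powr_half_sqrt) simp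
      thus ?thesis by (simp only: powr_minus_divide)
    qed
    also have "\<dots> \<le> 3 / 4"
    proof -
      have "4 / 3 \<le> sqrt 2" by (rule real_le_rsqrt) (simp add: power2_eq_square)
      thus ?thesis by (simp add: field_simps)
    qed
    finally show ?thesis .
  qed
  have "cmod (euler_log (s + \<i> * of_real a) p - euler_log (s + \<i> * of_real b) p) = cmod (Ln (1 - w a) - Ln (1 - w b))"
    using p by (simp add: euler_log_def w_def norm_minus_commute)
  also have "\<dots> \<le> 4 * cmod (w a - w b)" by (rule Ln_one_minus_lipschitz[OF nw nw])
  also have "w a - w b = of_nat p powr (-s) * cis (- (a * ln (real p))) * (1 - cis ((a - b) * ln (real p)))"
  proof -
    have "cis (- (a * ln (real p))) * cis ((a - b) * ln (real p)) = cis (- (b * ln (real p)))"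
      by (simp add: cis_mult algebra_simps)
    thus ?thesis by (simp only: w right_diff_distrib mult.assoc mult_1_right)
  qed
  also have "cmod \<dots> \<le> 1 * cmod (1 - cis ((a - b) * ln (real p)))"
  proof -
    have "cmod (of_nat p powr (-s) * cis (- (a * ln (real p)))) \<le> 1" using nw[of a] unfolding w by linarith
    thus ?thesis unfolding norm_mult[of _ "1 - cis ((a - b) * ln (real p))"] by (rule mult_right_mono) simp
  qed
  finally show ?thesis by simp
qed

text \<open>Cauchy's formula is applied to the square of f, so that the mean square appears at once.
  The circle keeps distance r / 2 from z, whence the factor 2.\<close>

lemma norm_square_le_circle_mean:
  assumes f: "f holomorphic_on cball c r" and r: "r > 0" and z: "cmod (z - c) \<le> r / 2"
  shows "(cmod (f z))\<^sup>2 \<le> 2 * integral {0..1} (\<lambda>t. (cmod (f (circlepath c r t)))\<^sup>2)"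
proof -
  have cp: "circlepath c r t \<in> cball c r" for t
    using r by (simp add: circlepath dist_norm norm_mult)
  have "(\<lambda>u. (f u)\<^sup>2) holomorphic_on cball c r" using f by (intro holomorphic_intros)
  from Cauchy_integral_circlepath_simple[OF this, of z] z r
  have "((\<lambda>u. (f u)\<^sup>2 / (u - z)) has_contour_integral (2 * of_real pi * \<i> * (f z)\<^sup>2)) (circlepath c r)" by simp
  hence hi: "((\<lambda>t. (f (circlepath c r t))\<^sup>2 / (circlepath c r t - z) * vector_derivative (circlepath c r) (at t within {0..1}))
     has_integral (2 * of_real pi * \<i> * (f z)\<^sup>2)) {0..1}" by (simp add: has_contour_integral_def)
  have cont: "continuous_on {0..1} (\<lambda>t. (cmod (f (circlepath c r t)))\<^sup>2)"
  proof (intro continuous_intros continuous_on_compose2[OF holomorphic_on_imp_continuous_on[OF f]])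
    show "continuous_on {0..1} (circlepath c r)" unfolding circlepath by (intro continuous_intros)
  qed (use cp in auto)
  have "norm (2 * of_real pi * \<i> * (f z)\<^sup>2) \<le> integral {0..1} (\<lambda>t. 4 * pi * (cmod (f (circlepath c r t)))\<^sup>2)"
    unfolding integral_unique[OF hi, symmetric]
  proof (rule integral_norm_bound_integral)
    show "(\<lambda>t. (f (circlepath c r t))\<^sup>2 / (circlepath c r t - z) * vector_derivative (circlepath c r) (at t within {0..1})) integrable_on {0..1}"
      using hi by blast
    show "(\<lambda>t. 4 * pi * (cmod (f (circlepath c r t)))\<^sup>2) integrable_on {0..1}"
      by (intro integrable_continuous_interval continuous_intros cont)
    fix t :: real assume t: "t \<in> {0..1}"
    have "cmod (circlepath c r t - c) = r" using r by (simp add: circlepath norm_mult)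
    moreover have "cmod (circlepath c r t - c) \<le> cmod (circlepath c r t - z) + cmod (z - c)"
      using norm_triangle_ineq[of "circlepath c r t - z" "z - c"] by simp
    ultimately have d: "cmod (circlepath c r t - z) \<ge> r / 2" using z by linarith
    have v: "cmod (vector_derivative (circlepath c r) (at t within {0..1})) = 2 * pi * r"
      using t r by (simp add: vector_derivative_circlepath01 norm_mult)
    have "norm ((f (circlepath c r t))\<^sup>2 / (circlepath c r t - z) * vector_derivative (circlepath c r) (at t within {0..1}))
       = (cmod (f (circlepath c r t)))\<^sup>2 / cmod (circlepath c r t - z) * (2 * pi * r)"
      unfolding norm_mult norm_divide v norm_power ..
    also have "\<dots> \<le> (cmod (f (circlepath c r t)))\<^sup>2 / (r / 2) * (2 * pi * r)"
      using d r by (intro mult_right_mono divide_left_mono mult_pos_pos) auto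
    also have "\<dots> = 4 * pi * (cmod (f (circlepath c r t)))\<^sup>2" using r by (simp add: field_simps)
    finally show "norm ((f (circlepath c r t))\<^sup>2 / (circlepath c r t - z) * vector_derivative (circlepath c r) (at t within {0..1}))
      \<le> 4 * pi * (cmod (f (circlepath c r t)))\<^sup>2" .
  qed
  also have "\<dots> = 4 * pi * integral {0..1} (\<lambda>t. (cmod (f (circlepath c r t)))\<^sup>2)" by simp
  finally have "2 * pi * (cmod (f z))\<^sup>2 \<le> 2 * pi * (2 * integral {0..1} (\<lambda>t. (cmod (f (circlepath c r t)))\<^sup>2))"
    by (simp add: norm_mult norm_power)
  thus ?thesis by simp
qed

text \<open>On a compact set the supremum is attained, so the strict bound holds pointwise and is
  stable under small changes of \<tau>; the set is an interval intersected with an open set.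
  Measurability serves the monotonicity of \<open>measure\<close> in the final comparison.\<close>

lemma approximation_set_measurable:
  fixes d \<epsilon> :: real and K :: "complex set"
  assumes K: "compact K"
  defines "B \<equiv> (\<lambda>T. {\<tau> \<in> {0..T}. (\<forall>s\<in>K. s + \<i> * of_real \<tau> \<in> log_zeta_dom \<and> s + \<i> * of_real (d * \<tau>) \<in> log_zeta_dom) \<and>
              (SUP s\<in>K. ereal (norm (log_zeta (s + \<i> * of_real \<tau>) - log_zeta (s + \<i> * of_real (d * \<tau>))))) < ereal \<epsilon>})"
  shows "B T = {0..T} \<inter> {\<tau>. \<forall>s\<in>K. s + \<i> * of_real \<tau> \<in> log_zeta_dom \<and> s + \<i> * of_real (d * \<tau>) \<in> log_zeta_dom \<and>
           norm (log_zeta (s + \<i> * of_real \<tau>) - log_zeta (s + \<i> * of_real (d * \<tau>))) < \<epsilon>}"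
    and "B T \<in> lmeasurable"
proof -
  define \<Delta> where "\<Delta> = (\<lambda>\<tau> s. norm (log_zeta (s + \<i> * of_real \<tau>) - log_zeta (s + \<i> * of_real (d * \<tau>))))"
  define dom where "dom = (\<lambda>\<tau> s. s + \<i> * of_real \<tau> \<in> log_zeta_dom \<and> s + \<i> * of_real (d * \<tau>) \<in> log_zeta_dom)"
  define D where "D = {x::real \<times> complex. dom (fst x) (snd x)}"
  have Deq: "D = ((\<lambda>x. snd x + \<i> * of_real (fst x)) -` log_zeta_dom) \<inter> ((\<lambda>x. snd x + \<i> * of_real (d * fst x)) -` log_zeta_dom)"
    by (auto simp: D_def dom_def)
  have Dopen: "open D" unfolding Deq
    by (intro open_Int open_vimage open_log_zeta_dom continuous_intros)
  have cont: "continuous_on D (\<lambda>x. \<Delta> (fst x) (snd x))" unfolding \<Delta>_def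
    by (intro continuous_intros continuous_on_compose2[OF continuous_on_log_zeta]) (auto simp: D_def dom_def)
  define P where "P = {x \<in> D. \<Delta> (fst x) (snd x) < \<epsilon>}"
  have "P = D \<inter> (\<lambda>x. \<Delta> (fst x) (snd x)) -` {..<\<epsilon>}" by (auto simp: P_def)
  hence Popen: "open P" using continuous_open_preimage[OF cont Dopen, of "{..<\<epsilon>}"] by simp
  define O2 where "O2 = {\<tau>. \<forall>s\<in>K. (\<tau>, s) \<in> P}"
  have "open O2"
  proof (subst open_contains_ball, intro ballI)
    fix \<tau> assume "\<tau> \<in> O2"
    hence "{\<tau>} \<times> K \<subseteq> P" by (auto simp: O2_def)
    moreover have "compact ({\<tau>} \<times> K)" using K by (intro compact_Times) auto
    ultimately obtain e where e: "e > 0" "(\<Union>x\<in>{\<tau>} \<times> K. ball x e) \<subseteq> P"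
      using compact_subset_open_imp_ball_epsilon_subset[of "{\<tau>} \<times> K" P] Popen by blast
    have "ball \<tau> e \<subseteq> O2"
    proof
      fix \<tau>' assume "\<tau>' \<in> ball \<tau> e"
      hence "(\<tau>', s) \<in> ball (\<tau>, s) e" for s :: complex by (simp add: dist_Pair_Pair)
      thus "\<tau>' \<in> O2" using e(2) unfolding O2_def by blast
    qed
    thus "\<exists>e>0. ball \<tau> e \<subseteq> O2" using e(1) by blast
  qed
  have sup: "(SUP s\<in>K. ereal (\<Delta> \<tau> s)) < ereal \<epsilon> \<longleftrightarrow> (\<forall>s\<in>K. \<Delta> \<tau> s < \<epsilon>)" if dm: "\<forall>s\<in>K. dom \<tau> s" for \<tau>
  proof
    assume *: "(SUP s\<in>K. ereal (\<Delta> \<tau> s)) < ereal \<epsilon>"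
    show "\<forall>s\<in>K. \<Delta> \<tau> s < \<epsilon>"
    proof
      fix s assume "s \<in> K"
      hence "ereal (\<Delta> \<tau> s) \<le> (SUP s\<in>K. ereal (\<Delta> \<tau> s))" by (rule SUP_upper)
      with * have "ereal (\<Delta> \<tau> s) < ereal \<epsilon>" by (rule le_less_trans[rotated])
      thus "\<Delta> \<tau> s < \<epsilon>" by simp
    qed
  next
    assume *: "\<forall>s\<in>K. \<Delta> \<tau> s < \<epsilon>"
    show "(SUP s\<in>K. ereal (\<Delta> \<tau> s)) < ereal \<epsilon>"
    proof (cases "K = {}")
      \<comment> \<open>Over the empty set the supremum of extended reals is -\<infinity>.\<close>
      case True
      thus ?thesis by (simp add: bot_ereal_def)
    next
      case False
      have "continuous_on K (\<Delta> \<tau>)"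
      proof -
        have "continuous_on K ((\<lambda>x. \<Delta> (fst x) (snd x)) \<circ> (\<lambda>s. (\<tau>, s)))"
          by (intro continuous_on_compose continuous_intros continuous_on_subset[OF cont]) (use dm in \<open>auto simp: D_def\<close>)
        thus ?thesis by (simp add: o_def)
      qed
      from continuous_attains_sup[OF K False this] obtain s where s: "s \<in> K" "\<forall>t\<in>K. \<Delta> \<tau> t \<le> \<Delta> \<tau> s" by blast
      have "(SUP s\<in>K. ereal (\<Delta> \<tau> s)) \<le> ereal (\<Delta> \<tau> s)" by (rule SUP_least) (use s in auto)
      also have "\<dots> < ereal \<epsilon>" using * s by simp
      finally show ?thesis .
    qed
  qed
  have "B T = {\<tau> \<in> {0..T}. (\<forall>s\<in>K. dom \<tau> s) \<and> (SUP s\<in>K. ereal (\<Delta> \<tau> s)) < ereal \<epsilon>}"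
    unfolding B_def dom_def \<Delta>_def ..
  also have "\<dots> = {0..T} \<inter> O2"
  proof (rule set_eqI)
    fix \<tau>
    have mem: "\<tau> \<in> O2 \<longleftrightarrow> (\<forall>s\<in>K. dom \<tau> s) \<and> (\<forall>s\<in>K. \<Delta> \<tau> s < \<epsilon>)"
      unfolding O2_def P_def D_def mem_Collect_eq fst_conv snd_conv by (rule ball_conj_distrib)
    show "\<tau> \<in> {\<tau> \<in> {0..T}. (\<forall>s\<in>K. dom \<tau> s) \<and> (SUP s\<in>K. ereal (\<Delta> \<tau> s)) < ereal \<epsilon>} \<longleftrightarrow> \<tau> \<in> {0..T} \<inter> O2"
    proof (cases "\<forall>s\<in>K. dom \<tau> s")
      case True
      show ?thesis unfolding Int_iff mem mem_Collect_eq sup[OF True] by (rule refl)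
    next
      case False
      thus ?thesis unfolding Int_iff mem mem_Collect_eq by (simp only: simp_thms)
    qed
  qed
  finally have BO: "B T = {0..T} \<inter> O2" .
  show "B T = {0..T} \<inter> {\<tau>. \<forall>s\<in>K. s + \<i> * of_real \<tau> \<in> log_zeta_dom \<and> s + \<i> * of_real (d * \<tau>) \<in> log_zeta_dom \<and>
           norm (log_zeta (s + \<i> * of_real \<tau>) - log_zeta (s + \<i> * of_real (d * \<tau>))) < \<epsilon>}"
    unfolding BO O2_def P_def D_def dom_def \<Delta>_def mem_Collect_eq fst_conv snd_conv conj_assoc by (rule refl)
  show "B T \<in> lmeasurable" unfolding BO
    by (rule fmeasurable_Int_fmeasurable) (use \<open>open O2\<close> in simp_all)
qed

section \<open>The weight and the main estimate\<close>

text \<open>Each factor is the square of the cosine of half the phase, to the power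
  \<open>m\<close>. It is nonnegative and so are its Fourier coefficients; the first makes it a
  weight, the second bounds its mean from below.\<close>

definition weight :: "nat set \<Rightarrow> nat \<Rightarrow> real \<Rightarrow> real \<Rightarrow> real" where
  "weight S m c \<tau> = (\<Prod>p\<in>S. ((1 + cos (c * \<tau> * ln (real p))) / 2) ^ m)"

text \<open>The binomial index \<open>k p\<close> runs from 0 to 2 m and is shifted by
  \<open>m\<close> to a symmetric range, so the constant index \<open>m\<close> belongs to frequency
  0.\<close>

definition weight_freq :: "nat set \<Rightarrow> nat \<Rightarrow> real \<Rightarrow> (nat \<Rightarrow> nat) \<Rightarrow> real" where
  "weight_freq S m c k = c * (\<Sum>p\<in>S. of_int (int (k p) - int m) * ln (real p))"

definition weight_coeff :: "nat set \<Rightarrow> nat \<Rightarrow> (nat \<Rightarrow> nat) \<Rightarrow> real" where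
  "weight_coeff S m k = (\<Prod>p\<in>S. real ((2 * m) choose (k p)) / 4 ^ m)"

lemma half_one_plus_cos_bounds:
  fixes \<theta> :: real
  shows "0 \<le> (1 + cos \<theta>) / 2" "(1 + cos \<theta>) / 2 \<le> 1"
proof -
  have "0 \<le> 1 + cos \<theta>" using cos_ge_minus_one[of \<theta>] by (rule real_0_le_add_iff[THEN iffD2])
  thus "0 \<le> (1 + cos \<theta>) / 2" by (rule divide_nonneg_nonneg) simp
  show "(1 + cos \<theta>) / 2 \<le> 1" by simp
qed

lemma weight_bounds: "0 \<le> weight S m c \<tau>" "weight S m c \<tau> \<le> 1"
proof -
  have "0 \<le> ((1 + cos \<theta>) / 2) ^ m \<and> ((1 + cos \<theta>) / 2) ^ m \<le> (1::real)" for \<theta>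
    by (intro conjI zero_le_power power_le_one half_one_plus_cos_bounds)
  thus "0 \<le> weight S m c \<tau>" "weight S m c \<tau> \<le> 1"
    unfolding weight_def by (auto intro!: prod_nonneg prod_le_1)
qed

lemma continuous_on_weight: "continuous_on A (weight S m c)"
  unfolding weight_def[abs_def] by (intro continuous_intros) auto

lemma weight_le_power:
  assumes "finite S" "p \<in> S" "(1 + cos (c * \<tau> * ln (real p))) / 2 \<le> \<kappa>"
  shows "weight S m c \<tau> \<le> \<kappa> ^ m"
proof -
  have b: "0 \<le> ((1 + cos \<theta>) / 2) ^ m \<and> ((1 + cos \<theta>) / 2) ^ m \<le> (1::real)" for \<theta>
    by (intro conjI zero_le_power power_le_one half_one_plus_cos_bounds)
  have "weight S m c \<tau> = ((1 + cos (c * \<tau> * ln (real p))) / 2) ^ m * (\<Prod>p\<in>S - {p}. ((1 + cos (c * \<tau> * ln (real p))) / 2) ^ m)"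
    unfolding weight_def by (rule prod.remove[OF assms(1,2)])
  also have "\<dots> \<le> ((1 + cos (c * \<tau> * ln (real p))) / 2) ^ m"
    using b by (intro mult_right_le_one_le prod_nonneg prod_le_1) auto
  also have "\<dots> \<le> \<kappa> ^ m" using assms(3) half_one_plus_cos_bounds by (intro power_mono)
  finally show ?thesis .
qed

text \<open>The binomial theorem, after writing (1 + cos \<theta>) / 2 as (cis \<theta> + 1)^2 cis
  (-\<theta>) / 4.\<close>

lemma cos_power_expansion:
  "complex_of_real (((1 + cos \<theta>) / 2) ^ m) = (\<Sum>j\<le>2 * m. of_real (real ((2 * m) choose j) / 4 ^ m) * cis (of_int (int j - int m) * \<theta>))"
proof -
  have base: "complex_of_real ((1 + cos \<theta>) / 2) = (cis \<theta> + 1)\<^sup>2 / 4 * cis (- \<theta>)"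
  proof -
    have "(cis \<theta> + 1)\<^sup>2 * cis (- \<theta>) = cis \<theta> * (cis \<theta> * cis (- \<theta>)) + 2 * (cis \<theta> * cis (- \<theta>)) + cis (- \<theta>)"
      by (simp add: power2_eq_square algebra_simps)
    also have "cis \<theta> * cis (- \<theta>) = 1" by (simp add: cis_mult)
    also have "cis \<theta> * 1 + 2 * 1 + cis (- \<theta>) = of_real (2 + 2 * cos \<theta>)" by (simp add: complex_eq_iff)
    finally show ?thesis by (simp add: field_simps)
  qed
  have "complex_of_real (((1 + cos \<theta>) / 2) ^ m) = ((cis \<theta> + 1)\<^sup>2 / 4 * cis (- \<theta>)) ^ m"
    by (simp only: of_real_power base)
  also have "\<dots> = (cis \<theta> + 1) ^ (2 * m) / 4 ^ m * cis (- (of_nat m * \<theta>))"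
  proof -
    have "cis (- \<theta>) ^ m = cis (- (of_nat m * \<theta>))" using Complex.DeMoivre[of "- \<theta>" m] by (simp only: mult_minus_right)
    thus ?thesis by (simp only: power_mult_distrib power_divide power_mult)
  qed
  also have "(cis \<theta> + 1) ^ (2 * m) = (\<Sum>j\<le>2 * m. of_nat ((2 * m) choose j) * cis \<theta> ^ j * 1 ^ (2 * m - j))"
    by (rule binomial_ring)
  also have "\<dots> / 4 ^ m * cis (- (of_nat m * \<theta>)) = (\<Sum>j\<le>2 * m. of_real (real ((2 * m) choose j) / 4 ^ m) * (cis (of_nat j * \<theta>) * cis (- (of_nat m * \<theta>))))"
    unfolding sum_divide_distrib sum_distrib_right
  proof (intro sum.cong refl)
    fix j
    show "of_nat ((2 * m) choose j) * cis \<theta> ^ j * 1 ^ (2 * m - j) / 4 ^ m * cis (- (of_nat m * \<theta>))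
      = of_real (real ((2 * m) choose j) / 4 ^ m) * (cis (of_nat j * \<theta>) * cis (- (of_nat m * \<theta>)))"
      unfolding Complex.DeMoivre by simp
  qed
  also have "\<dots> = (\<Sum>j\<le>2 * m. of_real (real ((2 * m) choose j) / 4 ^ m) * cis (of_int (int j - int m) * \<theta>))"
    by (intro sum.cong refl) (simp add: cis_mult algebra_simps)
  finally show ?thesis .
qed

lemma prod_cis: "(\<Prod>p\<in>S. cis (f p)) = cis (\<Sum>p\<in>S. f p)"
  by (induction S rule: infinite_finite_induct) (auto simp: cis_mult)

lemma weight_expansion:
  assumes "finite S"
  shows "complex_of_real (weight S m c \<tau>) = (\<Sum>k\<in>PiE S (\<lambda>_. {..2 * m}). of_real (weight_coeff S m k) * cis (weight_freq S m c k * \<tau>))"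
proof -
  have "complex_of_real (weight S m c \<tau>) = (\<Prod>p\<in>S. \<Sum>j\<le>2 * m. of_real (real ((2 * m) choose j) / 4 ^ m) * cis (of_int (int j - int m) * (c * \<tau> * ln (real p))))"
    unfolding weight_def of_real_prod cos_power_expansion ..
  also have "\<dots> = (\<Sum>k\<in>PiE S (\<lambda>_. {..2 * m}). \<Prod>p\<in>S. of_real (real ((2 * m) choose (k p)) / 4 ^ m) * cis (of_int (int (k p) - int m) * (c * \<tau> * ln (real p))))"
    using assms by (intro prod_sum_PiE) auto
  also have "\<dots> = (\<Sum>k\<in>PiE S (\<lambda>_. {..2 * m}). of_real (weight_coeff S m k) * cis (weight_freq S m c k * \<tau>))"
  proof (intro sum.cong refl)
    fix k
    have "(\<Sum>p\<in>S. of_int (int (k p) - int m) * (c * \<tau> * ln (real p))) = weight_freq S m c k * \<tau>"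
      by (simp add: weight_freq_def sum_distrib_left sum_distrib_right mult_ac)
    thus "(\<Prod>p\<in>S. of_real (real ((2 * m) choose (k p)) / 4 ^ m) * cis (of_int (int (k p) - int m) * (c * \<tau> * ln (real p))))
       = of_real (weight_coeff S m k) * cis (weight_freq S m c k * \<tau>)"
      by (simp only: prod.distrib prod_cis weight_coeff_def of_real_prod)
  qed
  finally show ?thesis .
qed

lemma integral_cis_bound:
  assumes "\<omega> \<noteq> 0" "T \<ge> 0"
  shows "cmod (integral {0..T} (\<lambda>\<tau>. cis (\<omega> * \<tau>))) \<le> 2 / \<bar>\<omega>\<bar>"
proof -
  define \<Phi> where "\<Phi> = (\<lambda>z. exp (\<i> * of_real \<omega> * z) / (\<i> * of_real \<omega>))"
  have der: "(\<Phi> has_field_derivative exp (\<i> * of_real \<omega> * z)) (at z)" for z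
    unfolding \<Phi>_def using assms by (auto intro!: derivative_eq_intros)
  have "((\<lambda>t. exp (\<i> * of_real \<omega> * of_real t)) has_integral (\<Phi> (of_real T) - \<Phi> (of_real 0))) {0..T}"
    using assms by (intro fundamental_theorem_of_calculus has_vector_derivative_real_field der) auto
  moreover have "exp (\<i> * of_real \<omega> * of_real t) = cis (\<omega> * t)" for t by (simp add: cis_conv_exp mult.assoc)
  ultimately have I: "integral {0..T} (\<lambda>\<tau>. cis (\<omega> * \<tau>)) = \<Phi> (of_real T) - \<Phi> (of_real 0)"
    by (intro integral_unique) simp
  have "cmod (\<Phi> (of_real u)) = 1 / \<bar>\<omega>\<bar>" for u by (simp add: \<Phi>_def norm_divide norm_mult)
  from this[of T] this[of 0] show ?thesis
    unfolding I using norm_triangle_ineq4[of "\<Phi> (of_real T)" "\<Phi> (of_real 0)"] by linarith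
qed

lemma integrable_trig:
  fixes T :: real
  shows "(\<lambda>\<tau>. cis (\<omega> * \<tau>)) integrable_on {0..T}"
  by (intro integrable_continuous_interval continuous_intros)

lemma integral_complex_of_real_eq:
  fixes f :: "real \<Rightarrow> real"
  assumes "f integrable_on A"
  shows "integral A (\<lambda>x. complex_of_real (f x)) = of_real (integral A f)"
  using has_integral_linear[OF integrable_integral[OF assms] bounded_linear_of_real[where 'a = complex]]
  by (intro integral_unique) (simp add: o_def)

text \<open>The diagonal n = n' gives the main term; all other terms integrate oscillations of
  nonzero frequency and stay bounded in T. One \<open>C0\<close> serves all coefficients b of
  modulus at most 1, as required when b n = n^(-z) with z varying in a rectangle.\<close>

lemma trig_weighted_mean_square:
  fixes W :: "real \<Rightarrow> real" and w \<mu> :: "'k \<Rightarrow> real" and l :: "'n \<Rightarrow> real"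
  assumes W: "\<And>\<tau>. complex_of_real (W \<tau>) = (\<Sum>k\<in>Kf. of_real (w k) * cis (\<mu> k * \<tau>))" and "finite Kf" "finite A"
    and Wc: "continuous_on UNIV W"
    and nonres: "\<And>k n n'. k \<in> Kf \<Longrightarrow> n \<in> A \<Longrightarrow> n' \<in> A \<Longrightarrow> n \<noteq> n' \<Longrightarrow> \<mu> k - (l n - l n') \<noteq> 0"
  shows "\<exists>C0\<ge>0. \<forall>T\<ge>0. \<forall>b. (\<forall>n\<in>A. cmod (b n) \<le> 1) \<longrightarrow>
    integral {0..T} (\<lambda>\<tau>. W \<tau> * (cmod (\<Sum>n\<in>A. b n * cis (- (l n * \<tau>))))\<^sup>2) \<le> (\<Sum>n\<in>A. (cmod (b n))\<^sup>2) * integral {0..T} W + C0"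
proof -
  define off where "off = (\<lambda>n n'. \<Sum>k\<in>Kf. \<bar>w k\<bar> * (2 / \<bar>\<mu> k - (l n - l n')\<bar>))"
  define C0 where "C0 = (\<Sum>n\<in>A. \<Sum>n'\<in>A - {n}. off n n')"
  have C0: "C0 \<ge> 0" unfolding C0_def off_def by (intro sum_nonneg mult_nonneg_nonneg) auto
  have Wc': "continuous_on {0..T} W" for T using Wc continuous_on_subset by blast
  have "integral {0..T} (\<lambda>\<tau>. W \<tau> * (cmod (\<Sum>n\<in>A. b n * cis (- (l n * \<tau>))))\<^sup>2) \<le> (\<Sum>n\<in>A. (cmod (b n))\<^sup>2) * integral {0..T} W + C0"
    if T: "T \<ge> 0" and b: "\<forall>n\<in>A. cmod (b n) \<le> 1" for T b
  proof -
    define J where "J = (\<lambda>n n'. integral {0..T} (\<lambda>\<tau>. complex_of_real (W \<tau>) * cis (- ((l n - l n') * \<tau>))))"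
    have Jint: "(\<lambda>\<tau>. complex_of_real (W \<tau>) * cis (- ((l n - l n') * \<tau>))) integrable_on {0..T}" for n n'
      by (intro integrable_continuous_interval continuous_intros Wc')
    have Jdiag: "J n n = of_real (integral {0..T} W)" for n
      unfolding J_def by (simp add: integral_complex_of_real_eq integrable_continuous_interval[OF Wc'])
    have Joff: "cmod (J n n') \<le> off n n'" if "n \<in> A" "n' \<in> A" "n \<noteq> n'" for n n'
    proof -
      have "J n n' = integral {0..T} (\<lambda>\<tau>. \<Sum>k\<in>Kf. of_real (w k) * cis ((\<mu> k - (l n - l n')) * \<tau>))"
        unfolding J_def W sum_distrib_right by (simp add: mult.assoc cis_mult algebra_simps)
      also have "\<dots> = (\<Sum>k\<in>Kf. integral {0..T} (\<lambda>\<tau>. of_real (w k) * cis ((\<mu> k - (l n - l n')) * \<tau>)))"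
        using assms by (intro integral_sum integrable_on_mult_right integrable_trig)
      also have "\<dots> = (\<Sum>k\<in>Kf. of_real (w k) * integral {0..T} (\<lambda>\<tau>. cis ((\<mu> k - (l n - l n')) * \<tau>)))" by simp
      also have "cmod \<dots> \<le> off n n'" unfolding off_def
      proof (rule sum_norm_le)
        fix k assume k: "k \<in> Kf"
        have "cmod (integral {0..T} (\<lambda>\<tau>. cis ((\<mu> k - (l n - l n')) * \<tau>))) \<le> 2 / \<bar>\<mu> k - (l n - l n')\<bar>"
          by (rule integral_cis_bound[OF nonres[OF k that] T])
        thus "cmod (of_real (w k) * integral {0..T} (\<lambda>\<tau>. cis ((\<mu> k - (l n - l n')) * \<tau>))) \<le> \<bar>w k\<bar> * (2 / \<bar>\<mu> k - (l n - l n')\<bar>)"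
          unfolding norm_mult norm_of_real by (rule mult_left_mono) simp
      qed
      finally show ?thesis .
    qed
    have pt: "complex_of_real (W \<tau> * (cmod (\<Sum>n\<in>A. b n * cis (- (l n * \<tau>))))\<^sup>2) =
        (\<Sum>n\<in>A. \<Sum>n'\<in>A. (b n * cnj (b n')) * (of_real (W \<tau>) * cis (- ((l n - l n') * \<tau>))))" for \<tau>
    proof -
      have "complex_of_real ((cmod (\<Sum>n\<in>A. b n * cis (- (l n * \<tau>))))\<^sup>2) = (\<Sum>n\<in>A. b n * cis (- (l n * \<tau>))) * (\<Sum>n'\<in>A. cnj (b n') * cis (l n' * \<tau>))"
        unfolding complex_norm_square by (simp add: cis_cnj)
      also have "\<dots> = (\<Sum>n\<in>A. \<Sum>n'\<in>A. (b n * cnj (b n')) * cis (- ((l n - l n') * \<tau>)))"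
        unfolding sum_product
      proof (intro sum.cong refl)
        fix n n'
        have "cis (- (l n * \<tau>)) * cis (l n' * \<tau>) = cis (- ((l n - l n') * \<tau>))" by (simp add: cis_mult algebra_simps)
        moreover have "b n * cis (- (l n * \<tau>)) * (cnj (b n') * cis (l n' * \<tau>)) = b n * cnj (b n') * (cis (- (l n * \<tau>)) * cis (l n' * \<tau>))"
          by (simp only: mult_ac)
        ultimately show "b n * cis (- (l n * \<tau>)) * (cnj (b n') * cis (l n' * \<tau>)) = b n * cnj (b n') * cis (- ((l n - l n') * \<tau>))"
          by (simp only:)
      qed
      finally have e: "complex_of_real ((cmod (\<Sum>n\<in>A. b n * cis (- (l n * \<tau>))))\<^sup>2) = (\<Sum>n\<in>A. \<Sum>n'\<in>A. (b n * cnj (b n')) * cis (- ((l n - l n') * \<tau>)))" .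
      show ?thesis unfolding of_real_mult e sum_distrib_left
        by (intro sum.cong refl) (simp only: mult_ac)
    qed
    have Dc: "(\<lambda>\<tau>. W \<tau> * (cmod (\<Sum>n\<in>A. b n * cis (- (l n * \<tau>))))\<^sup>2) integrable_on {0..T}"
      by (intro integrable_continuous_interval continuous_intros Wc')
    have "complex_of_real (integral {0..T} (\<lambda>\<tau>. W \<tau> * (cmod (\<Sum>n\<in>A. b n * cis (- (l n * \<tau>))))\<^sup>2))
        = integral {0..T} (\<lambda>\<tau>. complex_of_real (W \<tau> * (cmod (\<Sum>n\<in>A. b n * cis (- (l n * \<tau>))))\<^sup>2))"
      by (rule integral_complex_of_real_eq[OF Dc, symmetric])
    also have "\<dots> = (\<Sum>n\<in>A. \<Sum>n'\<in>A. (b n * cnj (b n')) * J n n')"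
    proof -
      have i1: "(\<lambda>\<tau>. (b n * cnj (b n')) * (of_real (W \<tau>) * cis (- ((l n - l n') * \<tau>)))) integrable_on {0..T}" for n n'
        by (intro integrable_on_mult_right Jint)
      have i2: "integral {0..T} (\<lambda>\<tau>. \<Sum>n'\<in>A. (b n * cnj (b n')) * (of_real (W \<tau>) * cis (- ((l n - l n') * \<tau>)))) = (\<Sum>n'\<in>A. (b n * cnj (b n')) * J n n')" for n
        unfolding J_def by (subst integral_sum[OF \<open>finite A\<close> i1]) simp
      have "integral {0..T} (\<lambda>\<tau>. \<Sum>n\<in>A. \<Sum>n'\<in>A. (b n * cnj (b n')) * (of_real (W \<tau>) * cis (- ((l n - l n') * \<tau>))))
         = (\<Sum>n\<in>A. integral {0..T} (\<lambda>\<tau>. \<Sum>n'\<in>A. (b n * cnj (b n')) * (of_real (W \<tau>) * cis (- ((l n - l n') * \<tau>)))))"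
        by (intro integral_sum integrable_sum i1 \<open>finite A\<close>)
      thus ?thesis unfolding pt i2 .
    qed
    also have "\<dots> = (\<Sum>n\<in>A. (b n * cnj (b n)) * J n n + (\<Sum>n'\<in>A - {n}. (b n * cnj (b n')) * J n n'))"
      using assms by (intro sum.cong refl sum.remove) auto
    also have "\<dots> = of_real ((\<Sum>n\<in>A. (cmod (b n))\<^sup>2) * integral {0..T} W) + (\<Sum>n\<in>A. \<Sum>n'\<in>A - {n}. (b n * cnj (b n')) * J n n')"
      unfolding sum.distrib Jdiag complex_norm_square[symmetric] by (simp add: sum_distrib_right)
    finally have eq: "complex_of_real (integral {0..T} (\<lambda>\<tau>. W \<tau> * (cmod (\<Sum>n\<in>A. b n * cis (- (l n * \<tau>))))\<^sup>2) - (\<Sum>n\<in>A. (cmod (b n))\<^sup>2) * integral {0..T} W)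
       = (\<Sum>n\<in>A. \<Sum>n'\<in>A - {n}. (b n * cnj (b n')) * J n n')" by (simp add: algebra_simps)
    have "cmod (\<Sum>n\<in>A. \<Sum>n'\<in>A - {n}. (b n * cnj (b n')) * J n n') \<le> C0"
      unfolding C0_def
    proof (intro sum_norm_le)
      fix n n' assume n: "n \<in> A" "n' \<in> A - {n}"
      have "cmod (b n) * cmod (b n') \<le> 1 * 1" using b n by (intro mult_mono) auto
      hence "cmod (b n * cnj (b n')) * cmod (J n n') \<le> 1 * off n n'"
        using Joff[of n n'] n by (intro mult_mono) (auto simp: norm_mult)
      thus "cmod (b n * cnj (b n') * J n n') \<le> off n n'" by (simp add: norm_mult)
    qed
    hence "cmod (complex_of_real (integral {0..T} (\<lambda>\<tau>. W \<tau> * (cmod (\<Sum>n\<in>A. b n * cis (- (l n * \<tau>))))\<^sup>2) - (\<Sum>n\<in>A. (cmod (b n))\<^sup>2) * integral {0..T} W)) \<le> C0"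
      unfolding eq .
    hence "\<bar>integral {0..T} (\<lambda>\<tau>. W \<tau> * (cmod (\<Sum>n\<in>A. b n * cis (- (l n * \<tau>))))\<^sup>2) - (\<Sum>n\<in>A. (cmod (b n))\<^sup>2) * integral {0..T} W\<bar> \<le> C0"
      by (simp only: norm_of_real)
    thus ?thesis by linarith
  qed
  thus ?thesis using C0 by blast
qed

text \<open>The mean of W is the sum of its coefficients at frequency 0. None is negative, so a
  single one is a lower bound, even if further frequencies vanish, as for d = 1.\<close>

lemma trig_mean_lower:
  fixes W :: "real \<Rightarrow> real" and w \<mu> :: "'k \<Rightarrow> real"
  assumes W: "\<And>\<tau>. complex_of_real (W \<tau>) = (\<Sum>k\<in>Kf. of_real (w k) * cis (\<mu> k * \<tau>))" and "finite Kf"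
    and Wc: "continuous_on UNIV W" and w: "\<And>k. k \<in> Kf \<Longrightarrow> w k \<ge> 0" and k0: "k0 \<in> Kf" "\<mu> k0 = 0"
  shows "\<exists>C1. \<forall>T\<ge>0. w k0 * T - C1 \<le> integral {0..T} W"
proof -
  define C1 where "C1 = (\<Sum>k\<in>Kf. w k * (2 / \<bar>\<mu> k\<bar>))"
  have "w k0 * T - C1 \<le> integral {0..T} W" if T: "T \<ge> 0" for T
  proof -
    have Wi: "W integrable_on {0..T}" using Wc continuous_on_subset by (intro integrable_continuous_interval) blast
    have "complex_of_real (integral {0..T} W) = integral {0..T} (\<lambda>\<tau>. complex_of_real (W \<tau>))"
      by (rule integral_complex_of_real_eq[OF Wi, symmetric])
    also have "\<dots> = (\<Sum>k\<in>Kf. integral {0..T} (\<lambda>\<tau>. of_real (w k) * cis (\<mu> k * \<tau>)))"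
      unfolding W using assms by (intro integral_sum integrable_on_mult_right integrable_trig)
    finally have "complex_of_real (integral {0..T} W) = (\<Sum>k\<in>Kf. of_real (w k) * integral {0..T} (\<lambda>\<tau>. cis (\<mu> k * \<tau>)))" by simp
    hence "Re (complex_of_real (integral {0..T} W)) = Re (\<Sum>k\<in>Kf. of_real (w k) * integral {0..T} (\<lambda>\<tau>. cis (\<mu> k * \<tau>)))" by (rule arg_cong)
    hence I: "integral {0..T} W = (\<Sum>k\<in>Kf. w k * Re (integral {0..T} (\<lambda>\<tau>. cis (\<mu> k * \<tau>))))" by simp
    have le: "(if \<mu> k = 0 then w k * T else 0) - w k * (2 / \<bar>\<mu> k\<bar>) \<le> w k * Re (integral {0..T} (\<lambda>\<tau>. cis (\<mu> k * \<tau>)))" if k: "k \<in> Kf" for k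
    proof (cases "\<mu> k = 0")
      case True
      have "integral {0..T} (\<lambda>\<tau>. cis (\<mu> k * \<tau>)) = of_real T" using T True by (simp add: scaleR_conv_of_real)
      thus ?thesis using True by simp
    next
      case False
      have "\<bar>Re (integral {0..T} (\<lambda>\<tau>. cis (\<mu> k * \<tau>)))\<bar> \<le> 2 / \<bar>\<mu> k\<bar>"
        using abs_Re_le_cmod integral_cis_bound[OF False T] by (rule order_trans)
      hence "- (2 / \<bar>\<mu> k\<bar>) \<le> Re (integral {0..T} (\<lambda>\<tau>. cis (\<mu> k * \<tau>)))" by linarith
      hence "w k * (- (2 / \<bar>\<mu> k\<bar>)) \<le> w k * Re (integral {0..T} (\<lambda>\<tau>. cis (\<mu> k * \<tau>)))" by (rule mult_left_mono) (rule w[OF k])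
      thus ?thesis using False by simp
    qed
    have "w k0 * T = (\<Sum>k\<in>{k0}. if \<mu> k = 0 then w k * T else 0)" using k0 by simp
    also have "\<dots> \<le> (\<Sum>k\<in>Kf. if \<mu> k = 0 then w k * T else 0)"
      using assms T by (intro sum_mono2) auto
    finally have "w k0 * T - C1 \<le> (\<Sum>k\<in>Kf. (if \<mu> k = 0 then w k * T else 0) - w k * (2 / \<bar>\<mu> k\<bar>))"
      unfolding sum_subtractf C1_def by simp
    also have "\<dots> \<le> integral {0..T} W" unfolding I by (intro sum_mono le)
    finally show ?thesis .
  qed
  thus ?thesis by blast
qed

text \<open>The central binomial coefficient is at least 4^m / (2 m), so the right-hand side decays
  at most like m^(-n), the left-hand side exponentially.\<close>

lemma exists_weight_exponent:
  fixes \<kappa> :: real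
  assumes \<kappa>: "0 < \<kappa>" "\<kappa> < 1"
  shows "\<exists>m\<ge>1. \<kappa> ^ m \<le> 1 / 8 * (real ((2 * m) choose m) / 4 ^ m) ^ n"
proof -
  define b where "b = - ln \<kappa>"
  have b: "b > 0" using \<kappa> by (simp add: b_def)
  have "filterlim (\<lambda>m::nat. b * real m) at_top sequentially"
    using b by (intro filterlim_tendsto_pos_mult_at_top[OF tendsto_const _ filterlim_real_sequentially])
  from filterlim_compose[OF tendsto_power_div_exp_0[of n] this]
  have "(\<lambda>m. (b * real m) ^ n / exp (b * real m)) \<longlonglongrightarrow> 0" .
  hence "\<forall>\<^sub>F m in sequentially. (b * real m) ^ n / exp (b * real m) < b ^ n / (8 * 2 ^ n)"
    using b by (intro order_tendstoD) auto
  hence "\<forall>\<^sub>F m in sequentially. (b * real m) ^ n / exp (b * real m) < b ^ n / (8 * 2 ^ n) \<and> m \<ge> 1"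
    using eventually_ge_at_top[of 1] by (rule eventually_conj)
  then obtain m where m: "(b * real m) ^ n / exp (b * real m) < b ^ n / (8 * 2 ^ n)" "m \<ge> 1"
    by (auto dest!: eventually_happens)
  have "\<kappa> ^ m = exp (- (b * real m))"
  proof -
    have "- (b * real m) = real m * ln \<kappa>" by (simp add: b_def)
    thus ?thesis using \<kappa> by (simp only: exp_of_nat_mult exp_ln)
  qed
  also have "\<dots> = 1 / exp (b * real m)" by (simp add: exp_minus divide_inverse)
  also have "\<dots> \<le> 1 / (8 * (2 * real m) ^ n)"
  proof -
    have "b ^ n * real m ^ n / exp (b * real m) < b ^ n / (8 * 2 ^ n)" using m by (simp add: power_mult_distrib)
    hence "real m ^ n / exp (b * real m) < 1 / (8 * 2 ^ n)" using b by (simp add: field_simps)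
    thus ?thesis using m(2) by (simp add: field_simps power_mult_distrib)
  qed
  also have "\<dots> = 1 / 8 * (1 / (2 * real m)) ^ n" by (simp add: power_divide)
  also have "\<dots> \<le> 1 / 8 * (real ((2 * m) choose m) / 4 ^ m) ^ n"
  proof (intro mult_left_mono power_mono)
    have "4 ^ m / (2 * real m) \<le> real ((2 * m) choose m)" using m by (intro central_binomial_lower_bound) simp
    thus "1 / (2 * real m) \<le> real ((2 * m) choose m) / 4 ^ m" by (simp add: field_simps)
  qed auto
  finally show ?thesis using m(2) by blast
qed

section \<open>From the weight to a set of shifts of positive density\<close>

lemma compact_strip_bounds:
  fixes K :: "complex set"
  assumes "compact K" "K \<subseteq> {s. 1 / 2 < Re s \<and> Re s < 1}"
  shows "\<exists>\<sigma>1 H. 1 / 2 < \<sigma>1 \<and> \<sigma>1 < 1 \<and> H > 0 \<and> (\<forall>s\<in>K. \<sigma>1 < Re s \<and> \<bar>Im s\<bar> < H)"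
proof (cases "K = {}")
  case True
  thus ?thesis by (intro exI[of _ "3 / 4"] exI[of _ 1]) auto
next
  case False
  have "continuous_on K Re" by (intro continuous_intros)
  from continuous_attains_inf[OF assms(1) False this] obtain s0 where s0: "s0 \<in> K" "\<forall>s\<in>K. Re s0 \<le> Re s" by blast
  have r0: "1 / 2 < Re s0" "Re s0 < 1" using s0(1) assms(2) by auto
  obtain B where B: "\<forall>s\<in>K. norm s \<le> B" using compact_imp_bounded[OF assms(1)] bounded_iff by blast
  define \<sigma>1 where "\<sigma>1 = (1 / 2 + Re s0) / 2"
  have \<sigma>1: "1 / 2 < \<sigma>1" "\<sigma>1 < Re s0" using r0 by (auto simp: \<sigma>1_def)
  have "\<sigma>1 < Re s \<and> \<bar>Im s\<bar> < \<bar>B\<bar> + 1" if s: "s \<in> K" for s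
  proof
    show "\<sigma>1 < Re s" using s0(2) s \<sigma>1(2) by fastforce
    have "norm s \<le> B" using B s by blast
    thus "\<bar>Im s\<bar> < \<bar>B\<bar> + 1" using abs_Im_le_cmod[of s] by linarith
  qed
  moreover have "\<sigma>1 < 1" using \<sigma>1 r0 by linarith
  ultimately show ?thesis using \<sigma>1(1) by (intro exI[of _ \<sigma>1] exI[of _ "\<bar>B\<bar> + 1"]) simp
qed

text \<open>Substitution t = e y + |\<rho>| \<tau>. The sign e reflects the line if \<rho> < 0, so
  that both signs of d lead to integrals from 1 upwards.\<close>

lemma affine_shift_integral_le:
  fixes h :: "real \<Rightarrow> real" and e y \<rho> T1 T :: real
  assumes \<rho>: "\<rho> \<noteq> 0" and e: "e = sgn \<rho>" and T: "T1 \<le> T" and ge1: "e * y + \<bar>\<rho>\<bar> * T1 \<ge> 1"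
    and cont: "\<And>X. continuous_on {1..X} (\<lambda>t. h (e * t))" and nn: "\<And>t. h t \<ge> 0"
  shows "integral {T1..T} (\<lambda>\<tau>. h (y + \<rho> * \<tau>)) \<le> 1 / \<bar>\<rho>\<bar> * integral {1..e * y + \<bar>\<rho>\<bar> * T} (\<lambda>t. h (e * t))"
proof -
  define g where "g = (\<lambda>\<tau>. e * y + \<bar>\<rho>\<bar> * \<tau>)"
  have ee: "e * e = 1" "e * \<bar>\<rho>\<bar> = \<rho>" using \<rho> e by (auto simp: sgn_if)
  have gh: "e * g \<tau> = y + \<rho> * \<tau>" for \<tau>
  proof -
    have "e * g \<tau> = (e * e) * y + (e * \<bar>\<rho>\<bar>) * \<tau>" by (simp add: g_def algebra_simps)
    thus ?thesis unfolding ee by simp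
  qed
  have g1: "1 \<le> g T1" "g T1 \<le> g T" using ge1 T by (auto simp: g_def mult_left_mono)
  have "((\<lambda>\<tau>. \<bar>\<rho>\<bar> *\<^sub>R h (e * g \<tau>)) has_integral (integral {g T1..g T} (\<lambda>t. h (e * t)))) {T1..T}"
  proof (rule has_integral_substitution[OF T g1(2), where c = 1 and d = "g T"])
    show "g ` {T1..T} \<subseteq> {1..g T}"
    proof
      fix u assume "u \<in> g ` {T1..T}"
      then obtain \<tau> where \<tau>: "u = g \<tau>" "T1 \<le> \<tau>" "\<tau> \<le> T" by auto
      have "\<bar>\<rho>\<bar> * T1 \<le> \<bar>\<rho>\<bar> * \<tau>" "\<bar>\<rho>\<bar> * \<tau> \<le> \<bar>\<rho>\<bar> * T" using \<tau> by (auto intro: mult_left_mono)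
      thus "u \<in> {1..g T}" using g1 \<tau> by (simp add: g_def)
    qed
    show "continuous_on {1..g T} (\<lambda>t. h (e * t))" by (rule cont)
    show "(g has_field_derivative \<bar>\<rho>\<bar>) (at x within {T1..T})" for x
      unfolding g_def by (auto intro!: derivative_eq_intros)
  qed
  hence "integral {T1..T} (\<lambda>\<tau>. \<bar>\<rho>\<bar> *\<^sub>R h (e * g \<tau>)) = integral {g T1..g T} (\<lambda>t. h (e * t))" by (rule integral_unique)
  hence "\<bar>\<rho>\<bar> * integral {T1..T} (\<lambda>\<tau>. h (y + \<rho> * \<tau>)) = integral {g T1..g T} (\<lambda>t. h (e * t))" unfolding gh by simp
  also have "\<dots> \<le> integral {1..g T} (\<lambda>t. h (e * t))"
  proof (rule integral_subset_le)
    show "{g T1..g T} \<subseteq> {1..g T}" using g1 by auto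
    show "(\<lambda>t. h (e * t)) integrable_on {1..g T}" by (intro integrable_continuous_interval cont)
    show "(\<lambda>t. h (e * t)) integrable_on {g T1..g T}"
      by (intro integrable_continuous_interval continuous_on_subset[OF cont[of "g T"]]) (use g1 in auto)
  qed (use nn in auto)
  finally show ?thesis using \<rho> by (simp add: g_def field_simps)
qed

lemma continuous_on_sieve_error:
  assumes "\<And>p. p \<in> S \<Longrightarrow> prime p"
  shows "continuous_on (-{1}) (sieve_error S Y)"
  unfolding sieve_error_def[abs_def] sieved_sum_def
  by (intro continuous_intros holomorphic_on_imp_continuous_on[OF holomorphic_zeta]
        holomorphic_on_imp_continuous_on[OF holomorphic_euler_factor] holomorphic_on_imp_continuous_on[OF holomorphic_nat_powr])
     (use assms in auto)

text \<open>\<open>F\<close> is the sieved Dirichlet polynomial without its term 1, plus the sieve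
  error. On the polynomial the weight acts as its mean; for the error only W \<le> 1 is available,
  and its unweighted mean square is made small. \<open>C0\<close> and \<open>T2\<close> are chosen
  before z.\<close>

lemma weighted_tail_estimate:
  fixes \<sigma>0 \<rho> B c T1 \<eta> :: real and N m :: nat
  defines "S \<equiv> primes_upto N"
  defines "W \<equiv> weight S m c"
  defines "F \<equiv> (\<lambda>s. zeta s * euler_factor S s - 1)"
  assumes \<sigma>0: "1 / 2 < \<sigma>0" "\<sigma>0 < 1" and \<rho>: "\<rho> \<noteq> 0" and B: "B \<ge> 0" and \<eta>: "\<eta> > 0" and T1: "T1 \<ge> 0" "\<bar>\<rho>\<bar> * T1 \<ge> B + 1"
    and nonres: "\<And>k n n'. n > 0 \<Longrightarrow> n' > 0 \<Longrightarrow> sieved S n \<Longrightarrow> sieved S n' \<Longrightarrow> weight_freq S m c k = \<rho> * (ln (real n) - ln (real n')) \<Longrightarrow> n = n'"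
  shows "\<exists>C0 T2. \<forall>T\<ge>T2. \<forall>z. \<sigma>0 \<le> Re z \<longrightarrow> Re z \<le> 3 \<longrightarrow> \<bar>Im z\<bar> \<le> B \<longrightarrow>
    integral {T1..T} (\<lambda>\<tau>. W \<tau> * (cmod (F (z + \<i> * of_real (\<rho> * \<tau>))))\<^sup>2)
      \<le> 2 * (\<Sum>n. real (n + Suc N) powr (- (2 * \<sigma>0))) * integral {0..T} W + C0 + \<eta> * T"
proof -
  have S: "finite S" "\<And>p. p \<in> S \<Longrightarrow> prime p" by (auto simp: S_def)
  define tail where "tail = (\<Sum>n. real (n + Suc N) powr (- (2 * \<sigma>0)))"
  define e where "e = sgn \<rho>"
  have e: "e = 1 \<or> e = -1" using \<rho> by (auto simp: e_def sgn_if)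
  \<comment> \<open>The shift by Im z at most doubles the length |\<rho>| T, and the square of the
    sum costs another factor 2, which leaves \<eta> / 2.\<close>
  have "\<eta> / 8 > 0" using \<eta> by simp
  from sieve_error_mean_square[OF S \<sigma>0 this] obtain Y0 where Y0: "\<forall>Y\<ge>Y0. \<exists>T0. \<forall>T\<ge>T0. \<forall>\<sigma> e. \<sigma>0 \<le> \<sigma> \<longrightarrow> \<sigma> \<le> 3 \<longrightarrow> e = 1 \<or> e = -1 \<longrightarrow>
    integral {1..T} (\<lambda>t. (cmod (sieve_error S Y (Complex \<sigma> (e * t))))\<^sup>2) \<le> \<eta> / 8 * T" by blast
  define Y where "Y = max Y0 2"
  have Y: "Y \<ge> Y0" "Y > 1" by (auto simp: Y_def)
  from Y0 Y(1) obtain T0 where T0: "\<forall>T\<ge>T0. \<forall>\<sigma> e. \<sigma>0 \<le> \<sigma> \<longrightarrow> \<sigma> \<le> 3 \<longrightarrow> e = 1 \<or> e = -1 \<longrightarrow>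
    integral {1..T} (\<lambda>t. (cmod (sieve_error S Y (Complex \<sigma> (e * t))))\<^sup>2) \<le> \<eta> / 8 * T" by blast
  define A where "A = {n. n > 1 \<and> real n < Y \<and> sieved S n}"
  have finA: "finite A" unfolding A_def by (rule finite_subset[OF _ finite_nat_below[of Y "\<lambda>_. True"]]) auto
  define Kf where "Kf = PiE S (\<lambda>_. {..2 * m})"
  have finK: "finite Kf" unfolding Kf_def using S by (intro finite_PiE) auto
  have Wexp: "complex_of_real (W \<tau>) = (\<Sum>k\<in>Kf. of_real (weight_coeff S m k) * cis (weight_freq S m c k * \<tau>))" for \<tau>
    unfolding W_def Kf_def by (rule weight_expansion[OF S(1)])
  have Wc: "continuous_on X W" for X unfolding W_def by (rule continuous_on_weight)
  have W01: "0 \<le> W \<tau>" "W \<tau> \<le> 1" for \<tau> unfolding W_def by (rule weight_bounds)+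
  have "\<exists>C0\<ge>0. \<forall>T\<ge>0. \<forall>b. (\<forall>n\<in>A. cmod (b n) \<le> 1) \<longrightarrow>
    integral {0..T} (\<lambda>\<tau>. W \<tau> * (cmod (\<Sum>n\<in>A. b n * cis (- (\<rho> * ln (real n) * \<tau>))))\<^sup>2) \<le> (\<Sum>n\<in>A. (cmod (b n))\<^sup>2) * integral {0..T} W + C0"
  proof (rule trig_weighted_mean_square[OF Wexp finK finA Wc])
    fix k n n' assume n: "n \<in> A" "n' \<in> A" "n \<noteq> n'"
    show "weight_freq S m c k - (\<rho> * ln (real n) - \<rho> * ln (real n')) \<noteq> 0"
    proof
      assume "weight_freq S m c k - (\<rho> * ln (real n) - \<rho> * ln (real n')) = 0"
      hence "weight_freq S m c k = \<rho> * (ln (real n) - ln (real n'))" by (simp add: algebra_simps)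
      hence "n = n'" using n by (intro nonres[of n n' k]) (auto simp: A_def)
      thus False using n(3) by contradiction
    qed
  qed
  then obtain C0 where C0: "C0 \<ge> 0" "\<forall>T\<ge>0. \<forall>b. (\<forall>n\<in>A. cmod (b n) \<le> 1) \<longrightarrow>
    integral {0..T} (\<lambda>\<tau>. W \<tau> * (cmod (\<Sum>n\<in>A. b n * cis (- (\<rho> * ln (real n) * \<tau>))))\<^sup>2) \<le> (\<Sum>n\<in>A. (cmod (b n))\<^sup>2) * integral {0..T} W + C0"
    by (elim exE conjE)
  define T2 where "T2 = max T1 ((\<bar>T0\<bar> + B) / \<bar>\<rho>\<bar>)"
  have main: "integral {T1..T} (\<lambda>\<tau>. W \<tau> * (cmod (F (z + \<i> * of_real (\<rho> * \<tau>))))\<^sup>2) \<le> 2 * tail * integral {0..T} W + 2 * C0 + \<eta> * T"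
    if T: "T \<ge> T2" and z: "\<sigma>0 \<le> Re z" "Re z \<le> 3" "\<bar>Im z\<bar> \<le> B" for T z
  proof -
    have TT: "T1 \<le> T" "0 \<le> T" "\<bar>T0\<bar> + B \<le> \<bar>\<rho>\<bar> * T" using T T1 \<rho> by (auto simp: T2_def field_simps)
    define s where "s = (\<lambda>\<tau>. z + \<i> * of_real (\<rho> * \<tau>))"
    have s1: "s \<tau> \<in> -{1}" if "\<tau> \<in> {T1..T}" for \<tau>
    proof -
      have "\<bar>\<rho>\<bar> * T1 \<le> \<bar>\<rho>\<bar> * \<tau>" using that by (intro mult_left_mono) auto
      moreover have "\<bar>\<rho> * \<tau>\<bar> = \<bar>\<rho>\<bar> * \<tau>" using that T1 by (simp add: abs_mult)
      ultimately have "Im z + \<rho> * \<tau> \<noteq> 0" using z(3) T1(2) by linarith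
      hence "Im (s \<tau>) \<noteq> Im 1" by (simp add: s_def)
      thus ?thesis by auto
    qed
    have sc: "continuous_on X s" for X unfolding s_def by (intro continuous_intros)
    define E where "E = (\<lambda>\<tau>. sieve_error S Y (s \<tau>))"
    define b where "b = (\<lambda>n. of_nat n powr (-z))"
    define D where "D = (\<lambda>\<tau>. \<Sum>n\<in>A. b n * cis (- (\<rho> * ln (real n) * \<tau>)))"
    have n1: "n \<ge> 1" "real n \<ge> 1" if "n \<in> A" for n using that by (auto simp: A_def)
    have FDE: "F (s \<tau>) = D \<tau> + E \<tau>" for \<tau>
    proof -
      have "D \<tau> = (\<Sum>n\<in>A. of_nat n powr (- s \<tau>))"
        unfolding D_def
      proof (intro sum.cong refl)
        fix n assume n: "n \<in> A"
        show "b n * cis (- (\<rho> * ln (real n) * \<tau>)) = of_nat n powr (- s \<tau>)"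
          unfolding b_def s_def nat_powr_exp[OF n1(1)[OF n]] cis_conv_exp by (simp add: algebra_simps flip: exp_add)
      qed
      moreover have "sieved_sum S Y (s \<tau>) = 1 + (\<Sum>n\<in>A. of_nat n powr (- s \<tau>))"
        unfolding S_def A_def by (rule sieved_sum_split_1[OF Y(2)])
      ultimately show ?thesis by (simp add: F_def E_def sieve_error_def)
    qed
    have Ec: "continuous_on {T1..T} E" unfolding E_def
      by (rule continuous_on_compose2[OF continuous_on_sieve_error[OF S(2)] sc]) (use s1 in auto)
    have Dc: "continuous_on X D" for X unfolding D_def by (intro continuous_intros)
    have bn: "cmod (b n) \<le> 1" "(cmod (b n))\<^sup>2 \<le> real n powr (- (2 * \<sigma>0))" if "n \<in> A" for n
    proof -
      have "real n powr (- Re z) \<le> real n powr 0" using n1[OF that] z \<sigma>0 by (intro powr_mono) auto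
      thus "cmod (b n) \<le> 1" using n1[OF that] by (simp add: b_def)
      have "(cmod (b n))\<^sup>2 = real n powr (- (2 * Re z))" by (simp add: b_def power2_eq_square flip: powr_add)
      also have "\<dots> \<le> real n powr (- (2 * \<sigma>0))" using n1[OF that] z by (intro powr_mono) auto
      finally show "(cmod (b n))\<^sup>2 \<le> real n powr (- (2 * \<sigma>0))" .
    qed
    have IW0: "integral {0..T} W \<ge> 0" using W01 by (intro integral_nonneg integrable_continuous_interval Wc) auto
    have "integral {T1..T} (\<lambda>\<tau>. W \<tau> * (cmod (F (s \<tau>)))\<^sup>2) \<le> integral {T1..T} (\<lambda>\<tau>. 2 * (W \<tau> * (cmod (D \<tau>))\<^sup>2) + 2 * (cmod (E \<tau>))\<^sup>2)"
    proof (rule integral_le)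
      show "(\<lambda>\<tau>. W \<tau> * (cmod (F (s \<tau>)))\<^sup>2) integrable_on {T1..T}"
        unfolding FDE by (intro integrable_continuous_interval continuous_intros Wc Dc Ec)
      show "(\<lambda>\<tau>. 2 * (W \<tau> * (cmod (D \<tau>))\<^sup>2) + 2 * (cmod (E \<tau>))\<^sup>2) integrable_on {T1..T}"
        by (intro integrable_continuous_interval continuous_intros Wc Dc Ec)
      fix \<tau>
      have "(cmod (D \<tau> + E \<tau>))\<^sup>2 \<le> (cmod (D \<tau>) + cmod (E \<tau>))\<^sup>2" by (intro power_mono norm_triangle_ineq) auto
      also have "\<dots> \<le> 2 * (cmod (D \<tau>))\<^sup>2 + 2 * (cmod (E \<tau>))\<^sup>2"
        using sum_squares_bound[of "cmod (D \<tau>)" "cmod (E \<tau>)"] by (simp add: power2_sum)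
      finally have "W \<tau> * (cmod (D \<tau> + E \<tau>))\<^sup>2 \<le> W \<tau> * (2 * (cmod (D \<tau>))\<^sup>2 + 2 * (cmod (E \<tau>))\<^sup>2)"
        by (rule mult_left_mono) (rule W01)
      also have "\<dots> = 2 * (W \<tau> * (cmod (D \<tau>))\<^sup>2) + W \<tau> * (2 * (cmod (E \<tau>))\<^sup>2)" by (simp add: algebra_simps)
      also have "\<dots> \<le> 2 * (W \<tau> * (cmod (D \<tau>))\<^sup>2) + 1 * (2 * (cmod (E \<tau>))\<^sup>2)"
        using W01 by (intro add_left_mono mult_right_mono) auto
      finally show "W \<tau> * (cmod (F (s \<tau>)))\<^sup>2 \<le> 2 * (W \<tau> * (cmod (D \<tau>))\<^sup>2) + 2 * (cmod (E \<tau>))\<^sup>2" unfolding FDE by simp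
    qed
    also have "\<dots> = 2 * integral {T1..T} (\<lambda>\<tau>. W \<tau> * (cmod (D \<tau>))\<^sup>2) + 2 * integral {T1..T} (\<lambda>\<tau>. (cmod (E \<tau>))\<^sup>2)"
    proof -
      have "(\<lambda>\<tau>. 2 * (W \<tau> * (cmod (D \<tau>))\<^sup>2)) integrable_on {T1..T}" "(\<lambda>\<tau>. 2 * (cmod (E \<tau>))\<^sup>2) integrable_on {T1..T}"
        by (intro integrable_continuous_interval continuous_intros Wc Dc Ec)+
      from integral_add[OF this] show ?thesis by simp
    qed
    also have "integral {T1..T} (\<lambda>\<tau>. W \<tau> * (cmod (D \<tau>))\<^sup>2) \<le> tail * integral {0..T} W + C0"
    proof -
      have "integral {T1..T} (\<lambda>\<tau>. W \<tau> * (cmod (D \<tau>))\<^sup>2) \<le> integral {0..T} (\<lambda>\<tau>. W \<tau> * (cmod (D \<tau>))\<^sup>2)"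
      proof (rule integral_subset_le)
        show "{T1..T} \<subseteq> {0..T}" using T1 by auto
        show "(\<lambda>\<tau>. W \<tau> * (cmod (D \<tau>))\<^sup>2) integrable_on {T1..T}" "(\<lambda>\<tau>. W \<tau> * (cmod (D \<tau>))\<^sup>2) integrable_on {0..T}"
          by (intro integrable_continuous_interval continuous_intros Wc Dc)+
      qed (use W01 in auto)
      also have "\<dots> \<le> (\<Sum>n\<in>A. (cmod (b n))\<^sup>2) * integral {0..T} W + C0"
        using C0(2) TT(2) bn(1) unfolding D_def by blast
      also have "(\<Sum>n\<in>A. (cmod (b n))\<^sup>2) \<le> tail"
      proof -
        have "(\<Sum>n\<in>A. (cmod (b n))\<^sup>2) \<le> (\<Sum>n\<in>A. real n powr (- (2 * \<sigma>0)))" by (intro sum_mono bn(2))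
        also have "\<dots> \<le> tail" unfolding A_def S_def tail_def using \<sigma>0 by (intro sum_sieved_powr_le) auto
        finally show ?thesis .
      qed
      finally show ?thesis using IW0 by (simp add: mult_right_mono)
    qed
    also have "integral {T1..T} (\<lambda>\<tau>. (cmod (E \<tau>))\<^sup>2) \<le> \<eta> / 4 * T"
    proof -
      define h where "h = (\<lambda>t. (cmod (sieve_error S Y (Complex (Re z) t)))\<^sup>2)"
      have eIm: "\<bar>e * Im z\<bar> \<le> B" using e z(3) by auto
      have "(cmod (E \<tau>))\<^sup>2 = h (Im z + \<rho> * \<tau>)" for \<tau>
      proof -
        have "s \<tau> = Complex (Re z) (Im z + \<rho> * \<tau>)" by (simp add: s_def complex_eq_iff)
        thus ?thesis by (simp add: E_def h_def)
      qed
      hence "integral {T1..T} (\<lambda>\<tau>. (cmod (E \<tau>))\<^sup>2) = integral {T1..T} (\<lambda>\<tau>. h (Im z + \<rho> * \<tau>))" by simp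
      also have "\<dots> \<le> 1 / \<bar>\<rho>\<bar> * integral {1..e * Im z + \<bar>\<rho>\<bar> * T} (\<lambda>t. h (e * t))"
      proof (rule affine_shift_integral_le[OF \<rho> e_def TT(1)])
        show "1 \<le> e * Im z + \<bar>\<rho>\<bar> * T1" using eIm T1(2) by linarith
        show "continuous_on {1..X} (\<lambda>t. h (e * t))" for X
          unfolding h_def using e by (intro continuous_intros continuous_on_sieve_error_vertical S) auto
      qed (simp add: h_def)
      also have "\<dots> \<le> 1 / \<bar>\<rho>\<bar> * (\<eta> / 8 * (e * Im z + \<bar>\<rho>\<bar> * T))"
      proof (rule mult_left_mono)
        have "e * Im z + \<bar>\<rho>\<bar> * T \<ge> T0" using eIm TT(3) by linarith
        thus "integral {1..e * Im z + \<bar>\<rho>\<bar> * T} (\<lambda>t. h (e * t)) \<le> \<eta> / 8 * (e * Im z + \<bar>\<rho>\<bar> * T)"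
          unfolding h_def using T0 z e by blast
      qed simp
      also have "\<dots> \<le> 1 / \<bar>\<rho>\<bar> * (\<eta> / 8 * (2 * (\<bar>\<rho>\<bar> * T)))"
      proof (intro mult_left_mono)
        show "e * Im z + \<bar>\<rho>\<bar> * T \<le> 2 * (\<bar>\<rho>\<bar> * T)" using eIm TT(3) by linarith
      qed (use \<eta> in auto)
      also have "\<dots> = \<eta> / 4 * T" using \<rho> by simp
      finally show ?thesis .
    qed
    finally have "integral {T1..T} (\<lambda>\<tau>. W \<tau> * (cmod (F (s \<tau>)))\<^sup>2) \<le> 2 * (tail * integral {0..T} W + C0) + 2 * (\<eta> / 4 * T)" by simp
    also have "\<dots> \<le> 2 * tail * integral {0..T} W + 2 * C0 + \<eta> * T" using \<eta> TT(2) by simp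
    finally show ?thesis unfolding s_def .
  qed
  show ?thesis unfolding tail_def[symmetric]
    by (rule exI[of _ "2 * C0"], rule exI[of _ T2], intro allI impI, rule main)
qed

text \<open>Exchange of the integrations over \<tau> and over the circle: a bound that is uniform on
  the circle passes to the circle mean.\<close>

lemma circle_weighted_estimate:
  fixes W :: "real \<Rightarrow> real" and F :: "complex \<Rightarrow> complex"
  assumes F: "continuous_on (-{1}) F" and W: "continuous_on UNIV W"
    and off1: "\<And>\<tau> t. \<tau> \<in> {T1..T} \<Longrightarrow> circlepath c r t + \<i> * of_real (\<rho> * \<tau>) \<noteq> 1"
    and le: "\<And>t. integral {T1..T} (\<lambda>\<tau>. W \<tau> * (cmod (F (circlepath c r t + \<i> * of_real (\<rho> * \<tau>))))\<^sup>2) \<le> Bd"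
  defines "g \<equiv> (\<lambda>\<tau>. integral {0..1} (\<lambda>t. (cmod (F (circlepath c r t + \<i> * of_real (\<rho> * \<tau>))))\<^sup>2))"
  shows "continuous_on {T1..T} g" "integral {T1..T} (\<lambda>\<tau>. W \<tau> * g \<tau>) \<le> Bd"
proof -
  let ?f = "\<lambda>\<tau> t. (cmod (F (circlepath c r t + \<i> * of_real (\<rho> * \<tau>))))\<^sup>2"
  have cF: "continuous_on ({T1..T} \<times> {0..1}) (\<lambda>x. F (circlepath c r (snd x) + \<i> * of_real (\<rho> * fst x)))"
  proof (rule continuous_on_compose2[OF F])
    show "continuous_on ({T1..T} \<times> {0..1}) (\<lambda>x. circlepath c r (snd x) + \<i> * of_real (\<rho> * fst x))"
      unfolding circlepath by (intro continuous_intros)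
    show "(\<lambda>x. circlepath c r (snd x) + \<i> * of_real (\<rho> * fst x)) ` ({T1..T} \<times> {0..1}) \<subseteq> -{1}" using off1 by auto
  qed
  hence c1: "continuous_on ({T1..T} \<times> {0..1}) (\<lambda>x. ?f (fst x) (snd x))" by (intro continuous_intros)
  have c2: "continuous_on ({T1..T} \<times> {0..1}) (\<lambda>x. W (fst x) * ?f (fst x) (snd x))"
    by (intro continuous_intros c1 continuous_on_compose2[OF W]) auto
  have "continuous_on {T1..T} (\<lambda>\<tau>. integral (cbox 0 1) (?f \<tau>))"
    by (rule integral_continuous_on_param) (use c1 in \<open>simp add: case_prod_beta'\<close>)
  thus gc: "continuous_on {T1..T} g" unfolding g_def by simp
  have swap_cont: "continuous_on ({0..1} \<times> {T1..T}) (\<lambda>x. W (snd x) * ?f (snd x) (fst x))"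
  proof -
    have "continuous_on ({0..1} \<times> {T1..T}) (\<lambda>x. (\<lambda>x. W (fst x) * ?f (fst x) (snd x)) (snd x, fst x))"
      by (rule continuous_on_compose2[OF c2]) (auto intro!: continuous_intros)
    thus ?thesis by simp
  qed
  have hc: "continuous_on {0..1} (\<lambda>t. integral (cbox T1 T) (\<lambda>\<tau>. W \<tau> * ?f \<tau> t))"
    by (rule integral_continuous_on_param) (use swap_cont in \<open>simp add: case_prod_beta'\<close>)
  have "integral {T1..T} (\<lambda>\<tau>. W \<tau> * g \<tau>) = integral (cbox T1 T) (\<lambda>\<tau>. integral (cbox 0 1) (\<lambda>t. W \<tau> * ?f \<tau> t))"
    by (simp add: g_def)
  also have "\<dots> = integral (cbox 0 1) (\<lambda>t. integral (cbox T1 T) (\<lambda>\<tau>. W \<tau> * ?f \<tau> t))"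
    by (rule integral_swap_continuous) (use c2 in \<open>simp add: case_prod_beta' cbox_Pair_eq\<close>)
  also have "\<dots> = integral {0..1} (\<lambda>t. integral {T1..T} (\<lambda>\<tau>. W \<tau> * ?f \<tau> t))" by simp
  also have "\<dots> \<le> integral {0..1} (\<lambda>t::real. Bd)"
    using le hc by (intro integral_le integrable_continuous_interval) auto
  also have "\<dots> = Bd" by simp
  finally show "integral {T1..T} (\<lambda>\<tau>. W \<tau> * g \<tau>) \<le> Bd" .
qed

lemma one_minus_cis_bound:
  assumes "(1 + cos \<theta>) / 2 > 1 - x\<^sup>2" "x \<ge> (0::real)"
  shows "cmod (1 - cis \<theta>) \<le> 2 * x"
proof (rule power2_le_imp_le)
  have "(cmod (1 - cis \<theta>))\<^sup>2 = (1 - cos \<theta>)\<^sup>2 + (sin \<theta>)\<^sup>2" by (simp add: cmod_power2)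
  also have "\<dots> = 1 - 2 * cos \<theta> + ((cos \<theta>)\<^sup>2 + (sin \<theta>)\<^sup>2)" by (simp add: power2_diff)
  also have "\<dots> = 2 - 2 * cos \<theta>" by simp
  also have "\<dots> \<le> (2 * x)\<^sup>2" using assms by (simp add: power_mult_distrib field_simps)
  finally show "(cmod (1 - cis \<theta>))\<^sup>2 \<le> (2 * x)\<^sup>2" .
qed (use assms in simp)

text \<open>Each demand holds for all large N, so they can be met together. The numbers
  \<open>b1\<close> and \<open>b2\<close> will be the resonance ratios 1 - d and (1 - d) /
  d.\<close>

lemma exists_sieve_level:
  fixes a b1 b2 \<eta> :: real
  assumes a: "a > 1" and \<eta>: "\<eta> > 0"
  shows "\<exists>N. (\<Sum>n. real (n + Suc N) powr (-2)) < 1 / 4 \<and> (\<Sum>n. real (n + Suc N) powr (-a)) < \<eta> \<and>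
    (\<forall>b\<in>{b1, b2}. \<forall>(k :: nat \<Rightarrow> int) n n'. n > 0 \<longrightarrow> n' > 0 \<longrightarrow> sieved (primes_upto N) n \<longrightarrow> sieved (primes_upto N) n' \<longrightarrow>
      ln (real n) - ln (real n') = b * (\<Sum>p\<in>primes_upto N. of_int (k p) * ln (real p)) \<longrightarrow> n = n')"
proof -
  have t2: "\<forall>\<^sub>F N in sequentially. (\<Sum>n. real (n + Suc N) powr (-2)) < 1 / 4"
    using powr_tail_tendsto_0[of 2] by (intro order_tendstoD) auto
  have ta: "\<forall>\<^sub>F N in sequentially. (\<Sum>n. real (n + Suc N) powr (-a)) < \<eta>"
    using powr_tail_tendsto_0[OF a] \<eta> by (intro order_tendstoD)
  have ind: "\<forall>\<^sub>F N in sequentially. \<forall>(k :: nat \<Rightarrow> int) n n'. n > 0 \<longrightarrow> n' > 0 \<longrightarrow> sieved (primes_upto N) n \<longrightarrow> sieved (primes_upto N) n' \<longrightarrow>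
      ln (real n) - ln (real n') = b * (\<Sum>p\<in>primes_upto N. of_int (k p) * ln (real p)) \<longrightarrow> n = n'" for b :: real
  proof -
    obtain N0 where N0: "\<forall>N\<ge>N0. \<forall>(k :: nat \<Rightarrow> int) n n'. n > 0 \<longrightarrow> n' > 0 \<longrightarrow> (\<forall>p. prime p \<longrightarrow> p \<le> N \<longrightarrow> \<not> p dvd n * n') \<longrightarrow>
      ln (real n) - ln (real n') = b * (\<Sum>p | prime p \<and> p \<le> N. of_int (k p) * ln (real p)) \<longrightarrow> n = n'"
      using log_independence[of b] by blast
    show ?thesis using eventually_ge_at_top[of N0]
    proof eventually_elim
      case (elim N)
      show ?case
      proof (intro allI impI)
        fix k :: "nat \<Rightarrow> int" and n n' :: nat
        assume *: "n > 0" "n' > 0" "sieved (primes_upto N) n" "sieved (primes_upto N) n'"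
          "ln (real n) - ln (real n') = b * (\<Sum>p\<in>primes_upto N. of_int (k p) * ln (real p))"
        have "\<forall>p. prime p \<longrightarrow> p \<le> N \<longrightarrow> \<not> p dvd n * n'" using *(3,4) by (auto simp: sieved_def prime_dvd_mult_iff)
        thus "n = n'" using N0 elim * by blast
      qed
    qed
  qed
  from eventually_conj[OF t2 eventually_conj[OF ta eventually_conj[OF ind[of b1] ind[of b2]]]]
  have "\<exists>N. (\<Sum>n. real (n + Suc N) powr (-2)) < 1 / 4 \<and> (\<Sum>n. real (n + Suc N) powr (-a)) < \<eta> \<and>
    (\<forall>(k :: nat \<Rightarrow> int) n n'. n > 0 \<longrightarrow> n' > 0 \<longrightarrow> sieved (primes_upto N) n \<longrightarrow> sieved (primes_upto N) n' \<longrightarrow>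
      ln (real n) - ln (real n') = b1 * (\<Sum>p\<in>primes_upto N. of_int (k p) * ln (real p)) \<longrightarrow> n = n') \<and>
    (\<forall>(k :: nat \<Rightarrow> int) n n'. n > 0 \<longrightarrow> n' > 0 \<longrightarrow> sieved (primes_upto N) n \<longrightarrow> sieved (primes_upto N) n' \<longrightarrow>
      ln (real n) - ln (real n') = b2 * (\<Sum>p\<in>primes_upto N. of_int (k p) * ln (real p)) \<longrightarrow> n = n')"
    by (rule eventually_happens'[OF sequentially_bot])
  thus ?thesis by (simp only: ball_simps simp_thms)
qed

text \<open>Chebyshev's argument from the pointwise bound of W by the indicator of \<open>G\<close>
  plus q + W G0 / \<eta>: outside \<open>G\<close> either W \<le> q or G0 \<ge> \<eta>. The stretch
  from 0 to T1 costs at most T1.\<close>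

lemma weighted_good_set_measure:
  fixes W G0 :: "real \<Rightarrow> real"
  assumes T: "0 \<le> T1" "T1 \<le> T" and W: "continuous_on UNIV W" "\<And>\<tau>. 0 \<le> W \<tau>" "\<And>\<tau>. W \<tau> \<le> 1"
    and G0: "continuous_on {T1..T} G0" and V: "open V" "\<And>\<tau>. \<tau> \<notin> V \<Longrightarrow> W \<tau> \<le> q" and q: "q \<ge> 0" and \<eta>: "\<eta> > 0" and G0nn: "\<And>\<tau>. \<tau> \<in> {T1..T} \<Longrightarrow> G0 \<tau> \<ge> 0"
  defines "G \<equiv> {\<tau> \<in> {T1..T}. \<tau> \<in> V \<and> G0 \<tau> < \<eta>}"
  shows "G \<in> sets lebesgue"
    and "integral {0..T} W \<le> measure lebesgue G + T1 + q * T + 1 / \<eta> * integral {T1..T} (\<lambda>\<tau>. W \<tau> * G0 \<tau>)"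
proof -
  have "openin (top_of_set {T1..T}) ({T1..T} \<inter> G0 -` {..<\<eta>})"
    by (rule continuous_openin_preimage_gen[OF G0]) simp
  then obtain U where U: "open U" "{T1..T} \<inter> G0 -` {..<\<eta>} = {T1..T} \<inter> U" by (auto simp: openin_open)
  have Geq: "G = {T1..T} \<inter> (U \<inter> V)" using U(2) unfolding G_def by blast
  show Gs: "G \<in> sets lebesgue" unfolding Geq using U(1) V(1) by (intro sets.Int) auto
  have Gm: "G \<in> lmeasurable" unfolding Geq
    by (rule fmeasurable_Int_fmeasurable) (use U(1) V(1) in auto)
  have Wi: "W integrable_on {a..b}" for a b
    by (intro integrable_continuous_interval continuous_on_subset[OF W(1)]) simp
  have Gh: "((\<lambda>\<tau>. if \<tau> \<in> G then 1 else 0) has_integral measure lebesgue G) {T1..T}"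
  proof -
    have "((\<lambda>\<tau>. 1::real) has_integral measure lebesgue G) G"
      using Gm lmeasurable_iff_integrable_on lmeasure_integral integrable_integral by metis
    moreover have "G \<subseteq> {T1..T}" unfolding G_def by blast
    ultimately show ?thesis by (simp add: has_integral_restrict)
  qed
  have WGi: "(\<lambda>\<tau>. W \<tau> * G0 \<tau>) integrable_on {T1..T}"
    by (intro integrable_continuous_interval continuous_intros G0 continuous_on_subset[OF W(1)]) simp
  have qi: "((\<lambda>\<tau>. q) has_integral (T - T1) * q) {T1..T}" using has_integral_const_real[of q T1 T] T by simp
  have "integral {T1..T} W \<le> measure lebesgue G + (T - T1) * q + 1 / \<eta> * integral {T1..T} (\<lambda>\<tau>. W \<tau> * G0 \<tau>)"
  proof (rule has_integral_le)
    show "(W has_integral integral {T1..T} W) {T1..T}" using Wi by (rule integrable_integral)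
    show "((\<lambda>\<tau>. (if \<tau> \<in> G then 1 else 0) + q + 1 / \<eta> * (W \<tau> * G0 \<tau>)) has_integral
       (measure lebesgue G + (T - T1) * q + 1 / \<eta> * integral {T1..T} (\<lambda>\<tau>. W \<tau> * G0 \<tau>))) {T1..T}"
      by (intro has_integral_add has_integral_mult_right Gh qi integrable_integral WGi)
    fix \<tau> assume \<tau>: "\<tau> \<in> {T1..T}"
    have nn: "1 / \<eta> * (W \<tau> * G0 \<tau>) \<ge> 0" using \<eta> W(2) G0nn[OF \<tau>] by simp
    show "W \<tau> \<le> (if \<tau> \<in> G then 1 else 0) + q + 1 / \<eta> * (W \<tau> * G0 \<tau>)"
    proof (cases "\<tau> \<in> G")
      case True
      thus ?thesis using W(3)[of \<tau>] q nn by simp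
    next
      case False
      show ?thesis
      proof (cases "\<tau> \<in> V")
        case True
        hence "G0 \<tau> \<ge> \<eta>" using False \<tau> by (auto simp: G_def)
        hence "1 / \<eta> * (W \<tau> * \<eta>) \<le> 1 / \<eta> * (W \<tau> * G0 \<tau>)" using \<eta> W(2) by (intro mult_left_mono) auto
        thus ?thesis using False q \<eta> by simp
      next
        case False
        thus ?thesis using V(2)[OF False] nn by simp
      qed
    qed
  qed
  moreover have "integral {0..T} W = integral {0..T1} W + integral {T1..T} W"
    using Henstock_Kurzweil_Integration.integral_combine[OF T(1,2) Wi] by simp
  moreover have "integral {0..T1} W \<le> T1"
    using integral_le[OF Wi integrable_const_ivl[of 1 0 T1] W(3)] T by simp
  moreover have "(T - T1) * q \<le> q * T" using T q by (simp add: algebra_simps)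
  ultimately show "integral {0..T} W \<le> measure lebesgue G + T1 + q * T + 1 / \<eta> * integral {T1..T} (\<lambda>\<tau>. W \<tau> * G0 \<tau>)"
    by linarith
qed

text \<open>Budget: 8 x for each prime, in total at most \<epsilon> / 4, and less than \<epsilon> /
  4 for each of the two principal logarithms, by |Ln (1 + w)| \<le> 2 |w|.\<close>

lemma close_euler_product_imp_approximation:
  fixes d \<epsilon> \<tau> \<sigma>1 H \<kappa> x :: real and N :: nat
  assumes tail: "(\<Sum>n. real (n + Suc N) powr (-2)) < 1 / 4" and \<sigma>1: "\<sigma>1 > 1 / 2"
    and H: "H \<le> \<bar>\<tau>\<bar>" "H \<le> \<bar>d * \<tau>\<bar>"
    and close_all: "\<forall>\<rho>\<in>{1, d}. \<forall>z. \<sigma>1 < Re z \<longrightarrow> Re z \<le> 2 \<longrightarrow> \<bar>Im z\<bar> < H \<longrightarrow>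
        cmod (zeta (z + \<i> * of_real (\<rho> * \<tau>)) * euler_factor (primes_upto N) (z + \<i> * of_real (\<rho> * \<tau>)) - 1) < min (1 / 4) (\<epsilon> / 8)"
    and x: "x \<ge> 0" "8 * x * real (card (primes_upto N)) \<le> \<epsilon> / 4"
    and ph: "\<forall>p\<in>primes_upto N. (1 + cos ((1 - d) * \<tau> * ln (real p))) / 2 > 1 - x\<^sup>2"
    and \<epsilon>: "\<epsilon> > 0" and s: "\<sigma>1 < Re s" "Re s \<le> 2" "\<bar>Im s\<bar> < H"
  shows "s + \<i> * of_real \<tau> \<in> log_zeta_dom" "s + \<i> * of_real (d * \<tau>) \<in> log_zeta_dom"
    "norm (log_zeta (s + \<i> * of_real \<tau>) - log_zeta (s + \<i> * of_real (d * \<tau>))) < \<epsilon>"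
proof -
  have close: "cmod (zeta (z + \<i> * of_real (\<rho> * \<tau>)) * euler_factor (primes_upto N) (z + \<i> * of_real (\<rho> * \<tau>)) - 1) < min (1 / 4) (\<epsilon> / 8)"
    if "\<rho> \<in> {1, d}" "\<sigma>1 < Re z" "Re z \<le> 2" "\<bar>Im z\<bar> < H" for \<rho> z
    using bspec[OF close_all that(1), THEN spec, of z] that(2-4) by simp
  define S where "S = primes_upto N"
  define q where "q = (\<lambda>z. zeta z * euler_factor S z)"
  have lz: "s + \<i> * of_real (\<rho> * \<tau>) \<in> log_zeta_dom \<and>
      log_zeta (s + \<i> * of_real (\<rho> * \<tau>)) = (\<Sum>p\<in>S. euler_log (s + \<i> * of_real (\<rho> * \<tau>)) p) + Ln (q (s + \<i> * of_real (\<rho> * \<tau>)))"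
    if \<rho>: "\<rho> \<in> {1, d}" for \<rho>
  proof -
    have H\<rho>: "H \<le> \<bar>\<rho> * \<tau>\<bar>" using \<rho> H by auto
    have cl: "cmod (zeta z * euler_factor (primes_upto N) z - 1) < 1 / 2"
      if z: "\<sigma>1 < Re z" "Re z \<le> 2" "\<bar>Im z - \<rho> * \<tau>\<bar> < H" for z
    proof -
      have "z - \<i> * of_real (\<rho> * \<tau>) + \<i> * of_real (\<rho> * \<tau>) = z" by simp
      thus ?thesis using close[OF \<rho>, of "z - \<i> * of_real (\<rho> * \<tau>)"] z by simp
    qed
    have \<sigma>0: "\<sigma>1 > 0" using \<sigma>1 by simp
    have s\<rho>: "\<sigma>1 < Re (s + \<i> * of_real (\<rho> * \<tau>))" "\<bar>Im (s + \<i> * of_real (\<rho> * \<tau>)) - \<rho> * \<tau>\<bar> < H" using s by simp_all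
    show ?thesis unfolding S_def q_def
      using log_zeta_near_euler_product[OF tail \<sigma>0 H\<rho> cl s\<rho>] by blast
  qed
  have ln: "cmod (Ln (q (s + \<i> * of_real (\<rho> * \<tau>)))) < \<epsilon> / 4" if \<rho>: "\<rho> \<in> {1, d}" for \<rho>
  proof -
    define w where "w = q (s + \<i> * of_real (\<rho> * \<tau>)) - 1"
    have w: "cmod w < min (1 / 4) (\<epsilon> / 8)" unfolding w_def q_def S_def by (rule close[OF \<rho> s])
    have "cmod (Ln (1 + w)) \<le> 2 * cmod w" by (rule norm_Ln_le) (use w in simp)
    also have "\<dots> < \<epsilon> / 4" using w by simp
    finally show ?thesis by (simp add: w_def)
  qed
  from lz[of 1] show "s + \<i> * of_real \<tau> \<in> log_zeta_dom" by simp
  from lz[of d] show "s + \<i> * of_real (d * \<tau>) \<in> log_zeta_dom" by simp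
  have l1: "log_zeta (s + \<i> * of_real \<tau>) = (\<Sum>p\<in>S. euler_log (s + \<i> * of_real \<tau>) p) + Ln (q (s + \<i> * of_real \<tau>))"
    using lz[of 1] by simp
  have l2: "log_zeta (s + \<i> * of_real (d * \<tau>)) = (\<Sum>p\<in>S. euler_log (s + \<i> * of_real (d * \<tau>)) p) + Ln (q (s + \<i> * of_real (d * \<tau>)))"
    using lz[of d] by blast
  have "cmod (\<Sum>p\<in>S. euler_log (s + \<i> * of_real \<tau>) p - euler_log (s + \<i> * of_real (d * \<tau>)) p) \<le> (\<Sum>p\<in>S. 8 * x)"
  proof (rule sum_norm_le)
    fix p assume p: "p \<in> S"
    have "cmod (euler_log (s + \<i> * of_real \<tau>) p - euler_log (s + \<i> * of_real (d * \<tau>)) p) \<le> 4 * cmod (1 - cis ((\<tau> - d * \<tau>) * ln (real p)))"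
      using p s \<sigma>1 by (intro euler_log_diff_le) (auto simp: S_def)
    also have "(\<tau> - d * \<tau>) * ln (real p) = (1 - d) * \<tau> * ln (real p)" by (simp add: algebra_simps)
    also have "4 * cmod (1 - cis ((1 - d) * \<tau> * ln (real p))) \<le> 4 * (2 * x)"
      using ph p x by (intro mult_left_mono one_minus_cis_bound) (auto simp: S_def)
    finally show "cmod (euler_log (s + \<i> * of_real \<tau>) p - euler_log (s + \<i> * of_real (d * \<tau>)) p) \<le> 8 * x" by simp
  qed
  also have "\<dots> \<le> \<epsilon> / 4" using x(2) by (simp add: S_def mult_ac)
  finally have A: "cmod (\<Sum>p\<in>S. euler_log (s + \<i> * of_real \<tau>) p - euler_log (s + \<i> * of_real (d * \<tau>)) p) \<le> \<epsilon> / 4" .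
  have B: "cmod (Ln (q (s + \<i> * of_real \<tau>)) - Ln (q (s + \<i> * of_real (d * \<tau>)))) < \<epsilon> / 4 + \<epsilon> / 4"
    using norm_triangle_ineq4[of "Ln (q (s + \<i> * of_real \<tau>))" "Ln (q (s + \<i> * of_real (d * \<tau>)))"] ln[of 1] ln[of d] by simp
  have "log_zeta (s + \<i> * of_real \<tau>) - log_zeta (s + \<i> * of_real (d * \<tau>)) =
     (\<Sum>p\<in>S. euler_log (s + \<i> * of_real \<tau>) p - euler_log (s + \<i> * of_real (d * \<tau>)) p) + (Ln (q (s + \<i> * of_real \<tau>)) - Ln (q (s + \<i> * of_real (d * \<tau>))))"
    unfolding l1 l2 sum_subtractf by simp
  also have "cmod \<dots> \<le> cmod (\<Sum>p\<in>S. euler_log (s + \<i> * of_real \<tau>) p - euler_log (s + \<i> * of_real (d * \<tau>)) p)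
      + cmod (Ln (q (s + \<i> * of_real \<tau>)) - Ln (q (s + \<i> * of_real (d * \<tau>))))" by (rule norm_triangle_ineq)
  also have "\<dots> < \<epsilon>" using A B \<epsilon> by linarith
  finally show "norm (log_zeta (s + \<i> * of_real \<tau>) - log_zeta (s + \<i> * of_real (d * \<tau>))) < \<epsilon>" .
qed

text \<open>The order of the choices is essential: first the circles and \<eta>1, then N, then x,
  \<kappa> and m depending on N, and finally \<eta>, which depends on the lower bound
  \<open>w0\<close> for the mean of the weight.\<close>

lemma approximation_positive_density:
  fixes d \<epsilon> :: real and K :: "complex set"
  assumes d: "d \<noteq> 0" and K: "compact K" "K \<subseteq> {s. 1 / 2 < Re s \<and> Re s < 1}" and \<epsilon>: "\<epsilon> > 0"
  shows "\<exists>\<delta>>0. \<exists>T3. \<forall>T\<ge>T3. \<exists>G. G \<in> sets lebesgue \<and> \<delta> * T \<le> measure lebesgue G \<and>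
    G \<subseteq> {0..T} \<inter> {\<tau>. \<forall>s\<in>K. s + \<i> * of_real \<tau> \<in> log_zeta_dom \<and> s + \<i> * of_real (d * \<tau>) \<in> log_zeta_dom \<and>
           norm (log_zeta (s + \<i> * of_real \<tau>) - log_zeta (s + \<i> * of_real (d * \<tau>))) < \<epsilon>}"
proof -
  obtain \<sigma>1 H where \<sigma>1: "1 / 2 < \<sigma>1" "\<sigma>1 < 1" and H: "H > 0" and KH: "\<And>s. s \<in> K \<Longrightarrow> \<sigma>1 < Re s \<and> \<bar>Im s\<bar> < H"
    using compact_strip_bounds[OF K] by (elim exE conjE) blast
  \<comment> \<open>Midway, so that circles of radius r about points with real part at least
    \<sigma>1 stay to the right of 1 / 2.\<close>
  define \<sigma>0 where "\<sigma>0 = (1 / 2 + \<sigma>1) / 2"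
  define r where "r = \<sigma>1 - \<sigma>0"
  have \<sigma>0: "1 / 2 < \<sigma>0" "\<sigma>0 < 1" using \<sigma>1 by (auto simp: \<sigma>0_def)
  have "\<sigma>0 < \<sigma>1" using \<sigma>1 by (simp add: \<sigma>0_def field_simps)
  hence r: "r > 0" "r < 1" using \<sigma>0 \<sigma>1 unfolding r_def by simp_all
  \<comment> \<open>The rectangle extends to real part 2, beyond K: the logarithm at a shifted point
    requires that there be no zero on the whole ray to its right.\<close>
  define Q where "Q = cbox (Complex \<sigma>1 (-H)) (Complex 2 H)"
  have Qmem: "z \<in> Q \<longleftrightarrow> \<sigma>1 \<le> Re z \<and> Re z \<le> 2 \<and> -H \<le> Im z \<and> Im z \<le> H" for z
    unfolding Q_def by (auto simp: in_cbox_complex_iff)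
  have "compact Q" unfolding Q_def by (rule compact_cbox)
  have "Q \<subseteq> (\<Union>c\<in>Q. ball c (r / 2))" using r by auto
  \<comment> \<open>Finitely many circles suffice, since Cauchy's formula controls all points within
    r / 2 of a centre.\<close>
  from compactE_image[OF \<open>compact Q\<close> _ this] obtain Cs where Cs: "Cs \<subseteq> Q" "finite Cs" "Q \<subseteq> (\<Union>c\<in>Cs. ball c (r / 2))"
    by auto
  define B where "B = H + 1"
  have B: "B \<ge> 0" using H by (simp add: B_def)
  have circ: "\<sigma>0 \<le> Re (circlepath c r t)" "Re (circlepath c r t) \<le> 3" "\<bar>Im (circlepath c r t)\<bar> \<le> B" if "c \<in> Cs" for c t
  proof -
    have c: "\<sigma>1 \<le> Re c" "Re c \<le> 2" "-H \<le> Im c" "Im c \<le> H" using that Cs(1) Qmem by auto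
    define u where "u = r * exp (2 * of_real pi * \<i> * of_real t)"
    have "cmod u = r" unfolding u_def using r by (simp add: norm_mult)
    hence "\<bar>Re u\<bar> \<le> r" "\<bar>Im u\<bar> \<le> r" using abs_Re_le_cmod[of u] abs_Im_le_cmod[of u] by auto
    moreover have "circlepath c r t = c + u" by (simp add: circlepath u_def)
    ultimately show "\<sigma>0 \<le> Re (circlepath c r t)" "Re (circlepath c r t) \<le> 3" "\<bar>Im (circlepath c r t)\<bar> \<le> B"
      using c r by (auto simp: r_def B_def abs_le_iff)
  qed
  define Rs where "Rs = {1, d}"
  have Rs: "finite Rs" "\<And>\<rho>. \<rho> \<in> Rs \<Longrightarrow> \<rho> \<noteq> 0" using d by (auto simp: Rs_def)
  define I where "I = Rs \<times> Cs"
  have finI: "finite I" using Rs Cs by (simp add: I_def)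
  define M where "M = real (card I) + 1"
  have M: "M > 0" "real (card I) \<le> M" by (auto simp: M_def)
  define r0 where "r0 = min (1 / 4) (\<epsilon> / 8)"
  have r0: "r0 > 0" using \<epsilon> by (simp add: r0_def)
  \<comment> \<open>A circle mean below \<eta>1 gives |F|^2 < 2 \<eta>1 = r0^2 / 2 in the inner
    disc, below the required r0^2.\<close>
  define \<eta>1 where "\<eta>1 = r0\<^sup>2 / 4"
  have \<eta>1: "\<eta>1 > 0" using r0 by (simp add: \<eta>1_def)
  have "2 * \<sigma>0 > 1" "\<eta>1 / (4 * M) > 0" using \<sigma>0 \<eta>1 M by auto
  from exists_sieve_level[OF this, of "1 - d" "(1 - d) / d"] obtain N where
    N2: "(\<Sum>n. real (n + Suc N) powr (-2)) < 1 / 4" and Nt: "(\<Sum>n. real (n + Suc N) powr (- (2 * \<sigma>0))) < \<eta>1 / (4 * M)" and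
    Nind: "\<forall>b\<in>{1 - d, (1 - d) / d}. \<forall>(k :: nat \<Rightarrow> int) n n'. n > 0 \<longrightarrow> n' > 0 \<longrightarrow> sieved (primes_upto N) n \<longrightarrow> sieved (primes_upto N) n' \<longrightarrow>
      ln (real n) - ln (real n') = b * (\<Sum>p\<in>primes_upto N. of_int (k p) * ln (real p)) \<longrightarrow> n = n'"
    by (elim exE conjE)
  define S where "S = primes_upto N"
  have S: "finite S" by (simp add: S_def)
  define tail where "tail = (\<Sum>n. real (n + Suc N) powr (- (2 * \<sigma>0)))"
  have tail0: "tail \<ge> 0" unfolding tail_def using \<sigma>0 by (intro suminf_nonneg summable_shifted_powr) auto
  \<comment> \<open>With 8 x lost per prime, 32 = 8 * 4 makes the total at most \<epsilon> / 4; x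
    \<le> 1 / 2 keeps \<kappa> positive.\<close>
  define x where "x = min (1 / 2) (\<epsilon> / (32 * (real (card S) + 1)))"
  have x: "0 < x" "x \<le> 1 / 2" "8 * x * real (card S) \<le> \<epsilon> / 4"
  proof -
    show "0 < x" using \<epsilon> by (simp add: x_def)
    show "x \<le> 1 / 2" unfolding x_def by (rule min.cobounded1)
    have "8 * x * real (card S) \<le> 8 * (\<epsilon> / (32 * (real (card S) + 1))) * (real (card S) + 1)"
      using \<epsilon> by (intro mult_mono) (auto simp: x_def)
    also have "\<dots> = \<epsilon> / 4"
    proof -
      have y: "8 * (\<epsilon> / (32 * y)) * y = \<epsilon> / 4" if "y > 0" for y using that by simp
      show ?thesis by (rule y) linarith
    qed
    finally show "8 * x * real (card S) \<le> \<epsilon> / 4" .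
  qed
  define \<kappa> where "\<kappa> = 1 - x\<^sup>2"
  have "x\<^sup>2 \<le> (1 / 2)\<^sup>2" using x by (intro power_mono) auto
  hence \<kappa>: "0 < \<kappa>" "\<kappa> < 1" using x by (auto simp: \<kappa>_def power2_eq_square)
  obtain m where m: "m \<ge> 1" "\<kappa> ^ m \<le> 1 / 8 * (real ((2 * m) choose m) / 4 ^ m) ^ card S"
    using exists_weight_exponent[OF \<kappa>, of "card S"] by blast
  define w0 where "w0 = (real ((2 * m) choose m) / 4 ^ m) ^ card S"
  have w0: "w0 > 0" unfolding w0_def by (intro zero_less_power divide_pos_pos) auto
  define W where "W = weight S m (1 - d)"
  have Wc: "continuous_on UNIV W" unfolding W_def by (rule continuous_on_weight)
  have W01: "0 \<le> W \<tau>" "W \<tau> \<le> 1" for \<tau> unfolding W_def by (rule weight_bounds)+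
  define F where "F = (\<lambda>s. zeta s * euler_factor S s - 1)"
  have Fc: "continuous_on (-{1}) F" unfolding F_def
    by (intro continuous_intros holomorphic_on_imp_continuous_on[OF holomorphic_zeta]
        holomorphic_on_imp_continuous_on[OF holomorphic_euler_factor]) (auto simp: S_def)
  have Fh: "F holomorphic_on -{1}" unfolding F_def
    by (intro holomorphic_intros holomorphic_zeta holomorphic_euler_factor) (auto simp: S_def)
  \<comment> \<open>Small against the mean of the weight: summed over the circles and divided by
    \<eta>1, the sieve error costs w0 T / 16.\<close>
  define \<eta> where "\<eta> = w0 * \<eta>1 / (16 * M)"
  have \<eta>: "\<eta> > 0" unfolding \<eta>_def using w0 \<eta>1 M by simp
  \<comment> \<open>From T1 on, \<tau> and d \<tau> both have modulus at least B + 1, so no shifted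
    circle meets the pole.\<close>
  define T1 where "T1 = (B + 1) * (1 + 1 / \<bar>d\<bar>)"
  have T1: "T1 \<ge> 0" "T1 \<ge> B + 1" "\<And>\<rho>. \<rho> \<in> Rs \<Longrightarrow> \<bar>\<rho>\<bar> * T1 \<ge> B + 1"
  proof -
    show "T1 \<ge> 0" unfolding T1_def using B by (intro mult_nonneg_nonneg) auto
    have "(B + 1) * 1 \<le> (B + 1) * (1 + 1 / \<bar>d\<bar>)" using B by (intro mult_left_mono) auto
    thus T1': "T1 \<ge> B + 1" by (simp add: T1_def)
    have "\<bar>d\<bar> * T1 = (B + 1) * (\<bar>d\<bar> + 1)" using d by (simp add: T1_def field_simps)
    moreover have "(B + 1) * 1 \<le> (B + 1) * (\<bar>d\<bar> + 1)" using B by (intro mult_left_mono) auto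
    ultimately have "\<bar>d\<bar> * T1 \<ge> B + 1" by simp
    thus "\<bar>\<rho>\<bar> * T1 \<ge> B + 1" if "\<rho> \<in> Rs" for \<rho> using that T1' by (auto simp: Rs_def)
  qed
  have nonres: "n = n'" if "\<rho> \<in> Rs" "n > 0" "n' > 0" "sieved S n" "sieved S n'"
      "weight_freq S m (1 - d) k = \<rho> * (ln (real n) - ln (real n'))" for \<rho> k n n'
  proof -
    define L where "L = (\<Sum>p\<in>primes_upto N. of_int (int (k p) - int m) * ln (real p))"
    have fr: "(1 - d) * L = \<rho> * (ln (real n) - ln (real n'))"
      using that(6) by (simp only: weight_freq_def L_def S_def)
    \<comment> \<open>The resonance equation solved for ln n - ln n': \<rho> = 1 and \<rho> = d give
      the two ratios for which N was chosen.\<close>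
    define b where "b = (if \<rho> = 1 then 1 - d else (1 - d) / d)"
    have eq: "ln (real n) - ln (real n') = b * L"
      using fr that(1) d by (auto simp: b_def Rs_def field_simps)
    have bm: "b \<in> {1 - d, (1 - d) / d}" by (simp add: b_def)
    note ind = spec[OF spec[OF spec[OF bspec[OF Nind bm], of "\<lambda>p. int (k p) - int m"], of n], of n']
    show ?thesis
      by (rule ind[THEN mp, THEN mp, THEN mp, THEN mp, THEN mp, OF that(2,3) that(4,5)[unfolded S_def] eq[unfolded L_def]])
  qed
  have ex_est: "\<exists>C0 T2. \<forall>T\<ge>T2. \<forall>z. \<sigma>0 \<le> Re z \<longrightarrow> Re z \<le> 3 \<longrightarrow> \<bar>Im z\<bar> \<le> B \<longrightarrow>
    integral {T1..T} (\<lambda>\<tau>. W \<tau> * (cmod (F (z + \<i> * of_real (\<rho> * \<tau>))))\<^sup>2) \<le> 2 * tail * integral {0..T} W + C0 + \<eta> * T"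
    if \<rho>: "\<rho> \<in> Rs" for \<rho>
    unfolding W_def F_def tail_def S_def
    by (rule weighted_tail_estimate[OF \<sigma>0 Rs(2)[OF \<rho>] B \<eta> T1(1) T1(3)[OF \<rho>] nonres[OF \<rho>, unfolded S_def]])
  have mem: "1 \<in> Rs" "d \<in> Rs" by (auto simp: Rs_def)
  from ex_est[OF mem(1)] obtain Ca Ta where
    Ca: "\<forall>T\<ge>Ta. \<forall>z. \<sigma>0 \<le> Re z \<longrightarrow> Re z \<le> 3 \<longrightarrow> \<bar>Im z\<bar> \<le> B \<longrightarrow>
      integral {T1..T} (\<lambda>\<tau>. W \<tau> * (cmod (F (z + \<i> * of_real (1 * \<tau>))))\<^sup>2) \<le> 2 * tail * integral {0..T} W + Ca + \<eta> * T"
    by (elim exE)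
  from ex_est[OF mem(2)] obtain Cb Tb where
    Cb: "\<forall>T\<ge>Tb. \<forall>z. \<sigma>0 \<le> Re z \<longrightarrow> Re z \<le> 3 \<longrightarrow> \<bar>Im z\<bar> \<le> B \<longrightarrow>
      integral {T1..T} (\<lambda>\<tau>. W \<tau> * (cmod (F (z + \<i> * of_real (d * \<tau>))))\<^sup>2) \<le> 2 * tail * integral {0..T} W + Cb + \<eta> * T"
    by (elim exE)
  define C0 where "C0 = max 0 (max Ca Cb)"
  define Bd where "Bd = (\<lambda>T. 2 * tail * integral {0..T} W + C0 + \<eta> * T)"
  have est: "integral {T1..T} (\<lambda>\<tau>. W \<tau> * (cmod (F (z + \<i> * of_real (\<rho> * \<tau>))))\<^sup>2) \<le> Bd T"
    if T: "T \<ge> max Ta Tb" and \<rho>: "\<rho> \<in> Rs" and z: "\<sigma>0 \<le> Re z" "Re z \<le> 3" "\<bar>Im z\<bar> \<le> B" for T \<rho> z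
  proof -
    have "Ta \<le> T" "Tb \<le> T" using T by auto
    hence a: "integral {T1..T} (\<lambda>\<tau>. W \<tau> * (cmod (F (z + \<i> * of_real (1 * \<tau>))))\<^sup>2) \<le> 2 * tail * integral {0..T} W + Ca + \<eta> * T"
      and b: "integral {T1..T} (\<lambda>\<tau>. W \<tau> * (cmod (F (z + \<i> * of_real (d * \<tau>))))\<^sup>2) \<le> 2 * tail * integral {0..T} W + Cb + \<eta> * T"
      using Ca Cb z by blast+
    have C: "Ca \<le> C0" "Cb \<le> C0" by (auto simp: C0_def)
    consider (one) "\<rho> = 1" | (dd) "\<rho> = d" using \<rho> by (auto simp: Rs_def)
    thus ?thesis
    proof cases
      case one
      show ?thesis unfolding Bd_def one using a C(1) by linarith
    next
      case dd
      show ?thesis unfolding Bd_def dd using b C(2) by linarith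
    qed
  qed
  have far: "\<bar>Im z + \<rho> * \<tau>\<bar> \<ge> 1" if "\<rho> \<in> Rs" "T1 \<le> \<tau>" "\<bar>Im z\<bar> \<le> B" for \<rho> \<tau> z
  proof -
    have "\<bar>\<rho>\<bar> * T1 \<le> \<bar>\<rho>\<bar> * \<tau>" using that by (intro mult_left_mono) auto
    moreover have "\<bar>\<rho> * \<tau>\<bar> = \<bar>\<rho>\<bar> * \<tau>" using that T1(1) by (simp add: abs_mult)
    ultimately show ?thesis using T1(3)[OF that(1)] that(3) by linarith
  qed
  have off1: "z + \<i> * of_real (\<rho> * \<tau>) \<noteq> 1" if "\<rho> \<in> Rs" "T1 \<le> \<tau>" "\<bar>Im z\<bar> \<le> B" for \<rho> \<tau> z
  proof
    assume "z + \<i> * of_real (\<rho> * \<tau>) = 1"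
    hence "Im (z + \<i> * of_real (\<rho> * \<tau>)) = Im 1" by (rule arg_cong)
    thus False using far[OF that] by simp
  qed
  define gf where "gf = (\<lambda>i \<tau>. integral {0..1} (\<lambda>t. (cmod (F (circlepath (snd i) r t + \<i> * of_real (fst i * \<tau>))))\<^sup>2))"
  have gfc: "continuous_on {T1..T} (gf i) \<and> integral {T1..T} (\<lambda>\<tau>. W \<tau> * gf i \<tau>) \<le> Bd T"
    if T: "T \<ge> max Ta Tb" and i: "i \<in> I" for T i
  proof -
    have i': "fst i \<in> Rs" "snd i \<in> Cs" using i by (auto simp: I_def)
    have o: "circlepath (snd i) r t + \<i> * of_real (fst i * \<tau>) \<noteq> 1" if "\<tau> \<in> {T1..T}" for \<tau> t
      using off1[OF i'(1) _ circ(3)[OF i'(2)]] that by simp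
    have l: "integral {T1..T} (\<lambda>\<tau>. W \<tau> * (cmod (F (circlepath (snd i) r t + \<i> * of_real (fst i * \<tau>))))\<^sup>2) \<le> Bd T" for t
      by (rule est[OF T i'(1) circ[OF i'(2)]])
    show ?thesis unfolding gf_def using circle_weighted_estimate[OF Fc Wc o l] by blast
  qed
  define G0 where "G0 = (\<lambda>\<tau>. \<Sum>i\<in>I. gf i \<tau>)"
  have gf0: "gf i \<tau> \<ge> 0" if i: "i \<in> I" and \<tau>: "\<tau> \<ge> T1" for i \<tau>
  proof -
    have i': "fst i \<in> Rs" "snd i \<in> Cs" using i by (auto simp: I_def)
    have "continuous_on {0..1} (\<lambda>t. F (circlepath (snd i) r t + \<i> * of_real (fst i * \<tau>)))"
    proof (rule continuous_on_compose2[OF Fc])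
      show "continuous_on {0..1} (\<lambda>t. circlepath (snd i) r t + \<i> * of_real (fst i * \<tau>))"
        unfolding circlepath by (intro continuous_intros)
      show "(\<lambda>t. circlepath (snd i) r t + \<i> * of_real (fst i * \<tau>)) ` {0..1} \<subseteq> -{1}"
        using off1[OF i'(1) \<tau> circ(3)[OF i'(2)]] by auto
    qed
    thus ?thesis unfolding gf_def by (intro integral_nonneg integrable_continuous_interval continuous_intros) auto
  qed
  define V where "V = {\<tau>. \<forall>p\<in>S. (1 + cos ((1 - d) * \<tau> * ln (real p))) / 2 > \<kappa>}"
  have Vo: "open V"
  proof -
    have "V = (\<Inter>p\<in>S. {\<tau>. \<kappa> < (1 + cos ((1 - d) * \<tau> * ln (real p))) / 2})" by (auto simp: V_def)
    also have "open \<dots>" using S by (intro open_INT open_Collect_less continuous_intros ballI) auto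
    finally show ?thesis .
  qed
  have VW: "W \<tau> \<le> \<kappa> ^ m" if "\<tau> \<notin> V" for \<tau>
  proof -
    from that obtain p where "p \<in> S" "(1 + cos ((1 - d) * \<tau> * ln (real p))) / 2 \<le> \<kappa>" by (auto simp: V_def not_less)
    thus ?thesis unfolding W_def by (rule weight_le_power[OF S])
  qed
  define G where "G = (\<lambda>T. {\<tau> \<in> {T1..T}. \<tau> \<in> V \<and> G0 \<tau> < \<eta>1})"
  have Ggood: "s + \<i> * of_real \<tau> \<in> log_zeta_dom \<and> s + \<i> * of_real (d * \<tau>) \<in> log_zeta_dom \<and>
           norm (log_zeta (s + \<i> * of_real \<tau>) - log_zeta (s + \<i> * of_real (d * \<tau>))) < \<epsilon>"
    if \<tau>: "\<tau> \<in> G T" and s: "s \<in> K" for \<tau> T s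
  proof -
    have \<tau>1: "T1 \<le> \<tau>" "\<tau> \<in> V" "G0 \<tau> < \<eta>1" using \<tau> by (auto simp: G_def)
    have cl: "cmod (zeta (z + \<i> * of_real (\<rho> * \<tau>)) * euler_factor (primes_upto N) (z + \<i> * of_real (\<rho> * \<tau>)) - 1) < min (1 / 4) (\<epsilon> / 8)"
      if \<rho>: "\<rho> \<in> {1, d}" and z: "\<sigma>1 < Re z" "Re z \<le> 2" "\<bar>Im z\<bar> < H" for \<rho> z
    proof -
      have \<rho>': "\<rho> \<in> Rs" using \<rho> by (simp add: Rs_def)
      have "z \<in> Q" using z by (auto simp: Qmem)
      then obtain c where c: "c \<in> Cs" "z \<in> ball c (r / 2)" using Cs(3) by blast
      have hol: "(\<lambda>u. F (u + \<i> * of_real (\<rho> * \<tau>))) holomorphic_on cball c r"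
      proof (rule holomorphic_on_compose_gen[of "\<lambda>u. u + \<i> * of_real (\<rho> * \<tau>)" _ F "-{1}", unfolded o_def])
        show "(\<lambda>u. u + \<i> * of_real (\<rho> * \<tau>)) holomorphic_on cball c r" by (intro holomorphic_intros)
        show "F holomorphic_on -{1}" by (rule Fh)
        show "(\<lambda>u. u + \<i> * of_real (\<rho> * \<tau>)) ` cball c r \<subseteq> -{1}"
        proof
          fix v assume "v \<in> (\<lambda>u. u + \<i> * of_real (\<rho> * \<tau>)) ` cball c r"
          then obtain u where u: "v = u + \<i> * of_real (\<rho> * \<tau>)" "u \<in> cball c r" by auto
          have "c \<in> Q" using c Cs by auto
          hence "\<bar>Im c\<bar> \<le> H" by (auto simp: Qmem)
          moreover have "\<bar>Im (u - c)\<bar> \<le> r" using u(2) abs_Im_le_cmod[of "u - c"] by (simp add: dist_norm norm_minus_commute)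
          moreover have "Im u = Im c + Im (u - c)" by simp
          ultimately have "\<bar>Im u\<bar> \<le> B" using r(2) unfolding B_def by linarith
          thus "v \<in> -{1}" using off1[OF \<rho>' \<tau>1(1)] u(1) by auto
        qed
      qed
      have "(cmod (F (z + \<i> * of_real (\<rho> * \<tau>))))\<^sup>2 \<le> 2 * gf (\<rho>, c) \<tau>"
        unfolding gf_def fst_conv snd_conv
        by (rule norm_square_le_circle_mean[OF hol r(1)]) (use c(2) in \<open>simp add: dist_norm norm_minus_commute\<close>)
      also have "gf (\<rho>, c) \<tau> \<le> G0 \<tau>"
        unfolding G0_def using finI gf0 \<tau>1(1) c(1) \<rho>' by (intro member_le_sum) (auto simp: I_def)
      also have "2 * G0 \<tau> < 2 * \<eta>1" using \<tau>1(3) by simp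
      also have "2 * \<eta>1 \<le> r0\<^sup>2" by (simp add: \<eta>1_def)
      finally have "(cmod (F (z + \<i> * of_real (\<rho> * \<tau>))))\<^sup>2 < r0\<^sup>2" by simp
      hence "cmod (F (z + \<i> * of_real (\<rho> * \<tau>))) < r0" by (rule power2_less_imp_less) (use r0 in simp)
      thus ?thesis by (simp only: F_def S_def r0_def)
    qed
    have \<tau>H: "H \<le> \<bar>\<tau>\<bar>" using \<tau>1(1) T1(2) H by (simp add: B_def)
    have dH: "H \<le> \<bar>d * \<tau>\<bar>"
    proof -
      have "\<bar>d\<bar> * T1 \<le> \<bar>d\<bar> * \<tau>" using \<tau>1(1) by (intro mult_left_mono) auto
      moreover have "\<bar>d * \<tau>\<bar> = \<bar>d\<bar> * \<tau>" using \<tau>1(1) T1(1) by (simp add: abs_mult)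
      moreover have "\<bar>d\<bar> * T1 \<ge> B + 1" by (rule T1(3)) (simp add: Rs_def)
      ultimately show ?thesis unfolding B_def by linarith
    qed
    have ph: "\<forall>p\<in>primes_upto N. (1 + cos ((1 - d) * \<tau> * ln (real p))) / 2 > 1 - x\<^sup>2"
      using \<tau>1(2) unfolding V_def \<kappa>_def S_def by (rule CollectD)
    have cl_all: "\<forall>\<rho>\<in>{1, d}. \<forall>z. \<sigma>1 < Re z \<longrightarrow> Re z \<le> 2 \<longrightarrow> \<bar>Im z\<bar> < H \<longrightarrow>
        cmod (zeta (z + \<i> * of_real (\<rho> * \<tau>)) * euler_factor (primes_upto N) (z + \<i> * of_real (\<rho> * \<tau>)) - 1) < min (1 / 4) (\<epsilon> / 8)"
      by (intro ballI allI impI cl)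
    have x0: "0 \<le> x" using x(1) by simp
    have sK: "\<sigma>1 < Re s" "Re s \<le> 2" "\<bar>Im s\<bar> < H" using KH[OF s] K(2) s by auto
    note app = close_euler_product_imp_approximation[OF N2 \<sigma>1(1) \<tau>H dH cl_all x0 x(3)[unfolded S_def] ph \<epsilon> sK]
    show ?thesis by (intro conjI app)
  qed
  define Kf where "Kf = PiE S (\<lambda>_. {..2 * m})"
  \<comment> \<open>The central index at every prime: its frequency is 0 and its coefficient is a
    power of the central binomial coefficient.\<close>
  define k0 where "k0 = (\<lambda>p\<in>S. m)"
  have "\<exists>C1. \<forall>T\<ge>0. weight_coeff S m k0 * T - C1 \<le> integral {0..T} W"
  proof (rule trig_mean_lower[where Kf = Kf and \<mu> = "weight_freq S m (1 - d)" and w = "weight_coeff S m" and W = W and ?k0.0 = k0])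
    show "complex_of_real (W \<tau>) = (\<Sum>k\<in>Kf. of_real (weight_coeff S m k) * cis (weight_freq S m (1 - d) k * \<tau>))" for \<tau>
      unfolding W_def Kf_def by (rule weight_expansion[OF S])
    show "finite Kf" unfolding Kf_def using S by (intro finite_PiE) auto
    show "continuous_on UNIV W" by (rule Wc)
    show "weight_coeff S m k \<ge> 0" for k unfolding weight_coeff_def by (intro prod_nonneg) auto
    show "k0 \<in> Kf" by (auto simp: k0_def Kf_def)
    show "weight_freq S m (1 - d) k0 = 0" by (simp add: weight_freq_def k0_def)
  qed
  moreover have "weight_coeff S m k0 = w0" by (simp add: weight_coeff_def k0_def w0_def)
  ultimately obtain C1 where C1: "\<forall>T\<ge>0. w0 * T - C1 \<le> integral {0..T} W" by auto
  define c0 where "c0 = C1 / 2 + T1 + M / \<eta>1 * C0"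
  \<comment> \<open>Ensures |c0| \<le> 3 w0 T / 16. Of the main term w0 T / 2, at most w0 T / 8 is
    lost outside \<open>V\<close>, w0 T / 16 to the sieve error and 3 w0 T / 16 to
    \<open>c0\<close>, which leaves w0 T / 8.\<close>
  define T3 where "T3 = max (max T1 (max Ta Tb)) (16 * \<bar>c0\<bar> / (3 * w0))"
  have "G T \<in> sets lebesgue \<and> w0 / 8 * T \<le> measure lebesgue (G T) \<and>
    G T \<subseteq> {0..T} \<inter> {\<tau>. \<forall>s\<in>K. s + \<i> * of_real \<tau> \<in> log_zeta_dom \<and> s + \<i> * of_real (d * \<tau>) \<in> log_zeta_dom \<and>
           norm (log_zeta (s + \<i> * of_real \<tau>) - log_zeta (s + \<i> * of_real (d * \<tau>))) < \<epsilon>}" if T: "T \<ge> T3" for T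
  proof (intro conjI)
    have TT: "T1 \<le> T" "T \<ge> max Ta Tb" "0 \<le> T" using T T1(1) by (auto simp: T3_def)
    have G0c: "continuous_on {T1..T} G0" unfolding G0_def using gfc[OF TT(2)] by (intro continuous_on_sum) blast
    have G0nn: "G0 \<tau> \<ge> 0" if "\<tau> \<in> {T1..T}" for \<tau> unfolding G0_def using gf0 that by (intro sum_nonneg) auto
    have \<kappa>m: "\<kappa> ^ m \<ge> 0" using \<kappa> by simp
    have GT: "G T = {\<tau> \<in> {T1..T}. \<tau> \<in> V \<and> G0 \<tau> < \<eta>1}" by (simp add: G_def)
    show "G T \<in> sets lebesgue" unfolding GT
      by (rule weighted_good_set_measure(1)[where W = W and q = "\<kappa> ^ m"])
         (assumption | rule T1(1) TT(1) Wc W01 G0c Vo VW \<kappa>m \<eta>1 G0nn)+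
    have ws: "integral {0..T} W \<le> measure lebesgue (G T) + T1 + \<kappa> ^ m * T + 1 / \<eta>1 * integral {T1..T} (\<lambda>\<tau>. W \<tau> * G0 \<tau>)"
      unfolding GT by (rule weighted_good_set_measure(2)[where V = V])
         (assumption | rule T1(1) TT(1) Wc W01 G0c Vo VW \<kappa>m \<eta>1 G0nn)+
    define IW where "IW = integral {0..T} W"
    have IW: "IW \<ge> w0 * T - C1" "IW \<ge> 0" using C1 TT(3) W01
      by (auto simp: IW_def intro!: integral_nonneg integrable_continuous_interval continuous_on_subset[OF Wc])
    have WG: "integral {T1..T} (\<lambda>\<tau>. W \<tau> * G0 \<tau>) \<le> M * Bd T"
    proof -
      have "integral {T1..T} (\<lambda>\<tau>. W \<tau> * G0 \<tau>) = integral {T1..T} (\<lambda>\<tau>. \<Sum>i\<in>I. W \<tau> * gf i \<tau>)"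
        by (simp add: G0_def sum_distrib_left)
      also have "\<dots> = (\<Sum>i\<in>I. integral {T1..T} (\<lambda>\<tau>. W \<tau> * gf i \<tau>))"
        using finI gfc[OF TT(2)] by (intro integral_sum integrable_continuous_interval continuous_intros continuous_on_subset[OF Wc]) auto
      also have "\<dots> \<le> (\<Sum>i\<in>I. Bd T)" using gfc[OF TT(2)] by (intro sum_mono) blast
      also have "\<dots> = real (card I) * Bd T" by simp
      also have "\<dots> \<le> M * Bd T"
      proof (rule mult_right_mono[OF M(2)])
        have "C0 \<ge> 0" by (simp add: C0_def)
        thus "Bd T \<ge> 0" unfolding Bd_def using tail0 IW(2)[unfolded IW_def] \<eta> TT(3) by simp
      qed
      finally show ?thesis .
    qed
    have "1 / \<eta>1 * integral {T1..T} (\<lambda>\<tau>. W \<tau> * G0 \<tau>) \<le> 1 / \<eta>1 * (M * Bd T)"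
      using WG \<eta>1 by (intro mult_left_mono) auto
    also have "\<dots> = (2 * (M / \<eta>1 * tail)) * IW + M / \<eta>1 * C0 + (M / \<eta>1 * \<eta>) * T"
      by (simp add: Bd_def IW_def algebra_simps)
    also have "\<dots> \<le> (1 / 2) * IW + M / \<eta>1 * C0 + (w0 / 16) * T"
    proof -
      \<comment> \<open>The loss proportional to the mean of W: the choice of N limits it to one
        half.\<close>
      have "M / \<eta>1 * tail \<le> M / \<eta>1 * (\<eta>1 / (4 * M))"
        using Nt M \<eta>1 unfolding tail_def[symmetric] by (intro mult_left_mono) auto
      also have "\<dots> = 1 / 4" using M \<eta>1 by simp
      finally have "2 * (M / \<eta>1 * tail) \<le> 1 / 2" by linarith
      hence "(2 * (M / \<eta>1 * tail)) * IW \<le> (1 / 2) * IW" using IW(2) by (rule mult_right_mono)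
      moreover have e: "M / \<eta>1 * \<eta> = w0 / 16" using M \<eta>1 by (simp add: \<eta>_def)
      ultimately show ?thesis unfolding e by (intro add_mono order_refl)
    qed
    finally have e1: "1 / \<eta>1 * integral {T1..T} (\<lambda>\<tau>. W \<tau> * G0 \<tau>) \<le> (1 / 2) * IW + M / \<eta>1 * C0 + (w0 / 16) * T" .
    have e2: "\<kappa> ^ m * T \<le> w0 / 8 * T" using m(2) TT(3) unfolding w0_def by (intro mult_right_mono) auto
    have "IW \<le> measure lebesgue (G T) + T1 + \<kappa> ^ m * T + 1 / \<eta>1 * integral {T1..T} (\<lambda>\<tau>. W \<tau> * G0 \<tau>)"
      using ws unfolding IW_def .
    hence "measure lebesgue (G T) \<ge> (w0 * T) / 2 - w0 / 8 * T - w0 / 16 * T - c0"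
      using e1 e2 IW(1) unfolding c0_def by linarith
    moreover have "c0 \<le> 3 / 16 * w0 * T"
    proof -
      have "16 * \<bar>c0\<bar> / (3 * w0) \<le> T" using T by (simp add: T3_def)
      hence "16 * \<bar>c0\<bar> \<le> T * (3 * w0)" using w0 by (simp add: field_simps)
      thus ?thesis by (simp add: mult_ac)
    qed
    moreover have "w0 * T / 2 - w0 / 8 * T - w0 / 16 * T - 3 / 16 * w0 * T = w0 / 8 * T" by (simp add: algebra_simps)
    ultimately show "w0 / 8 * T \<le> measure lebesgue (G T)" by linarith
    show "G T \<subseteq> {0..T} \<inter> {\<tau>. \<forall>s\<in>K. s + \<i> * of_real \<tau> \<in> log_zeta_dom \<and> s + \<i> * of_real (d * \<tau>) \<in> log_zeta_dom \<and>
           norm (log_zeta (s + \<i> * of_real \<tau>) - log_zeta (s + \<i> * of_real (d * \<tau>))) < \<epsilon>}"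
    proof
      fix \<tau> assume \<tau>: "\<tau> \<in> G T"
      hence "\<tau> \<in> {0..T}" using T1(1) by (auto simp: G_def)
      thus "\<tau> \<in> {0..T} \<inter> {\<tau>. \<forall>s\<in>K. s + \<i> * of_real \<tau> \<in> log_zeta_dom \<and> s + \<i> * of_real (d * \<tau>) \<in> log_zeta_dom \<and>
           norm (log_zeta (s + \<i> * of_real \<tau>) - log_zeta (s + \<i> * of_real (d * \<tau>))) < \<epsilon>}"
        using Ggood[OF \<tau>] by blast
    qed
  qed
  moreover have "w0 / 8 > 0" using w0 by simp
  ultimately show ?thesis by blast
qed

theorem theorem2:
  fixes d \<epsilon> :: real and K :: "complex set"
  assumes "d \<noteq> 0"
    and "compact K"
    and "K \<subseteq> {s. 1 / 2 < Re s \<and> Re s < 1}"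
    and "connected (- K)"
    and "\<epsilon> > 0"
  shows "Liminf at_top (\<lambda>T::real. ereal (1 / T * measure lebesgue
           {\<tau> \<in> {0..T}.
              (\<forall>s\<in>K. s + \<i> * of_real \<tau> \<in> log_zeta_dom \<and> s + \<i> * of_real (d * \<tau>) \<in> log_zeta_dom) \<and>
              (SUP s\<in>K. ereal (norm (log_zeta (s + \<i> * of_real \<tau>) - log_zeta (s + \<i> * of_real (d * \<tau>)))))
                < ereal \<epsilon>})) > 0"
proof -
  define A where "A = (\<lambda>T::real. {\<tau> \<in> {0..T}.
              (\<forall>s\<in>K. s + \<i> * of_real \<tau> \<in> log_zeta_dom \<and> s + \<i> * of_real (d * \<tau>) \<in> log_zeta_dom) \<and>
              (SUP s\<in>K. ereal (norm (log_zeta (s + \<i> * of_real \<tau>) - log_zeta (s + \<i> * of_real (d * \<tau>)))))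
                < ereal \<epsilon>})"
  obtain \<delta> T3 where \<delta>: "\<delta> > 0" and T3: "\<forall>T\<ge>T3. \<exists>G. G \<in> sets lebesgue \<and> \<delta> * T \<le> measure lebesgue G \<and>
    G \<subseteq> {0..T} \<inter> {\<tau>. \<forall>s\<in>K. s + \<i> * of_real \<tau> \<in> log_zeta_dom \<and> s + \<i> * of_real (d * \<tau>) \<in> log_zeta_dom \<and>
           norm (log_zeta (s + \<i> * of_real \<tau>) - log_zeta (s + \<i> * of_real (d * \<tau>))) < \<epsilon>}"
    using approximation_positive_density[OF assms(1-3,5)] by (elim exE conjE)
  have "\<forall>\<^sub>F T in at_top. ereal \<delta> \<le> ereal (1 / T * measure lebesgue (A T))"
    using eventually_ge_at_top[of "max T3 1"]
  proof eventually_elim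
    case (elim T)
    hence T: "T \<ge> T3" "T \<ge> 1" by auto
    from T3[rule_format, OF T(1)] obtain G where G: "G \<in> sets lebesgue" "\<delta> * T \<le> measure lebesgue G"
      "G \<subseteq> {0..T} \<inter> {\<tau>. \<forall>s\<in>K. s + \<i> * of_real \<tau> \<in> log_zeta_dom \<and> s + \<i> * of_real (d * \<tau>) \<in> log_zeta_dom \<and>
           norm (log_zeta (s + \<i> * of_real \<tau>) - log_zeta (s + \<i> * of_real (d * \<tau>))) < \<epsilon>}"
      by (elim exE conjE)
    have GA: "G \<subseteq> A T" unfolding A_def approximation_set_measurable(1)[OF assms(2)] by (rule G(3))
    have "A T \<in> lmeasurable" unfolding A_def by (rule approximation_set_measurable(2)[OF assms(2)])
    from measure_mono_fmeasurable[OF GA G(1) this] have "\<delta> * T \<le> measure lebesgue (A T)" using G(2) by linarith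
    thus ?case using T(2) by (simp add: field_simps)
  qed
  hence "ereal \<delta> \<le> Liminf at_top (\<lambda>T. ereal (1 / T * measure lebesgue (A T)))" by (rule Liminf_bounded)
  moreover have "0 < ereal \<delta>" using \<delta> by simp
  ultimately show ?thesis unfolding A_def by (rule less_le_trans[rotated])
qed

end
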